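(* (Unconditional strong stability of the lowest order tent-implicit scheme.) On a causal tent, for any $v\in V_h^{\mathtt v}$ and any $0\le\tau\le1$, $$\|R^{\rm imp}_{h1}(\tau)v\|_{M(\tau)}^2\le\|v\|_{M_0}^2 .$$
   Context: **Coefficients.** $\Omega\subset\mathbb R^N$ is open and bounded, with a conforming simplicial mesh $\Omega_h$. $\mathcal L^{(j)}$ ($1\le j\le N$) and $\mathcal G$ are bounded symmetric $\mathbb R^{L\times L}$-valued functions on $\Omega$, constant on each mesh element, $\mathcal G$ uniformly positive definite, and $\sum_j\partial_j\mathcal L^{(j)}=0$ in the sense of distributions. $\mathcal D^{(\nu)}=\sum_j\nu_j\mathcal L^{(j)}$, and $\mathcal D=\mathcal D^{(n)}$ with $n$ the outward unit normal on the boundary considered. $c$ is the largest $|\lambda|$ with $\mathcal D^{(\nu)}(x)e=\lambda\mathcal G(x)e$, $e\ne0$, over all $x$ and unit $\nu$; $\hat c>c$ is fixed. **Tent.** For a mesh vertex $\mathtt v$, $\Omega^{\mathtt v}$ is the vertex patch (union of elements containing $\mathtt v$) and $\Omega_h^{\mathtt v}$ its set of elements. A tent is $T^{\mathtt v}=\{(x,t):x\in\Omega^{\mathtt v},\varphi_{\rm bot}(x)\le t\le\varphi_{\rm top}(x)\}$, with $\varphi_{\rm bot}\le\varphi_{\rm top}$ continuous on $\Omega^{\mathtt v}$, linear on each element, and equal at all vertices of the patch other than $\mathtt v$. It is causal: $\|\operatorname{grad}_x\varphi_{\rm bot}\|_2,\|\operatorname{grad}_x\varphi_{\rm top}\|_2\le1/\hat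 c$. $\delta=\varphi_{\rm top}-\varphi_{\rm bot}$ vanishes on $\partial\Omega^{\mathtt v}\setminus\partial\Omega$. **Spaces and operators.** $(\cdot,\cdot)_{\mathtt v}$ is the inner product of $L^2(\Omega^{\mathtt v})^L$; $V_h^{\mathtt v}=\{v:v|_K\in P_p(K)^L,\ K\in\Omega_h^{\mathtt v}\}$, $p\ge0$. $M_0w=\mathcal Gw-\sum_j(\partial_j\varphi_{\rm bot})\mathcal L^{(j)}w$, $M_1w=\sum_j(\partial_j\delta)\mathcal L^{(j)}w$, $M(\tau)=M_0-\tau M_1$ (these leave $V_h^{\mathtt v}$ invariant, and by causality $M(\tau)$ is selfadjoint positive definite for $0\le\tau\le1$); $\|z\|_{M(\tau)}=(M(\tau)z,z)_{\mathtt v}^{1/2}$, $\|\cdot\|_{M_0}=\|\cdot\|_{M(0)}$. **DG form.** $a(w,v)=\sum_{K\in\Omega_h^{\mathtt v}}\big[\sum_j(\delta\mathcal L^{(j)}w,\partial_jv)_K-(\delta\hat F^n_w,v)_{\partial K}\big]$, with $\hat F_w^n=\mathcal D\{w\}+S[\![w]\!]$ on $\partial K\setminus\partial\Omega$ and $\hat F_w^n=\frac12(\mathcal D+B)w$ on $\partial K\cap\partial\Omega$, where $\{w\}=\frac12(w+w_o)$, $[\![w]\!]=w-w_o$, $w_o$ being the value from the neighboring element (facets in $\partial\Omega^{\mathtt v}\setminus\partial\Omega$ contribute nothing since $\delta=0$ there). $S$ (bounded, single-valued on interior facets) and $B$ (bounded, on $\partial\Omega$) are $\mathbb R^{L\times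 L}$-valued with $S+S^t\ge0$, $B+B^t\ge0$. $A_h:V_h^{\mathtt v}\to V_h^{\mathtt v}$ is defined by $(A_hw,v)_{\mathtt v}=a(w,v)$. **Implicit flow.** $R^{\rm imp}_{h1}(\tau)=M(\tau)^{-1}(I-\tau A_hM(\tau)^{-1})^{-1}M_0:V_h^{\mathtt v}\to V_h^{\mathtt v}$; both inverses exist. *)

theory Defs
  imports "HOL-Analysis.Analysis"
begin

section \<open>Partial derivatives and distributional divergence\<close>

definition partial :: "'n \<Rightarrow> (real^'n \<Rightarrow> 'b::real_normed_vector) \<Rightarrow> real^'n \<Rightarrow> 'b"
  where "partial j f x = frechet_derivative f (at x) (axis j 1)"

definition grad :: "(real^'n \<Rightarrow> real) \<Rightarrow> real^'n \<Rightarrow> real^'n"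
  where "grad f x = (\<chi> j. partial j f x)"

primrec iterated_partial :: "'n list \<Rightarrow> (real^'n \<Rightarrow> real) \<Rightarrow> real^'n \<Rightarrow> real" where
  "iterated_partial [] f = f"
| "iterated_partial (j # js) f = partial j (iterated_partial js f)"

text \<open>The test functions \<open>C\<^sub>c\<^sup>\<infinity>(\<Omega>)\<close>.\<close>

definition test_function :: "(real^'n) set \<Rightarrow> (real^'n \<Rightarrow> real) \<Rightarrow> bool"
  where "test_function \<Omega> \<phi> \<longleftrightarrow>
    (\<forall>js x. iterated_partial js \<phi> differentiable (at x)) \<and>
    compact (closure {x. \<phi> x \<noteq> 0}) \<and> closure {x. \<phi> x \<noteq> 0} \<subseteq> \<Omega>"

text \<open>The integral is taken with respect to \<^const>\<open>lebesgue\<close> rather than \<^const>\<open>lborel\<close>, because the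
  values of a coefficient on the (negligible) mesh skeleton are unrestricted, so that the
  coefficients need not be Borel measurable.\<close>

definition divergence_free ::
    "(real^'n) set \<Rightarrow> ('n \<Rightarrow> real^'n \<Rightarrow> real^'l^'l) \<Rightarrow> bool"
  where "divergence_free \<Omega> \<L> \<longleftrightarrow>
    (\<forall>\<phi>. test_function \<Omega> \<phi> \<longrightarrow>
      (LINT x:\<Omega>|lebesgue. (\<Sum>j\<in>UNIV. partial j \<phi> x *\<^sub>R \<L> j x)) = 0)"


section \<open>Simplicial meshes\<close>

text \<open>Elements are closed simplices. The last condition excludes sets such as a polyhedron with
  a nowhere dense set of positive measure removed; it is automatic if \<open>\<Omega>\<close> is the interior of its
  closure.\<close>

definition conforming_mesh :: "(real^'n) set \<Rightarrow> (real^'n) set set \<Rightarrow> bool"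
  where "conforming_mesh \<Omega> \<T> \<longleftrightarrow>
    finite \<T> \<and>
    (\<forall>K\<in>\<T>. int CARD('n) simplex K) \<and>
    (\<forall>K\<in>\<T>. \<forall>K'\<in>\<T>. (K \<inter> K') face_of K \<and> (K \<inter> K') face_of K') \<and>
    \<Union>\<T> = closure \<Omega> \<and>
    (\<forall>K\<in>\<T>. interior K \<subseteq> \<Omega>)"

definition mesh_vertices :: "(real^'n) set set \<Rightarrow> (real^'n) set"
  where "mesh_vertices \<T> = {a. \<exists>K\<in>\<T>. a extreme_point_of K}"

definition patch :: "(real^'n) set set \<Rightarrow> real^'n \<Rightarrow> (real^'n) set set"
  where "patch \<T> a = {K\<in>\<T>. a \<in> K}"

definition mesh_facets :: "(real^'n) set set \<Rightarrow> (real^'n) set set"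
  where "mesh_facets \<T> = {F. \<exists>K\<in>\<T>. F facet_of K}"

definition outward_normal :: "(real^'n) set \<Rightarrow> (real^'n) set \<Rightarrow> real^'n"
  where "outward_normal K F =
    (THE n. norm n = 1 \<and> (\<exists>b. F \<subseteq> {x. n \<bullet> x = b} \<and> K \<subseteq> {x. n \<bullet> x \<le> b}))"

text \<open>The element on the other side of the facet \<open>F\<close> of \<open>K\<close>.\<close>

definition neighbor :: "(real^'n) set set \<Rightarrow> (real^'n) set \<Rightarrow> (real^'n) set \<Rightarrow> (real^'n) set"
  where "neighbor \<T> K F = (THE K'. K' \<in> \<T> \<and> K' \<noteq> K \<and> F facet_of K')"

text \<open>The surface measure on a facet \<open>F\<close>, i.e. \<open>(N-1)\<close>-dimensional Lebesgue measure on \<open>F\<close> inside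
  its hyperplane: by Fubini, it is the image, under the orthogonal projection to the hyperplane
  (the map \<^term>\<open>closest_point (affine hull F)\<close>), of Lebesgue measure on the right prism of total
  height 1 with mid-section \<open>F\<close>. For \<open>N = 1\<close> it is the unit mass at the point \<open>F\<close>.\<close>

definition surface_measure :: "(real^'n) set \<Rightarrow> (real^'n) measure"
  where "surface_measure F =
    completion (distr
      (restrict_space lborel
        {x. closest_point (affine hull F) x \<in> F \<and>
            dist x (closest_point (affine hull F) x) \<le> 1 / 2})
      borel (closest_point (affine hull F)))"

text \<open>The constant value on the element \<open>K\<close> of a function that is constant on each element. Constancy
  is only required in the interior, since such functions jump across facets.\<close>

definition constant_on_elements :: "(real^'n) set set \<Rightarrow> (real^'n \<Rightarrow> 'b) \<Rightarrow> bool"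
  where "constant_on_elements \<T> f \<longleftrightarrow> (\<forall>K\<in>\<T>. \<exists>C. \<forall>x\<in>interior K. f x = C)"

definition elem_val :: "(real^'n) set \<Rightarrow> (real^'n \<Rightarrow> 'b) \<Rightarrow> 'b"
  where "elem_val K f = (THE C. \<forall>x\<in>interior K. f x = C)"


section \<open>Coefficients, wave speed and numerical flux parameters\<close>

definition psd :: "real^'l^'l \<Rightarrow> bool"
  where "psd A \<longleftrightarrow> (\<forall>e. 0 \<le> e \<bullet> (A *v e))"

definition bounded_symmetric :: "(real^'n) set \<Rightarrow> (real^'n \<Rightarrow> real^'l^'l) \<Rightarrow> bool"
  where "bounded_symmetric \<Omega> A \<longleftrightarrow>
    bounded (A ` \<Omega>) \<and> (\<forall>x\<in>\<Omega>. transpose (A x) = A x)"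

definition uniformly_pos_def :: "(real^'n) set \<Rightarrow> (real^'n \<Rightarrow> real^'l^'l) \<Rightarrow> bool"
  where "uniformly_pos_def \<Omega> A \<longleftrightarrow>
    (\<exists>\<gamma>>0. \<forall>x\<in>\<Omega>. \<forall>e. \<gamma> * (norm e)\<^sup>2 \<le> e \<bullet> (A x *v e))"

definition wave_speed ::
    "(real^'n) set \<Rightarrow> ('n \<Rightarrow> real^'n \<Rightarrow> real^'l^'l) \<Rightarrow> (real^'n \<Rightarrow> real^'l^'l) \<Rightarrow> real"
  where "wave_speed \<Omega> \<L> \<G> =
    Sup {\<bar>\<mu>\<bar> | \<mu>. \<exists>x\<in>\<Omega>. \<exists>\<nu> e. norm \<nu> = 1 \<and> e \<noteq> 0 \<and>
      (\<Sum>j\<in>UNIV. \<nu> $ j *\<^sub>R \<L> j x) *v e = \<mu> *\<^sub>R (\<G> x *v e)}"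

text \<open>Admissibility of a flux parameter on the part \<open>X\<close> of the mesh skeleton. The parameter is a
  function of the point only, hence single-valued across facets.\<close>

definition flux_parameter ::
    "(real^'n) set set \<Rightarrow> (real^'n) set \<Rightarrow> (real^'n \<Rightarrow> real^'l^'l) \<Rightarrow> bool"
  where "flux_parameter \<T> X A \<longleftrightarrow>
    (\<forall>F\<in>mesh_facets \<T>. A \<in> borel_measurable (restrict_space (surface_measure F) X)) \<and>
    bounded (A ` X) \<and> (\<forall>x\<in>X. psd (A x + transpose (A x)))"


section \<open>Causal tents\<close>

definition affine_on_elements :: "(real^'n) set set \<Rightarrow> (real^'n \<Rightarrow> real) \<Rightarrow> bool"
  where "affine_on_elements \<T> \<phi> \<longleftrightarrow> (\<forall>K\<in>\<T>. \<exists>g b. \<forall>x\<in>K. \<phi> x = g \<bullet> x + b)"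

text \<open>The tent \<open>{(x, t). x \<in> \<Union>(patch \<T> a) \<and> \<phi>bot x \<le> t \<le> \<phi>top x}\<close> is represented by its bottom and top.\<close>

definition tent ::
    "(real^'n) set set \<Rightarrow> real^'n \<Rightarrow> (real^'n \<Rightarrow> real) \<Rightarrow> (real^'n \<Rightarrow> real) \<Rightarrow> bool"
  where "tent \<T> a \<phi>bot \<phi>top \<longleftrightarrow>
    a \<in> mesh_vertices \<T> \<and>
    continuous_on (\<Union>(patch \<T> a)) \<phi>bot \<and> continuous_on (\<Union>(patch \<T> a)) \<phi>top \<and>
    affine_on_elements (patch \<T> a) \<phi>bot \<and> affine_on_elements (patch \<T> a) \<phi>top \<and>
    (\<forall>x\<in>\<Union>(patch \<T> a). \<phi>bot x \<le> \<phi>top x) \<and>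
    (\<forall>b\<in>mesh_vertices (patch \<T> a). b \<noteq> a \<longrightarrow> \<phi>bot b = \<phi>top b)"

definition causal ::
    "(real^'n) set set \<Rightarrow> real^'n \<Rightarrow> real \<Rightarrow> (real^'n \<Rightarrow> real) \<Rightarrow> bool"
  where "causal \<T> a c \<phi> \<longleftrightarrow>
    (\<forall>K\<in>patch \<T> a. \<forall>x\<in>interior K. norm (grad \<phi> x) \<le> 1 / c)"


section \<open>Broken polynomials\<close>

text \<open>Vector-valued polynomials of total degree at most \<open>p\<close>.\<close>

definition polys :: "nat \<Rightarrow> (real^'n \<Rightarrow> real^'l) set"
  where "polys p =
    {f. \<exists>c :: ('n \<Rightarrow> nat) \<Rightarrow> real^'l.
      \<forall>x. f x = (\<Sum>\<alpha> | sum \<alpha> UNIV \<le> p. (\<Prod>i\<in>UNIV. (x $ i) ^ \<alpha> i) *\<^sub>R c \<alpha>)}"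

text \<open>A piecewise polynomial function is given by the family of its pieces, where the piece on \<open>K\<close> is
  the polynomial function on the whole space that extends the restriction to \<open>K\<close>; it also
  provides the trace from \<open>K\<close> on the facets of \<open>K\<close>. Pieces on non-elements are 0, so that
  equality of functions is equality of all pieces.\<close>

type_synonym ('n, 'l) broken = "(real^'n) set \<Rightarrow> real^'n \<Rightarrow> real^'l"

definition broken_polys :: "(real^'n) set set \<Rightarrow> nat \<Rightarrow> ('n::finite, 'l::finite) broken set"
  where "broken_polys \<T> p =
    {v. (\<forall>K\<in>\<T>. v K \<in> polys p) \<and> (\<forall>K. K \<notin> \<T> \<longrightarrow> v K = (\<lambda>x. 0))}"


section \<open>The discontinuous Galerkin scheme on a tent\<close>

locale tent_dg =
  fixes \<Omega> :: "(real^'n) set"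
    and \<T> :: "(real^'n) set set"
    and \<L> :: "'n \<Rightarrow> real^'n \<Rightarrow> real^'l^'l"
    and \<G> :: "real^'n \<Rightarrow> real^'l^'l"
    and a :: "real^'n"
    and \<phi>bot \<phi>top :: "real^'n \<Rightarrow> real"
    and S B :: "real^'n \<Rightarrow> real^'l^'l"
    and p :: nat
begin

definition V\<^sub>h :: "('n, 'l) broken set"
  where "V\<^sub>h = broken_polys (patch \<T> a) p"

definition ip :: "('n, 'l) broken \<Rightarrow> ('n, 'l) broken \<Rightarrow> real"
  where "ip w v = (\<Sum>K\<in>patch \<T> a. LINT x:K|lborel. w K x \<bullet> v K x)"

definition \<delta> :: "real^'n \<Rightarrow> real"
  where "\<delta> x = \<phi>top x - \<phi>bot x"

definition M\<^sub>0 :: "('n, 'l) broken \<Rightarrow> ('n, 'l) broken"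
  where "M\<^sub>0 w = (\<lambda>K x. elem_val K \<G> *v w K x -
    (\<Sum>j\<in>UNIV. elem_val K (partial j \<phi>bot) *\<^sub>R (elem_val K (\<L> j) *v w K x)))"

definition M\<^sub>1 :: "('n, 'l) broken \<Rightarrow> ('n, 'l) broken"
  where "M\<^sub>1 w = (\<lambda>K x.
    \<Sum>j\<in>UNIV. elem_val K (partial j \<delta>) *\<^sub>R (elem_val K (\<L> j) *v w K x))"

definition M :: "real \<Rightarrow> ('n, 'l) broken \<Rightarrow> ('n, 'l) broken"
  where "M \<tau> w = (\<lambda>K x. M\<^sub>0 w K x - \<tau> *\<^sub>R M\<^sub>1 w K x)"

definition M_norm :: "real \<Rightarrow> ('n, 'l) broken \<Rightarrow> real"
  where "M_norm \<tau> z = sqrt (ip (M \<tau> z) z)"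

text \<open>\<open>\<D>\<close> on the facet \<open>F\<close> as seen from \<open>K\<close>.\<close>

definition D :: "(real^'n) set \<Rightarrow> (real^'n) set \<Rightarrow> real^'l^'l"
  where "D K F = (\<Sum>j\<in>UNIV. outward_normal K F $ j *\<^sub>R elem_val K (\<L> j))"

text \<open>On a facet of the patch whose other side is an element outside of the patch, the outer trace is
  0 by the convention for broken functions; this is immaterial as \<open>\<delta>\<close> vanishes there.\<close>

definition flux :: "('n, 'l) broken \<Rightarrow> (real^'n) set \<Rightarrow> (real^'n) set \<Rightarrow> real^'n \<Rightarrow> real^'l"
  where "flux w K F x =
    (let w\<^sub>i = w K x; w\<^sub>o = w (neighbor \<T> K F) x in
      if x \<in> frontier \<Omega> then (1 / 2) *\<^sub>R ((D K F + B x) *v w\<^sub>i)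
      else D K F *v ((1 / 2) *\<^sub>R (w\<^sub>i + w\<^sub>o)) + S x *v (w\<^sub>i - w\<^sub>o))"

definition dg_form :: "('n, 'l) broken \<Rightarrow> ('n, 'l) broken \<Rightarrow> real"
  where "dg_form w v = (\<Sum>K\<in>patch \<T> a.
    (\<Sum>j\<in>UNIV. LINT x:K|lborel. (\<delta> x *\<^sub>R (elem_val K (\<L> j) *v w K x)) \<bullet> partial j (v K) x) -
    (\<Sum>F | F facet_of K. LINT x:F|surface_measure F. (\<delta> x *\<^sub>R flux w K F x) \<bullet> v K x))"

definition A\<^sub>h :: "('n, 'l) broken \<Rightarrow> ('n, 'l) broken"
  where "A\<^sub>h w = (THE z. z \<in> V\<^sub>h \<and> (\<forall>v\<in>V\<^sub>h. ip z v = dg_form w v))"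

definition M_inv :: "real \<Rightarrow> ('n, 'l) broken \<Rightarrow> ('n, 'l) broken"
  where "M_inv \<tau> = the_inv_into V\<^sub>h (M \<tau>)"

text \<open>\<open>R_imp \<tau> = M(\<tau>)\<^sup>-\<^sup>1 \<circ> (I - \<tau> A\<^sub>h M(\<tau>)\<^sup>-\<^sup>1)\<^sup>-\<^sup>1 \<circ> M\<^sub>0\<close>, with inverses of operators on \<open>V\<^sub>h\<close>.\<close>

definition R_imp :: "real \<Rightarrow> ('n, 'l) broken \<Rightarrow> ('n, 'l) broken"
  where "R_imp \<tau> v =
    M_inv \<tau> (the_inv_into V\<^sub>h (\<lambda>z K x. z K x - \<tau> *\<^sub>R A\<^sub>h (M_inv \<tau> z) K x) (M\<^sub>0 v))"

end

end

theory Submission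
  imports Defs "HOL-Library.Function_Algebras"
begin

text \<open>
  Let \<open>u\<close> be the result of the implicit step, so that \<open>M(\<tau>) u - \<tau> A\<^sub>h u = M\<^sub>0 v\<close>. Testing with \<open>u\<close>, the
  claim reduces to the dissipation inequality \<open>a(u, u) \<le> - (M\<^sub>1 u, u) / 2\<close>: together with
  \<open>M(\<tau>) = M\<^sub>0 - \<tau> M\<^sub>1\<close> it yields \<open>(M(\<tau>) u, u) + (M\<^sub>0 u, u) \<le> 2 (M\<^sub>0 v, u)\<close>, and Young's inequality for
  the inner product given by \<open>M\<^sub>0\<close> absorbs \<open>(M\<^sub>0 u, u)\<close>. With \<open>v = 0\<close> the same estimate gives
  invertibility of \<open>I - \<tau> A\<^sub>h M(\<tau>)\<^sup>-\<^sup>1\<close>.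

  For the dissipation inequality one integrates by parts on each element. The facet terms
  then combine to the nonnegative forms of \<open>S\<close> and \<open>B\<close>, because a divergence free \<open>\<L>\<close> has no
  normal jump; facets that do not contain \<open>a\<close> do not contribute as \<open>\<delta>\<close> vanishes there.
\<close>

section \<open>Continuously differentiable functions\<close>

text \<open>A surface measure is here the image of Lebesgue measure on a prism, so Gauss's theorem
  is derived from volume integrals alone. A simplex is a cone over each of its facets; slicing it
  parallel to the facet reduces a radial field to one-dimensional integrals along rays. This is done
  first for nonnegative integrands, where Fubini needs no integrability. That \<open>\<L>\<close>
  has no normal jump is given only distributionally. It becomes an identity between two constant
  matrices by testing with a smooth bump near one point of the facet and applying Gauss on both
  sides of it. The factor 1/2 in the dissipation inequality comes from the symmetry of
  \<open>\<L> j\<close>: differentiating \<open>\<delta> (\<L> j w) . w\<close> produces the volume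
  term twice and the gradient of \<open>\<delta>\<close> once. Normals, neighbors, element values,
  \<open>A\<^sub>h\<close> and the inverses are definite descriptions, so each needs existence and
  uniqueness before it can be computed with; for the inverses, finite dimension reduces this to
  injectivity. Causality enters through the definiteness of \<open>M \<tau>\<close>.\<close>

text \<open>Continuity of the derivative is asked direction by direction. On finite-dimensional
  spaces this is the usual notion, and it avoids a topology on derivatives.\<close>

definition c1 :: "('a::real_normed_vector \<Rightarrow> 'b::real_normed_vector) \<Rightarrow> bool"
  where "c1 f \<longleftrightarrow> (\<exists>f'. (\<forall>x. (f has_derivative f' x) (at x)) \<and> (\<forall>v. continuous_on UNIV (\<lambda>x. f' x v)))"

lemma c1_differentiable: "c1 f \<Longrightarrow> f differentiable (at x)"
  by (auto simp: c1_def differentiable_def)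

lemma c1_has_derivative: "c1 f \<Longrightarrow> (f has_derivative frechet_derivative f (at x)) (at x)"
  using c1_differentiable frechet_derivative_works by blast

lemma c1_continuous_frechet_derivative:
  assumes "c1 f" shows "continuous_on UNIV (\<lambda>x. frechet_derivative f (at x) v)"
proof -
  obtain f' where f': "\<And>x. (f has_derivative f' x) (at x)" "\<And>v. continuous_on UNIV (\<lambda>x. f' x v)"
    using assms by (auto simp: c1_def)
  have "frechet_derivative f (at x) = f' x" for x
    using f'(1) frechet_derivative_at by metis
  then show ?thesis using f'(2) by simp
qed

lemma c1_continuous_on: "c1 f \<Longrightarrow> continuous_on A f"
  by (meson c1_has_derivative continuous_at_imp_continuous_on has_derivative_continuous)

lemma c1_const: "c1 (\<lambda>x. c)"
  unfolding c1_def by (rule exI[of _ "\<lambda>x v. 0"]) auto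

lemma c1_bounded_linear:
  assumes "bounded_linear f" shows "c1 f"
  unfolding c1_def by (rule exI[of _ "\<lambda>x. f"]) (auto intro: bounded_linear_imp_has_derivative assms)

lemma c1_add: assumes "c1 f" "c1 g" shows "c1 (\<lambda>x. f x + g x)"
proof -
  obtain f' g' where f': "\<And>x. (f has_derivative f' x) (at x)" "\<And>v. continuous_on UNIV (\<lambda>x. f' x v)"
    and g': "\<And>x. (g has_derivative g' x) (at x)" "\<And>v. continuous_on UNIV (\<lambda>x. g' x v)"
    using assms by (auto simp: c1_def)
  show ?thesis unfolding c1_def
    by (rule exI[of _ "\<lambda>x v. f' x v + g' x v"]) (auto intro!: has_derivative_add f' g' continuous_intros)
qed

lemma c1_sum: assumes "\<And>i. i \<in> I \<Longrightarrow> c1 (f i)" shows "c1 (\<lambda>x. \<Sum>i\<in>I. f i x)"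
proof (cases "finite I")
  case True
  then show ?thesis using assms
    by (induction I) (auto intro: c1_const c1_add)
qed (simp add: c1_const)

lemma c1_bounded_bilinear:
  assumes b: "bounded_bilinear b" and "c1 f" "c1 g" shows "c1 (\<lambda>x. b (f x) (g x))"
proof -
  obtain f' g' where f': "\<And>x. (f has_derivative f' x) (at x)" "\<And>v. continuous_on UNIV (\<lambda>x. f' x v)"
    and g': "\<And>x. (g has_derivative g' x) (at x)" "\<And>v. continuous_on UNIV (\<lambda>x. g' x v)"
    using assms by (auto simp: c1_def)
  have "continuous_on UNIV (\<lambda>x. b (f x) (g' x v) + b (f' x v) (g x))" for v
    by (rule continuous_on_add; rule bounded_bilinear.continuous_on[OF b])
      (use assms f' g' in \<open>auto intro: c1_continuous_on\<close>)
  then show ?thesis unfolding c1_def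
    by (intro exI[of _ "\<lambda>x v. b (f x) (g' x v) + b (f' x v) (g x)"])
      (auto intro!: bounded_bilinear.FDERIV[OF b] f' g')
qed

lemma c1_compose_bounded_linear:
  assumes "bounded_linear b" "c1 f" shows "c1 (\<lambda>x. b (f x))"
proof -
  obtain f' where f': "\<And>x. (f has_derivative f' x) (at x)" "\<And>v. continuous_on UNIV (\<lambda>x. f' x v)"
    using assms by (auto simp: c1_def)
  show ?thesis unfolding c1_def
    by (rule exI[of _ "\<lambda>x v. b (f' x v)"])
      (auto intro!: bounded_linear.has_derivative[OF assms(1)] f'
        bounded_linear.continuous_on[OF assms(1)])
qed

lemma c1_prod:
  fixes f :: "'i \<Rightarrow> 'a::real_normed_vector \<Rightarrow> 'b::{real_normed_algebra,comm_ring_1}"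
  assumes "\<And>i. i \<in> I \<Longrightarrow> c1 (f i)" shows "c1 (\<lambda>x. \<Prod>i\<in>I. f i x)"
proof (cases "finite I")
  case True
  then show ?thesis using assms
    by (induction I) (auto intro: c1_const c1_bounded_bilinear[OF bounded_bilinear_mult])
qed (simp add: c1_const)

lemma c1_power:
  fixes f :: "'a::real_normed_vector \<Rightarrow> 'b::{real_normed_algebra,comm_ring_1}"
  assumes "c1 f" shows "c1 (\<lambda>x. f x ^ k)"
  by (induction k) (auto intro: c1_const c1_bounded_bilinear[OF bounded_bilinear_mult] assms)

section \<open>Slicing and integration over cones\<close>

lemma nn_integral_lborel_translation:
  fixes g :: "'a::euclidean_space \<Rightarrow> ennreal"
  assumes [measurable]: "g \<in> borel_measurable borel"
  shows "(\<integral>\<^sup>+x. g (c + x) \<partial>lborel) = (\<integral>\<^sup>+x. g x \<partial>lborel)"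
  by (subst (2) lborel_distr_plus[symmetric, of c]) (simp add: nn_integral_distr)

lemma nn_integral_lborel_scale:
  fixes g :: "'a::euclidean_space \<Rightarrow> ennreal"
  assumes [measurable]: "g \<in> borel_measurable borel" and "h > 0"
  shows "(\<integral>\<^sup>+x. g x \<partial>lborel) = ennreal (h ^ DIM('a)) * (\<integral>\<^sup>+x. g (h *\<^sub>R x) \<partial>lborel)"
  using assms(2) by (subst lborel_affine[of h 0])
     (simp_all add: nn_integral_density nn_integral_distr nn_integral_cmult)

text \<open>Fubini along an arbitrary unit vector \<open>n\<close>: the hyperplane orthogonal to \<open>n\<close> is thickened to a
  slab, so that only translations of full-dimensional Lebesgue measure are needed.\<close>

lemma nn_integral_slab:
  fixes g :: "'a::euclidean_space \<Rightarrow> ennreal"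
  assumes [measurable]: "g \<in> borel_measurable borel" and n: "norm n = 1"
  shows "(\<integral>\<^sup>+x. g x \<partial>lborel) =
    (\<integral>\<^sup>+y. (\<integral>\<^sup>+t. g (y - (n \<bullet> y) *\<^sub>R n + t *\<^sub>R n) \<partial>lborel) * indicator {y. \<bar>n \<bullet> y\<bar> \<le> 1/2} y \<partial>lborel)"
proof -
  have nn: "n \<bullet> n = 1" using n by (simp add: norm_eq_1)
  let ?I = "\<lambda>s. indicator {s. \<bar>s\<bar> \<le> 1/2} (s::real) :: ennreal"
  \<comment> \<open>A point lies in the slab translated by t for a set of t of length 1. Inserting
    this factor 1 is what allows Fubini to trade x for a pair of slab point and height.\<close>
  have I: "(\<integral>\<^sup>+t. ?I (s - t) \<partial>lborel) = 1" for s
  proof -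
    have "(\<integral>\<^sup>+t. ?I (s - t) \<partial>lborel) = (\<integral>\<^sup>+t. indicator {s - 1/2 .. s + 1/2} t \<partial>lborel)"
      by (rule nn_integral_cong) (auto simp: indicator_def abs_if split: if_splits)
    then show ?thesis by simp
  qed
  have e1: "(\<integral>\<^sup>+x. g x * ?I (n \<bullet> x - t) \<partial>lborel) = (\<integral>\<^sup>+y. g (t *\<^sub>R n + y) * ?I (n \<bullet> y) \<partial>lborel)" for t
    using nn_integral_lborel_translation[of "\<lambda>x. g x * ?I (n \<bullet> x - t)" "t *\<^sub>R n"]
    by (simp add: inner_add_right nn)
  \<comment> \<open>Shifting t by the height of y replaces y by its projection to the
    hyperplane.\<close>
  have e2: "(\<integral>\<^sup>+t. g (t *\<^sub>R n + y) \<partial>lborel) = (\<integral>\<^sup>+t. g (y - (n \<bullet> y) *\<^sub>R n + t *\<^sub>R n) \<partial>lborel)" for y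
    by (subst (1) nn_integral_real_affine[where c=1 and t="- (n \<bullet> y)"]) (auto simp: algebra_simps)
  have "(\<integral>\<^sup>+x. g x \<partial>lborel) = (\<integral>\<^sup>+x. g x * (\<integral>\<^sup>+t. ?I (n \<bullet> x - t) \<partial>lborel) \<partial>lborel)"
    unfolding I by simp
  also have "\<dots> = (\<integral>\<^sup>+x. (\<integral>\<^sup>+t. g x * ?I (n \<bullet> x - t) \<partial>lborel) \<partial>lborel)"
    by (simp add: nn_integral_cmult)
  also have "\<dots> = (\<integral>\<^sup>+t. (\<integral>\<^sup>+x. g x * ?I (n \<bullet> x - t) \<partial>lborel) \<partial>lborel)"
    by (rule lborel_pair.Fubini'[symmetric]) measurable
  also have "\<dots> = (\<integral>\<^sup>+t. (\<integral>\<^sup>+y. g (t *\<^sub>R n + y) * ?I (n \<bullet> y) \<partial>lborel) \<partial>lborel)"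
    by (simp only: e1)
  also have "\<dots> = (\<integral>\<^sup>+y. (\<integral>\<^sup>+t. g (t *\<^sub>R n + y) * ?I (n \<bullet> y) \<partial>lborel) \<partial>lborel)"
    by (rule lborel_pair.Fubini') measurable
  also have "\<dots> = (\<integral>\<^sup>+y. (\<integral>\<^sup>+t. g (t *\<^sub>R n + y) \<partial>lborel) * ?I (n \<bullet> y) \<partial>lborel)"
    by (simp add: nn_integral_multc)
  also have "\<dots> = (\<integral>\<^sup>+y. (\<integral>\<^sup>+t. g (y - (n \<bullet> y) *\<^sub>R n + t *\<^sub>R n) \<partial>lborel) * ?I (n \<bullet> y) \<partial>lborel)"
    by (simp only: e2)
  finally show ?thesis by (simp add: indicator_def)
qed

text \<open>Projection and height separate under \<open>nn_integral_slab\<close>, so a weight in the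
  height counts only through its total mass. Hence slabs of any position or thickness can be
  exchanged for the standard one.\<close>

lemma nn_integral_slab_weight:
  fixes G :: "'a::euclidean_space \<Rightarrow> ennreal" and w :: "real \<Rightarrow> ennreal"
  assumes [measurable]: "G \<in> borel_measurable borel" "w \<in> borel_measurable borel" and n: "norm n = 1"
  shows "(\<integral>\<^sup>+y. G (y - (n \<bullet> y) *\<^sub>R n) * w (n \<bullet> y) \<partial>lborel) =
    (\<integral>\<^sup>+t. w t \<partial>lborel) * (\<integral>\<^sup>+y. G (y - (n \<bullet> y) *\<^sub>R n) * indicator {y. \<bar>n \<bullet> y\<bar> \<le> 1/2} y \<partial>lborel)"
proof -
  let ?P = "\<lambda>y. y - (n \<bullet> y) *\<^sub>R n" and ?I = "indicator {y. \<bar>n \<bullet> y\<bar> \<le> 1/2}"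
  have nn: "n \<bullet> n = 1" using n by (simp add: norm_eq_1)
  have "(\<integral>\<^sup>+y. G (?P y) * w (n \<bullet> y) \<partial>lborel) =
    (\<integral>\<^sup>+y. (\<integral>\<^sup>+t. G (?P y) * w t \<partial>lborel) * ?I y \<partial>lborel)"
    by (subst nn_integral_slab[OF _ n]) (auto simp: inner_simps nn)
  also have "\<dots> = (\<integral>\<^sup>+y. (\<integral>\<^sup>+t. w t \<partial>lborel) * (G (?P y) * ?I y) \<partial>lborel)"
    by (subst nn_integral_cmult) (simp_all add: ac_simps nn_integral_cmult[where c="_::ennreal", symmetric] nn_integral_multc)
  finally show ?thesis
    by (simp add: nn_integral_cmult)
qed

section \<open>Surface measure on a facet as an integral over a slab\<close>

lemma closest_point_hyperplane:
  fixes n :: "'a::euclidean_space"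
  assumes "norm n = 1"
  shows "closest_point {x. n \<bullet> x = b} y = y - (n \<bullet> y - b) *\<^sub>R n"
proof (rule closest_point_unique[symmetric])
  have nn: "n \<bullet> n = 1" using assms by (simp add: norm_eq_1)
  show "y - (n \<bullet> y - b) *\<^sub>R n \<in> {x. n \<bullet> x = b}" by (simp add: inner_diff_right nn)
  show "\<forall>z\<in>{x. n \<bullet> x = b}. dist y (y - (n \<bullet> y - b) *\<^sub>R n) \<le> dist y z"
  proof
    fix z assume "z \<in> {x. n \<bullet> x = b}"
    then have "\<bar>n \<bullet> y - b\<bar> = \<bar>n \<bullet> (y - z)\<bar>" by (simp add: inner_diff_right)
    also have "\<dots> \<le> norm (y - z)" using Cauchy_Schwarz_ineq2[of n "y - z"] assms by simp
    finally show "dist y (y - (n \<bullet> y - b) *\<^sub>R n) \<le> dist y z" by (simp add: dist_norm assms)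
  qed
qed (auto simp: convex_hyperplane closed_hyperplane)

lemma sets_surface_measure_borel: "A \<in> sets borel \<Longrightarrow> A \<in> sets (surface_measure F)"
  unfolding surface_measure_def by (intro sets_completionI_sets) simp

lemma space_surface_measure [simp]: "space (surface_measure F) = UNIV"
  by (simp add: surface_measure_def)

lemma borel_measurable_surface_measure:
  "f \<in> borel_measurable borel \<Longrightarrow> f \<in> borel_measurable (surface_measure F)"
  unfolding surface_measure_def by (rule measurable_completion) simp

lemma prism_hyperplane:
  fixes n :: "'a::euclidean_space"
  assumes n: "norm n = 1" and hull: "affine hull F = {x. n \<bullet> x = b}"
  shows "{x. closest_point (affine hull F) x \<in> F \<and> dist x (closest_point (affine hull F) x) \<le> 1 / 2}
    = {x. x - (n \<bullet> x - b) *\<^sub>R n \<in> F \<and> \<bar>n \<bullet> x - b\<bar> \<le> 1/2}"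
  unfolding hull closest_point_hyperplane[OF n] by (simp add: n dist_norm)

text \<open>The prism of the definition is centred at height b. As its height range has mass 1, it
  may be exchanged for the slab around height 0, with the shift by b moved into the
  integrand.\<close>

lemma nn_integral_surface_measure:
  fixes n :: "real^'n" and G :: "real^'n \<Rightarrow> ennreal"
  assumes n: "norm n = 1" and hull: "affine hull F = {x. n \<bullet> x = b}"
    and [measurable]: "F \<in> sets borel" "G \<in> borel_measurable borel"
  shows "(\<integral>\<^sup>+z. G z \<partial>surface_measure F) =
    (\<integral>\<^sup>+y. G (y - (n \<bullet> y) *\<^sub>R n + b *\<^sub>R n) * indicator F (y - (n \<bullet> y) *\<^sub>R n + b *\<^sub>R n)
        * indicator {y. \<bar>n \<bullet> y\<bar> \<le> 1/2} y \<partial>lborel)"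
proof -
  have cp: "closest_point (affine hull F) = (\<lambda>x. x - (n \<bullet> x - b) *\<^sub>R n)"
    by (simp add: hull closest_point_hyperplane n fun_eq_iff)
  define P where "P = {x. x - (n \<bullet> x - b) *\<^sub>R n \<in> F \<and> \<bar>n \<bullet> x - b\<bar> \<le> 1/2}"
  have P[measurable]: "P \<in> sets borel" unfolding P_def by measurable
  have [measurable]: "(\<lambda>x. x - (n \<bullet> x - b) *\<^sub>R n) \<in> borel_measurable (restrict_space lborel P)"
    by (intro measurable_restrict_space1) simp
  let ?H = "\<lambda>y. G (y + b *\<^sub>R n) * indicator F (y + b *\<^sub>R n)"
  have "(\<integral>\<^sup>+z. G z \<partial>surface_measure F) = 
     (\<integral>\<^sup>+x. G (x - (n \<bullet> x - b) *\<^sub>R n) * indicator P x \<partial>lborel)"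
    unfolding surface_measure_def nn_integral_completion prism_hyperplane[OF n hull]
    unfolding cp P_def[symmetric]
    by (simp add: nn_integral_distr nn_integral_restrict_space)
  also have "\<dots> = (\<integral>\<^sup>+y. ?H (y - (n \<bullet> y) *\<^sub>R n) * indicator {t. \<bar>t - b\<bar> \<le> 1/2} (n \<bullet> y) \<partial>lborel)"
    by (rule nn_integral_cong) (auto simp: P_def indicator_def algebra_simps)
  also have "\<dots> = (\<integral>\<^sup>+t. indicator {t. \<bar>t - b\<bar> \<le> 1/2} t \<partial>(lborel :: real measure)) *
     (\<integral>\<^sup>+y. ?H (y - (n \<bullet> y) *\<^sub>R n) * indicator {y. \<bar>n \<bullet> y\<bar> \<le> 1/2} y \<partial>lborel)"
    by (rule nn_integral_slab_weight[OF _ _ n]) measurable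
  also have "{t. \<bar>t - b\<bar> \<le> 1/2} = {b - 1/2 .. b + 1/2}" by (auto simp: abs_if split: if_splits)
  finally show ?thesis by simp
qed

text \<open>Invariance under tangential translation: translating by c also moves the slab by
  \<open>n \<bullet> c\<close>, which does not change the mass of its height range. It serves to
  move the apex of a cone.\<close>

lemma nn_integral_slab_shift:
  fixes Q :: "'a::euclidean_space \<Rightarrow> ennreal"
  assumes [measurable]: "Q \<in> borel_measurable borel" and n: "norm n = 1"
  shows "(\<integral>\<^sup>+y. Q (y - (n \<bullet> y) *\<^sub>R n) * indicator {y. \<bar>n \<bullet> y\<bar> \<le> 1/2} y \<partial>lborel) =
    (\<integral>\<^sup>+y. Q (c - (n \<bullet> c) *\<^sub>R n + (y - (n \<bullet> y) *\<^sub>R n)) * indicator {y. \<bar>n \<bullet> y\<bar> \<le> 1/2} y \<partial>lborel)"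
proof -
  let ?P = "\<lambda>y. y - (n \<bullet> y) *\<^sub>R n" and ?I = "indicator {y. \<bar>n \<bullet> y\<bar> \<le> 1/2}"
  have "(\<integral>\<^sup>+y. Q (?P y) * ?I y \<partial>lborel) =
    (\<integral>\<^sup>+y. Q ((c + y) - (n \<bullet> (c + y)) *\<^sub>R n) * indicator {y. \<bar>n \<bullet> y\<bar> \<le> 1/2} (c + y) \<partial>lborel)"
    by (subst nn_integral_lborel_translation[symmetric, where c=c]) auto
  also have "\<dots> = (\<integral>\<^sup>+y. Q (?P c + (?P y)) *
     indicator {t. \<bar>n \<bullet> c + t\<bar> \<le> 1/2} (n \<bullet> y) \<partial>lborel)"
    by (rule nn_integral_cong) (auto simp: algebra_simps indicator_def)
  also have "\<dots> = (\<integral>\<^sup>+t. indicator {t. \<bar>n \<bullet> c + t\<bar> \<le> 1/2} t \<partial>(lborel :: real measure)) *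
     (\<integral>\<^sup>+y. Q (?P c + (?P y)) * ?I y \<partial>lborel)"
    by (rule nn_integral_slab_weight[OF _ _ n]) measurable
  also have "{t. \<bar>n \<bullet> c + t\<bar> \<le> 1/2} = {- (n \<bullet> c) - 1/2 .. - (n \<bullet> c) + 1/2}"
    by (auto simp: abs_if split: if_splits)
  finally show ?thesis by simp
qed

text \<open>Cut the cone parallel to F: the slice at relative height h is F scaled by h about the
  apex. The Jacobian is the distance from the apex to the hyperplane times the (N-1)-dimensional
  scaling factor \<open>h ^ (N - 1)\<close>.\<close>

lemma nn_integral_cone:
  fixes n x0 :: "real^'n" and g :: "real^'n \<Rightarrow> ennreal"
  assumes n: "norm n = 1" and hull: "affine hull F = {x. n \<bullet> x = b}"
    and [measurable]: "F \<in> sets borel" "g \<in> borel_measurable borel" and below: "n \<bullet> x0 < b"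
    and K: "K = {x0 + h *\<^sub>R (z - x0) | z h. z \<in> F \<and> 0 \<le> h \<and> h \<le> 1}" and [measurable]: "K \<in> sets borel"
  shows "(\<integral>\<^sup>+x. g x * indicator K x \<partial>lborel) =
    (\<integral>\<^sup>+z. (\<integral>\<^sup>+h. ennreal ((b - n \<bullet> x0) * h ^ (CARD('n) - 1)) * g (x0 + h *\<^sub>R (z - x0))
        * indicator {0..1} h \<partial>lborel) * indicator F z \<partial>surface_measure F)"
proof -
  have nn: "n \<bullet> n = 1" using n by (simp add: norm_eq_1)
  define d where "d = b - n \<bullet> x0"
  have d: "d > 0" using below by (simp add: d_def)
  define P where "P y = y - (n \<bullet> y) *\<^sub>R n" for y
  have P[measurable]: "P \<in> borel_measurable borel" unfolding P_def by measurable
  have nP[simp]: "n \<bullet> P y = 0" for y by (simp add: P_def inner_diff_right nn)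
  have Pscale: "P (h *\<^sub>R y) = h *\<^sub>R P y" for h y by (simp add: P_def algebra_simps)
  define I :: "real \<Rightarrow> ennreal" where "I = indicator {s. \<bar>s\<bar> \<le> 1/2}"
  have I[measurable]: "I \<in> borel_measurable borel" unfolding I_def by measurable
  have I_eq: "indicator {y. \<bar>n \<bullet> y\<bar> \<le> 1/2} y = I (n \<bullet> y)" for y by (simp add: I_def indicator_def)
  define g' where "g' x = g (x0 + x) * indicator K (x0 + x)" for x
  have g'[measurable]: "g' \<in> borel_measurable borel" unfolding g'_def by measurable
  let ?g = "\<lambda>y h. ennreal (d * h ^ (CARD('n) - 1)) * g (x0 + h *\<^sub>R (P y + d *\<^sub>R n)) * indicator {0..1} h"
    and ?F = "\<lambda>y. indicator F (x0 + (P y + d *\<^sub>R n)) :: ennreal"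
  \<comment> \<open>\<open>inn t\<close> integrates over the slice of the cone at height t above the
    apex. \<open>J h\<close> is the slice at t = d h parametrised by the facet, still without the
    Jacobian.\<close>
  define J where "J h = (\<integral>\<^sup>+y. g (x0 + h *\<^sub>R (P y + d *\<^sub>R n)) * ?F y * I (n \<bullet> y) \<partial>lborel)" for h
  define inn where "inn t = (\<integral>\<^sup>+y. g' (P y + t *\<^sub>R n) * I (n \<bullet> y) \<partial>lborel)" for t
  have [measurable]: "J \<in> borel_measurable borel" "inn \<in> borel_measurable borel"
    unfolding J_def inn_def by measurable
  have hyp: "n \<bullet> z = b" if "z \<in> F" for z
    using hull that hull_subset[of F affine] by auto
  have K_iff: "x0 + h *\<^sub>R (u + d *\<^sub>R n) \<in> K \<longleftrightarrow> x0 + (u + d *\<^sub>R n) \<in> F" if "h > 0" "h \<le> 1" "n \<bullet> u = 0" for u h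
  proof
    assume "x0 + h *\<^sub>R (u + d *\<^sub>R n) \<in> K"
    then obtain z k where z: "x0 + h *\<^sub>R (u + d *\<^sub>R n) = x0 + k *\<^sub>R (z - x0)" "z \<in> F" unfolding K by auto
    then have "n \<bullet> (h *\<^sub>R (u + d *\<^sub>R n)) = n \<bullet> (k *\<^sub>R (z - x0))" by simp
    then have "h * d = k * d" using that hyp[OF z(2)] by (simp add: inner_simps nn d_def)
    then have "h = k" using d by simp
    then have "u + d *\<^sub>R n = z - x0" using z(1) \<open>h > 0\<close> by simp
    then show "x0 + (u + d *\<^sub>R n) \<in> F" using z(2) by simp
  next
    assume "x0 + (u + d *\<^sub>R n) \<in> F"
    then show "x0 + h *\<^sub>R (u + d *\<^sub>R n) \<in> K"
      unfolding K using that by (intro CollectI exI[of _ "x0 + (u + d *\<^sub>R n)"] exI[of _ h]) auto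
  qed
  have inn_out: "inn t = 0" if "t \<notin> {0..d}" for t
  proof -
    have "x0 + (P y + t *\<^sub>R n) \<notin> K" for y
    proof
      assume "x0 + (P y + t *\<^sub>R n) \<in> K"
      then obtain z k where z: "x0 + (P y + t *\<^sub>R n) = x0 + k *\<^sub>R (z - x0)" "z \<in> F" "0 \<le> k" "k \<le> 1"
        unfolding K by auto
      then have "n \<bullet> (P y + t *\<^sub>R n) = n \<bullet> (k *\<^sub>R (z - x0))" by simp
      then have "t = k * d" using hyp[OF z(2)] by (simp add: inner_simps nn d_def)
      then show False using that z(3,4) d by (auto simp: mult_le_cancel_right1)
    qed
    then show ?thesis by (simp add: inn_def g'_def)
  qed
  \<comment> \<open>Scaling full-dimensional measure by h gives \<open>h ^ N\<close>, but it also
    turns the unit slab into one of thickness 1 / h. What remains is the scaling factor of dimension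
    N - 1.\<close>
  have inn_in: "ennreal d * inn (d * h) = ennreal (d * h ^ (CARD('n) - 1)) * J h" if h: "0 < h" "h \<le> 1" for h
  proof -
    define Q where "Q u = g (x0 + h *\<^sub>R (u + d *\<^sub>R n)) * indicator F (x0 + (u + d *\<^sub>R n))" for u
    have [measurable]: "Q \<in> borel_measurable borel" unfolding Q_def by measurable
    have Q: "g' (h *\<^sub>R P y + (d * h) *\<^sub>R n) = Q (P y)" for y
      using K_iff[OF h, of "P y"] by (simp add: g'_def Q_def indicator_def algebra_simps)
    have "inn (d * h) = ennreal (h ^ CARD('n)) * (\<integral>\<^sup>+y. g' (h *\<^sub>R P y + (d * h) *\<^sub>R n) * I (h * (n \<bullet> y)) \<partial>lborel)"
      unfolding inn_def by (subst nn_integral_lborel_scale[OF _ h(1)]) (auto simp: Pscale)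
    also have "(\<integral>\<^sup>+y. g' (h *\<^sub>R P y + (d * h) *\<^sub>R n) * I (h * (n \<bullet> y)) \<partial>lborel) =
        (\<integral>\<^sup>+t. I (h * t) \<partial>lborel) * (\<integral>\<^sup>+y. Q (P y) * I (n \<bullet> y) \<partial>lborel)"
      unfolding Q using nn_integral_slab_weight[OF _ _ n, of Q "\<lambda>t. I (h * t)"]
      unfolding I_eq P_def[symmetric] by simp
    also have "(\<integral>\<^sup>+y. Q (P y) * I (n \<bullet> y) \<partial>lborel) = J h" by (simp add: J_def Q_def)
    also have "(\<integral>\<^sup>+t. I (h * t) \<partial>lborel) = ennreal (1 / h)"
    proof -
      have "(\<lambda>t. I (h * t)) = indicator {- (1 / (2 * h)) .. 1 / (2 * h)}"
        using h by (auto simp: I_def indicator_def fun_eq_iff field_simps abs_if split: if_splits)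
      then show ?thesis using h by (simp add: field_simps)
    qed
    finally have "ennreal d * inn (d * h) = ennreal d * (ennreal (h ^ CARD('n)) * (ennreal (1 / h) * J h))" by simp
    also have "\<dots> = ennreal (d * (h ^ CARD('n) * (1 / h))) * J h"
      using h d by (simp add: ennreal_mult[symmetric] mult.assoc[symmetric])
    also have "h ^ CARD('n) * (1 / h) = h ^ (CARD('n) - 1)"
      using h by (subst power_minus_mult[symmetric, of "CARD('n)"]) auto
    finally show ?thesis .
  qed
  have "(\<integral>\<^sup>+x. g x * indicator K x \<partial>lborel) = (\<integral>\<^sup>+x. g' x \<partial>lborel)"
    unfolding g'_def by (rule nn_integral_lborel_translation[symmetric]) measurable
  also have "\<dots> = (\<integral>\<^sup>+y. (\<integral>\<^sup>+t. g' (P y + t *\<^sub>R n) \<partial>lborel) * I (n \<bullet> y) \<partial>lborel)"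
    using nn_integral_slab[OF g' n] unfolding I_eq P_def[symmetric] .
  also have "\<dots> = (\<integral>\<^sup>+y. (\<integral>\<^sup>+t. g' (P y + t *\<^sub>R n) * I (n \<bullet> y) \<partial>lborel) \<partial>lborel)"
    by (simp add: nn_integral_multc)
  also have "\<dots> = (\<integral>\<^sup>+t. inn t \<partial>lborel)"
    unfolding inn_def by (rule lborel_pair.Fubini'[symmetric]) measurable
  also have "\<dots> = ennreal d * (\<integral>\<^sup>+h. inn (d * h) \<partial>lborel)"
    using d by (subst nn_integral_real_affine[where c=d and t=0]) auto
  also have "\<dots> = (\<integral>\<^sup>+h. ennreal d * inn (d * h) \<partial>lborel)"
    by (simp add: nn_integral_cmult)
  also have "\<dots> = (\<integral>\<^sup>+h. ennreal (d * h ^ (CARD('n) - 1)) * J h * indicator {0..1} h \<partial>lborel)"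
  proof (rule nn_integral_cong_AE)
    \<comment> \<open>The slice identity needs h > 0; the apex is a single value of h.\<close>
    have "AE h in lborel. h \<noteq> (0::real)" by (rule AE_lborel_singleton)
    then show "AE h in lborel. ennreal d * inn (d * h) = ennreal (d * h ^ (CARD('n) - 1)) * J h * indicator {0..1} h"
    proof eventually_elim
      case (elim h)
      show ?case
      proof (cases "h \<in> {0..1}")
        case True
        then show ?thesis using inn_in[of h] elim by simp
      next
        case False
        then have "inn (d * h) = 0" using d by (intro inn_out) (auto simp: zero_le_mult_iff)
        then show ?thesis using False by simp
      qed
    qed
  qed
  also have "\<dots> = (\<integral>\<^sup>+h. (\<integral>\<^sup>+y. ?g y h * ?F y * I (n \<bullet> y) \<partial>lborel) \<partial>lborel)"
    unfolding J_def
    by (rule nn_integral_cong, subst nn_integral_cmult[symmetric], measurable,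
        subst nn_integral_multc[symmetric]) (auto simp: ac_simps)
  also have "\<dots> = (\<integral>\<^sup>+y. (\<integral>\<^sup>+h. ?g y h * ?F y * I (n \<bullet> y) \<partial>lborel) \<partial>lborel)"
    by (rule lborel_pair.Fubini') measurable
  also have "\<dots> = (\<integral>\<^sup>+y. (\<integral>\<^sup>+h. ?g y h \<partial>lborel) * ?F y * I (n \<bullet> y) \<partial>lborel)"
    by (simp add: nn_integral_multc)
  finally have LHS: "(\<integral>\<^sup>+x. g x * indicator K x \<partial>lborel) = \<dots>" .
  define G where "G z = (\<integral>\<^sup>+h. ennreal (d * h ^ (CARD('n) - 1)) * g (x0 + h *\<^sub>R (z - x0))
      * indicator {0..1} h \<partial>lborel)" for z
  have [measurable]: "G \<in> borel_measurable borel" unfolding G_def by measurable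
  have "(\<integral>\<^sup>+z. G z * indicator F z \<partial>surface_measure F) =
     (\<integral>\<^sup>+y. (G (P y + b *\<^sub>R n) * indicator F (P y + b *\<^sub>R n)) * indicator F (P y + b *\<^sub>R n) * I (n \<bullet> y) \<partial>lborel)"
    using nn_integral_surface_measure[OF n hull, of "\<lambda>z. G z * indicator F z"]
    unfolding I_eq P_def[symmetric] by simp
  \<comment> \<open>The surface measure is written relative to the origin, the cone relative to x0.
    The tangential offset \<open>P x0\<close> is absorbed by translation.\<close>
  also have "\<dots> = (\<integral>\<^sup>+y. (G (P x0 + P y + b *\<^sub>R n) * indicator F (P x0 + P y + b *\<^sub>R n)) * indicator F (P x0 + P y + b *\<^sub>R n) * I (n \<bullet> y) \<partial>lborel)"
    using nn_integral_slab_shift[OF _ n, of "\<lambda>u. (G (u + b *\<^sub>R n) * indicator F (u + b *\<^sub>R n)) * indicator F (u + b *\<^sub>R n)" x0]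
    unfolding I_eq P_def[symmetric] by simp
  also have "\<dots> = (\<integral>\<^sup>+y. G (x0 + (P y + d *\<^sub>R n)) * ?F y * I (n \<bullet> y) \<partial>lborel)"
  proof -
    have "P x0 + P y + b *\<^sub>R n = x0 + (P y + d *\<^sub>R n)" for y by (simp add: P_def d_def algebra_simps)
    then show ?thesis by (simp only:) (rule nn_integral_cong, simp add: indicator_def)
  qed
  finally show ?thesis unfolding LHS by (simp add: G_def d_def[symmetric])
qed

section \<open>The divergence theorem on a simplex\<close>

lemma finite_measure_surface_measure:
  fixes n :: "real^'n"
  assumes n: "norm n = 1" and hull: "affine hull F = {x. n \<bullet> x = b}" and F: "compact F"
  shows "finite_measure (surface_measure F)"
proof
  have [measurable]: "F \<in> sets borel" using F by (simp add: borel_compact)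
  obtain R where R: "\<And>x. x \<in> F \<Longrightarrow> norm x \<le> R" using F compact_imp_bounded bounded_iff by metis
  define A where "A = {y. y - (n \<bullet> y) *\<^sub>R n + b *\<^sub>R n \<in> F \<and> \<bar>n \<bullet> y\<bar> \<le> 1/2}"
  have [measurable]: "A \<in> sets borel" unfolding A_def by measurable
  have "norm y \<le> R + 1/2 + \<bar>b\<bar>" if "y \<in> A" for y
  proof -
    have "norm y = norm ((y - (n \<bullet> y) *\<^sub>R n + b *\<^sub>R n) + ((n \<bullet> y) *\<^sub>R n - b *\<^sub>R n))" by simp
    also have "\<dots> \<le> norm (y - (n \<bullet> y) *\<^sub>R n + b *\<^sub>R n) + (norm ((n \<bullet> y) *\<^sub>R n) + norm (b *\<^sub>R n))"
      by (meson add_left_mono norm_triangle_ineq norm_triangle_ineq4 order_trans)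
    also have "\<dots> \<le> R + (1/2 + \<bar>b\<bar>)"
      using that R[of "y - (n \<bullet> y) *\<^sub>R n + b *\<^sub>R n"] n by (simp add: A_def)
    finally show ?thesis by simp
  qed
  then have "bounded A" by (auto simp: bounded_iff)
  then have "emeasure lborel A < \<infinity>" by (rule emeasure_bounded_finite)
  have "emeasure (surface_measure F) (space (surface_measure F)) = (\<integral>\<^sup>+z. 1 \<partial>surface_measure F)"
    by simp
  also have "\<dots> = (\<integral>\<^sup>+y. 1 * indicator F (y - (n \<bullet> y) *\<^sub>R n + b *\<^sub>R n)
        * indicator {y. \<bar>n \<bullet> y\<bar> \<le> 1/2} y \<partial>lborel)"
    by (rule nn_integral_surface_measure[OF n hull]) auto
  also have "\<dots> = (\<integral>\<^sup>+y. indicator A y \<partial>lborel)"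
    by (rule nn_integral_cong) (auto simp: A_def indicator_def)
  also have "\<dots> < \<infinity>" using \<open>emeasure lborel A < \<infinity>\<close> by simp
  finally show "emeasure (surface_measure F) (space (surface_measure F)) \<noteq> \<infinity>" by simp
qed

section \<open>Integrability of bounded measurable functions on facets\<close>

lemma set_integral_sum:
  fixes f :: "'i \<Rightarrow> 'a \<Rightarrow> 'b::{banach,second_countable_topology}"
  assumes "\<And>i. i \<in> I \<Longrightarrow> set_integrable M A (f i)"
  shows "set_integrable M A (\<lambda>x. \<Sum>i\<in>I. f i x)"
    and "(LINT x:A|M. (\<Sum>i\<in>I. f i x)) = (\<Sum>i\<in>I. (LINT x:A|M. f i x))"
  using assms unfolding set_integrable_def set_lebesgue_integral_def scaleR_sum_right
  by (auto intro: Bochner_Integration.integrable_sum Bochner_Integration.integral_sum)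

text \<open>Fluxes contain merely measurable parameters and are therefore not continuous; this class
  is closed under sums and bilinear products. Boundedness is local to F so that polynomial traces
  belong to it as well.\<close>

definition bounded_measurable :: "'a measure \<Rightarrow> 'a set \<Rightarrow> ('a \<Rightarrow> 'b::real_normed_vector) \<Rightarrow> bool"
  where "bounded_measurable M F f \<longleftrightarrow> f \<in> borel_measurable M \<and> bounded (f ` F)"

lemma bounded_measurable_add:
  fixes f g :: "'a \<Rightarrow> 'b::euclidean_space"
  assumes "bounded_measurable M F f" "bounded_measurable M F g" shows "bounded_measurable M F (\<lambda>x. f x + g x)"
proof -
  obtain C D where "\<And>x. x \<in> F \<Longrightarrow> norm (f x) \<le> C" "\<And>x. x \<in> F \<Longrightarrow> norm (g x) \<le> D"
    using assms by (auto simp: bounded_measurable_def bounded_iff)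
  then have "\<And>x. x \<in> F \<Longrightarrow> norm (f x + g x) \<le> C + D" by (meson add_mono norm_triangle_le)
  then show ?thesis using assms by (auto simp: bounded_measurable_def bounded_iff)
qed

lemma bounded_measurable_bilinear:
  fixes f :: "'a \<Rightarrow> 'b::euclidean_space" and g :: "'a \<Rightarrow> 'c::euclidean_space"
    and b :: "'b \<Rightarrow> 'c \<Rightarrow> 'd::euclidean_space"
  assumes b: "bounded_bilinear b" and "bounded_measurable M F f" "bounded_measurable M F g"
  shows "bounded_measurable M F (\<lambda>x. b (f x) (g x))"
proof -
  obtain C D where CD: "\<And>x. x \<in> F \<Longrightarrow> norm (f x) \<le> C" "\<And>x. x \<in> F \<Longrightarrow> norm (g x) \<le> D"
    using assms by (auto simp: bounded_measurable_def bounded_iff)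
  obtain k where k: "0 \<le> k" "\<And>a c. norm (b a c) \<le> norm a * norm c * k"
    using bounded_bilinear.nonneg_bounded[OF b] by blast
  have "norm (b (f x) (g x)) \<le> C * D * k" if "x \<in> F" for x
  proof -
    have "norm (f x) * norm (g x) \<le> C * D"
      using CD(1)[OF that] CD(2)[OF that] order_trans[OF norm_ge_zero CD(1)[OF that]] by (intro mult_mono) auto
    then have "norm (f x) * norm (g x) * k \<le> C * D * k" using k(1) by (rule mult_right_mono)
    then show ?thesis using k(2)[of "f x" "g x"] by linarith
  qed
  moreover have "(\<lambda>x. b (f x) (g x)) \<in> borel_measurable M"
  proof (rule borel_measurable_continuous_Pair[where H=b])
    show "continuous_on UNIV (\<lambda>x. b (fst x) (snd x))"
      by (rule bounded_bilinear.continuous_on[OF b continuous_on_fst[OF continuous_on_id] continuous_on_snd[OF continuous_on_id]])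
  qed (use assms(2,3) in \<open>simp_all add: bounded_measurable_def\<close>)
  ultimately show ?thesis by (auto simp: bounded_measurable_def bounded_iff)
qed

lemma bounded_measurable_continuous:
  fixes f :: "'a::euclidean_space \<Rightarrow> 'b::euclidean_space"
  assumes "compact F" "sets borel \<subseteq> sets M" "space M = UNIV" "continuous_on UNIV f"
  shows "bounded_measurable M F f"
proof -
  have "bounded (f ` F)"
    using assms by (meson compact_continuous_image compact_imp_bounded continuous_on_subset subset_UNIV)
  moreover have "f \<in> borel_measurable M"
    using borel_measurable_continuous_onI[OF assms(4)] assms(2,3) by (auto simp: measurable_def)
  ultimately show ?thesis by (simp add: bounded_measurable_def)
qed

lemma bounded_measurable_indicator:
  assumes "A \<in> sets M" shows "bounded_measurable M F (indicat_real A)"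
  using assms by (auto simp: bounded_measurable_def bounded_iff intro!: exI[of _ 1])

text \<open>Extension by zero of a parameter that is controlled only on a part A of the skeleton, as
  \<open>S\<close> off the boundary and \<open>B\<close> on it.\<close>

lemma bounded_measurable_restrict:
  fixes f :: "'a \<Rightarrow> 'b::euclidean_space"
  assumes "A \<in> sets M" "f \<in> borel_measurable (restrict_space M A)" "bounded (f ` A)"
  shows "bounded_measurable M F (\<lambda>x. indicat_real A x *\<^sub>R f x)"
proof -
  obtain C where C: "\<And>x. x \<in> A \<Longrightarrow> norm (f x) \<le> C" using assms(3) by (auto simp: bounded_iff)
  have "norm (indicat_real A x *\<^sub>R f x) \<le> max C 0" for x
    using C[of x] by (auto simp: indicator_def le_max_iff_disj)
  moreover have "(\<lambda>x. indicat_real A x *\<^sub>R f x) \<in> borel_measurable M"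
    using assms by (subst borel_measurable_restrict_space_iff[symmetric]) auto
  ultimately show ?thesis by (auto simp: bounded_measurable_def bounded_iff)
qed

lemma bounded_measurable_set_integrable:
  fixes f :: "'a \<Rightarrow> 'b::euclidean_space"
  assumes "finite_measure M" "F \<in> sets M" "bounded_measurable M F f" shows "set_integrable M F f"
proof -
  interpret finite_measure M by fact
  obtain C where C: "\<And>x. x \<in> F \<Longrightarrow> norm (f x) \<le> C"
    using assms by (auto simp: bounded_measurable_def bounded_iff)
  show ?thesis unfolding set_integrable_def
  proof (rule integrable_const_bound[of _ "max C 0"])
    show "AE x in M. norm (indicat_real F x *\<^sub>R f x) \<le> max C 0"
      using C by (intro AE_I2) (auto simp: indicator_def le_max_iff_disj)
  qed (use assms in \<open>auto simp: bounded_measurable_def\<close>)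
qed

lemma surface_bounded_measurable_continuous:
  fixes f :: "real^'n \<Rightarrow> 'b::euclidean_space"
  assumes "compact F" "continuous_on UNIV f" shows "bounded_measurable (surface_measure F) F f"
  by (rule bounded_measurable_continuous[OF assms(1) _ _ assms(2)]) (auto intro: sets_surface_measure_borel)

lemma set_integrable_surface_measure:
  fixes f :: "real^'n \<Rightarrow> 'b::euclidean_space"
  assumes "norm n = 1" "affine hull F = {x. n \<bullet> x = b}" "compact F" "continuous_on UNIV f"
  shows "set_integrable (surface_measure F) F f"
proof (rule bounded_measurable_set_integrable[OF finite_measure_surface_measure[OF assms(1-3)]])
  show "F \<in> sets (surface_measure F)"
    using assms(3) by (intro sets_surface_measure_borel) (simp add: borel_compact)
  show "bounded_measurable (surface_measure F) F f"
    using assms(3,4) by (rule surface_bounded_measurable_continuous)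
qed

lemma set_integrable_lborel_compact:
  fixes f :: "'a::euclidean_space \<Rightarrow> 'b::euclidean_space"
  assumes "compact K" "continuous_on K f"
  shows "set_integrable lborel K f"
  unfolding set_integrable_def using borel_integrable_compact[OF assms]
  by (simp add: indicator_def if_distrib[of "\<lambda>c. c *\<^sub>R _"] cong: if_cong)

text \<open>\<open>c1\<close> gives continuity for fixed directions only, whereas the direction
  \<open>x - x0\<close> varies with x. Expanding it in the basis reduces to fixed
  directions.\<close>

lemma c1_continuous_radial_derivative:
  fixes f :: "'a::euclidean_space \<Rightarrow> real"
  assumes f: "c1 f"
  shows "continuous_on UNIV (\<lambda>x. frechet_derivative f (at x) (x - x0))"
proof -
  have "frechet_derivative f (at x) (x - x0) =
      (\<Sum>i\<in>Basis. ((x - x0) \<bullet> i) * frechet_derivative f (at x) i)" for x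
  proof -
    interpret bounded_linear "frechet_derivative f (at x)"
      using c1_has_derivative[OF f] has_derivative_bounded_linear by blast
    have "frechet_derivative f (at x) (\<Sum>i\<in>Basis. ((x - x0) \<bullet> i) *\<^sub>R i) =
      (\<Sum>i\<in>Basis. ((x - x0) \<bullet> i) * frechet_derivative f (at x) i)"
      by (simp only: sum scaleR real_scaleR_def)
    then show ?thesis by (simp add: euclidean_representation)
  qed
  then show ?thesis
    by (auto intro!: continuous_intros c1_continuous_frechet_derivative[OF f])
qed

text \<open>The integrand is the divergence of the field \<open>f x *\<^sub>R (x - x0)\<close>,
  which is tangential to the lateral faces of the cone. Along the ray through z, the integrand times
  \<open>h ^ (N - 1)\<close> is the derivative of \<open>h ^ N * f\<close>, so each ray contributes
  the value of f at z.\<close>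

lemma cone_divergence_nonneg:
  fixes f :: "real^'n \<Rightarrow> real"
  assumes n: "norm n = 1" and hull: "affine hull F = {x. n \<bullet> x = b}"
    and F: "compact F" and below: "n \<bullet> x0 < b"
    and K: "K = {x0 + h *\<^sub>R (z - x0) | z h. z \<in> F \<and> 0 \<le> h \<and> h \<le> 1}" and cK: "compact K"
    and f: "c1 f"
    and nonneg: "\<And>x. x \<in> K \<Longrightarrow> 0 \<le> real CARD('n) * f x + frechet_derivative f (at x) (x - x0)"
  shows "(LINT x:K|lborel. real CARD('n) * f x + frechet_derivative f (at x) (x - x0)) =
     (b - n \<bullet> x0) * (LINT z:F|surface_measure F. f z)"
proof -
  define d where "d = b - n \<bullet> x0"
  have d: "d > 0" using below by (simp add: d_def)
  define N where "N = CARD('n)"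
  have N: "N > 0" by (simp add: N_def)
  have [measurable]: "F \<in> sets borel" "K \<in> sets borel" using F cK by (auto simp: borel_compact)
  define g where "g x = real N * f x + frechet_derivative f (at x) (x - x0)" for x
  have g_cont: "continuous_on UNIV g" unfolding g_def
    by (intro continuous_intros c1_continuous_on[OF f] c1_continuous_radial_derivative[OF f])
  then have [measurable]: "g \<in> borel_measurable borel" by (rule borel_measurable_continuous_onI)
  have f_cont: "continuous_on UNIV f" by (rule c1_continuous_on[OF f])
  then have [measurable]: "f \<in> borel_measurable borel" by (rule borel_measurable_continuous_onI)
  have inner: "(\<integral>\<^sup>+h. ennreal (d * h ^ (N - 1)) * ennreal (g (x0 + h *\<^sub>R (z - x0))) * indicator {0..1} h \<partial>lborel)
      = ennreal (d * f z)" and fnonneg: "0 \<le> f z" if z: "z \<in> F" for z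
  proof -
    let ?c = "\<lambda>h. x0 + h *\<^sub>R (z - x0)"
    let ?G = "\<lambda>h. d * h ^ (N - 1) * g (?c h)"
    let ?F = "\<lambda>h. d * (h ^ N * f (?c h))"
    have cin: "?c h \<in> K" if "h \<in> {0..1}" for h using that z unfolding K by auto
    have gpos: "0 \<le> g (?c h)" if "h \<in> {0..1}" for h
      using nonneg[OF cin[OF that]] by (simp add: g_def N_def)
    have Gpos: "0 \<le> ?G h" if "h \<in> {0..1}" for h
      using gpos[OF that] that d by (intro mult_nonneg_nonneg) auto
    have der: "DERIV ?F h :> ?G h" for h
    proof -
      have lin: "linear (frechet_derivative f (at (?c h)))"
        using c1_has_derivative[OF f] has_derivative_linear by blast
      have "((\<lambda>h. f (?c h)) has_derivative (\<lambda>t. frechet_derivative f (at (?c h)) (t *\<^sub>R (z - x0)))) (at h)"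
      proof (rule has_derivative_compose[OF _ c1_has_derivative[OF f]])
        show "(?c has_derivative (\<lambda>t. t *\<^sub>R (z - x0))) (at h)"
          by (auto intro!: derivative_eq_intros)
      qed
      moreover have "(\<lambda>t. frechet_derivative f (at (?c h)) (t *\<^sub>R (z - x0))) =
          (*) (frechet_derivative f (at (?c h)) (z - x0))"
        by (rule ext) (simp only: linear_cmul[OF lin] real_scaleR_def mult.commute)
      ultimately have "DERIV (\<lambda>h. f (?c h)) h :> frechet_derivative f (at (?c h)) (z - x0)"
        by (simp only: has_field_derivative_def)
      then have "DERIV (\<lambda>h. h ^ N * f (?c h)) h :>
          h ^ N * frechet_derivative f (at (?c h)) (z - x0) + (real N * h ^ (N - Suc 0)) * f (?c h)"
        by (rule DERIV_mult'[OF DERIV_pow])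
      then have "DERIV ?F h :> d * (h ^ N * frechet_derivative f (at (?c h)) (z - x0) + (real N * h ^ (N - Suc 0)) * f (?c h))"
        by (rule DERIV_cmult)
      also have "d * (h ^ N * frechet_derivative f (at (?c h)) (z - x0) + (real N * h ^ (N - Suc 0)) * f (?c h)) = ?G h"
        using N by (cases N) (simp_all add: g_def linear_cmul[OF lin] distrib_left distrib_right mult_ac)
      finally show ?thesis .
    qed
    have "(\<integral>\<^sup>+h. ennreal (?G h) * indicator {0..1} h \<partial>lborel) = ennreal (?F 1 - ?F 0)"
      by (rule nn_integral_FTC_Icc) (use der Gpos in auto)
    also have "(\<integral>\<^sup>+h. ennreal (?G h) * indicator {0..1} h \<partial>lborel) =
       (\<integral>\<^sup>+h. ennreal (d * h ^ (N - 1)) * ennreal (g (?c h)) * indicator {0..1} h \<partial>lborel)"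
      using gpos d by (intro nn_integral_cong) (auto simp: indicator_def ennreal_mult)
    also have "?F 1 - ?F 0 = d * f z" using N by simp
    finally show "(\<integral>\<^sup>+h. ennreal (d * h ^ (N - 1)) * ennreal (g (x0 + h *\<^sub>R (z - x0))) * indicator {0..1} h \<partial>lborel)
      = ennreal (d * f z)" .
    \<comment> \<open>The primitive starts at 0 and increases, so f is nonnegative on F; this lets
      the surface integral be read as a nonnegative one.\<close>
    have "?F 0 \<le> ?F 1"
    proof (rule DERIV_nonneg_imp_nondecreasing[of 0 1])
      fix h :: real assume "0 \<le> h" "h \<le> 1"
      then have "0 \<le> ?G h" by (intro Gpos) simp
      then show "\<exists>y. DERIV ?F h :> y \<and> 0 \<le> y" using der by blast
    qed simp
    then show "0 \<le> f z" using d N by (simp add: zero_le_mult_iff power_0_left)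
  qed
  have "(LINT x:K|lborel. g x) = enn2real (\<integral>\<^sup>+x. ennreal (g x) * indicator K x \<partial>lborel)"
    unfolding set_lebesgue_integral_def
  proof (subst integral_eq_nn_integral)
    have gK: "0 \<le> g x" if "x \<in> K" for x using nonneg[OF that] by (simp add: g_def N_def)
    show "AE x in lborel. 0 \<le> indicat_real K x *\<^sub>R g x" using gK by (auto simp: indicator_def)
    show "enn2real (\<integral>\<^sup>+x. ennreal (indicat_real K x *\<^sub>R g x) \<partial>lborel) = enn2real (\<integral>\<^sup>+x. ennreal (g x) * indicator K x \<partial>lborel)"
      by (intro arg_cong[where f=enn2real] nn_integral_cong) (auto simp: indicator_def)
  qed measurable
  also have "(\<integral>\<^sup>+x. ennreal (g x) * indicator K x \<partial>lborel) =
    (\<integral>\<^sup>+z. (\<integral>\<^sup>+h. ennreal (d * h ^ (N - 1)) * ennreal (g (x0 + h *\<^sub>R (z - x0)))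
        * indicator {0..1} h \<partial>lborel) * indicator F z \<partial>surface_measure F)"
    unfolding d_def N_def by (rule nn_integral_cone[OF n hull _ _ below K]) measurable
  also have "\<dots> = (\<integral>\<^sup>+z. ennreal (d * (f z * indicator F z)) \<partial>surface_measure F)"
  proof (rule nn_integral_cong)
    fix z
    show "(\<integral>\<^sup>+h. ennreal (d * h ^ (N - 1)) * ennreal (g (x0 + h *\<^sub>R (z - x0)))
        * indicator {0..1} h \<partial>lborel) * indicator F z = ennreal (d * (f z * indicator F z))"
      using inner[of z] by (cases "z \<in> F") simp_all
  qed
  also have "enn2real \<dots> = (LINT z|surface_measure F. d * (f z * indicator F z))"
    using fnonneg d
    by (subst integral_eq_nn_integral)
       (auto intro!: borel_measurable_surface_measure simp: indicator_def)
  also have "\<dots> = d * (LINT z:F|surface_measure F. f z)"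
    by (simp add: set_lebesgue_integral_def mult.commute)
  finally show ?thesis by (simp add: g_def d_def N_def)
qed

text \<open>The sign condition is removed by adding a constant e to f: the field
  \<open>e *\<^sub>R (x - x0)\<close> has the constant divergence \<open>N * e = C\<close>, which
  lifts the integrand above 0. The nonnegative case is applied to \<open>f + e\<close> and to e, and
  the results are subtracted.\<close>

lemma cone_divergence:
  fixes f :: "real^'n \<Rightarrow> real"
  assumes n: "norm n = 1" and hull: "affine hull F = {x. n \<bullet> x = b}"
    and F: "compact F" and below: "n \<bullet> x0 < b"
    and K: "K = {x0 + h *\<^sub>R (z - x0) | z h. z \<in> F \<and> 0 \<le> h \<and> h \<le> 1}" and cK: "compact K"
    and f: "c1 f"
  shows "(LINT x:K|lborel. real CARD('n) * f x + frechet_derivative f (at x) (x - x0)) =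
     (b - n \<bullet> x0) * (LINT z:F|surface_measure F. f z)"
    and "set_integrable lborel K (\<lambda>x. real CARD('n) * f x + frechet_derivative f (at x) (x - x0))"
proof -
  define g where "g x = real CARD('n) * f x + frechet_derivative f (at x) (x - x0)" for x
  have g: "continuous_on UNIV g" unfolding g_def
    by (intro continuous_intros c1_continuous_on c1_continuous_radial_derivative f)
  have gi: "set_integrable lborel K g"
    using g by (meson cK continuous_on_subset set_integrable_lborel_compact subset_UNIV)
  then show "set_integrable lborel K (\<lambda>x. real CARD('n) * f x + frechet_derivative f (at x) (x - x0))"
    by (simp add: g_def[abs_def])
  have "bounded (g ` K)"
    using cK g by (meson compact_continuous_image compact_imp_bounded continuous_on_subset subset_UNIV)
  then obtain C0 where C0: "\<And>x. x \<in> K \<Longrightarrow> norm (g x) \<le> C0" by (auto simp: bounded_iff)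
  \<comment> \<open>The maximum with 0 is for the second application, where the integrand is C
    itself.\<close>
  define C where "C = max C0 0"
  define e where "e = C / real CARD('n)"
  have fd: "frechet_derivative (\<lambda>x. f x + e) (at x) = frechet_derivative f (at x)" for x
    by (rule frechet_derivative_at[symmetric]) (auto intro!: derivative_eq_intros c1_has_derivative[OF f])
  have fc: "frechet_derivative (\<lambda>x. e) (at x) = (\<lambda>_. 0)" for x :: "real^'n"
    by (rule frechet_derivative_at[symmetric]) (auto intro!: derivative_eq_intros)
  have e: "real CARD('n) * e = C" by (simp add: e_def)
  have eq: "real CARD('n) * (f x + e) + frechet_derivative f (at x) (x - x0) = g x + C" for x
    by (simp add: g_def distrib_left e)
  have "0 \<le> g x + C" if "x \<in> K" for x using C0[OF that] by (auto simp: C_def)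
  then have 1: "(LINT x:K|lborel. g x + C) = (b - n \<bullet> x0) * (LINT z:F|surface_measure F. f z + e)"
    using cone_divergence_nonneg[OF n hull F below K cK, of "\<lambda>x. f x + e"]
    unfolding fd eq by (simp add: c1_add f c1_const)
  have 2: "(LINT x:K|lborel. C) = (b - n \<bullet> x0) * (LINT z:F|surface_measure F. e)"
    using cone_divergence_nonneg[OF n hull F below K cK, of "\<lambda>x. e"]
    unfolding fc by (simp add: c1_const e C_def)
  have "(LINT x:K|lborel. g x + C) = (LINT x:K|lborel. g x) + (LINT x:K|lborel. C)"
    by (intro set_integral_add gi set_integrable_lborel_compact cK continuous_intros)
  moreover have "(LINT z:F|surface_measure F. f z + e) = (LINT z:F|surface_measure F. f z) + (LINT z:F|surface_measure F. e)"
    by (intro set_integral_add set_integrable_surface_measure[OF n hull F] continuous_intros c1_continuous_on f)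
  ultimately have "(LINT x:K|lborel. g x) = (b - n \<bullet> x0) * (LINT z:F|surface_measure F. f z)"
    using 1 2 by (simp add: distrib_left)
  then show "(LINT x:K|lborel. real CARD('n) * f x + frechet_derivative f (at x) (x - x0)) =
     (b - n \<bullet> x0) * (LINT z:F|surface_measure F. f z)" by (simp add: g_def)
qed

section \<open>Outward normals\<close>

text \<open>The part u of n' orthogonal to n is a direction inside the first hyperplane, so it is
  also orthogonal to n'. Then u is orthogonal to itself and vanishes.\<close>

lemma hyperplane_normal_unique:
  fixes n n' :: "'a::real_inner"
  assumes n: "norm n = 1" and n': "norm n' = 1" and sub: "{x. n \<bullet> x = b} \<subseteq> {x. n' \<bullet> x = b'}"
  shows "n' = n \<and> b' = b \<or> n' = - n \<and> b' = - b"
proof -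
  have nn: "n \<bullet> n = 1" using n by (simp add: norm_eq_1)
  define u where "u = n' - (n \<bullet> n') *\<^sub>R n"
  have nu: "n \<bullet> u = 0" by (simp add: u_def inner_diff_right nn)
  have "b *\<^sub>R n \<in> {x. n \<bullet> x = b}" "b *\<^sub>R n + u \<in> {x. n \<bullet> x = b}" by (auto simp: nn nu inner_add_right)
  then have b': "n' \<bullet> (b *\<^sub>R n) = b'" "n' \<bullet> (b *\<^sub>R n + u) = b'" using sub by blast+
  then have "n' \<bullet> u = 0" by (simp add: inner_add_right)
  moreover have "u \<bullet> u = (n' - (n \<bullet> n') *\<^sub>R n) \<bullet> u" by (simp only: u_def)
  ultimately have "u \<bullet> u = 0" using nu by (simp add: inner_diff_left)
  then have eq: "n' = (n \<bullet> n') *\<^sub>R n" by (simp add: u_def)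
  then have "norm n' = \<bar>n \<bullet> n'\<bar> * norm n" by (metis norm_scaleR)
  then have "n \<bullet> n' = 1 \<or> n \<bullet> n' = -1" using n n' by auto
  then show ?thesis using eq b'(1) by (auto simp: inner_commute)
qed

text \<open>Evaluates the description in \<open>outward_normal\<close>. Faces of polyhedra are
  exposed, which gives a normal; the affine hull of F determines it up to sign, and a point q of K
  strictly below the hyperplane fixes the sign.\<close>

lemma outward_normal:
  fixes K :: "(real^'n) set"
  assumes K: "polyhedron K" "aff_dim K = int CARD('n)" and F: "F facet_of K"
  obtains b where "norm (outward_normal K F) = 1" "affine hull F = {x. outward_normal K F \<bullet> x = b}"
    "K \<subseteq> {x. outward_normal K F \<bullet> x \<le> b}" "F = K \<inter> {x. outward_normal K F \<bullet> x = b}"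
proof -
  have fF: "F face_of K" "F \<noteq> {}" "aff_dim F = aff_dim K - 1" using F by (auto simp: facet_of_def)
  then have FK: "F \<noteq> K" by auto
  obtain a c where ac: "K \<subseteq> {x. a \<bullet> x \<le> c}" "F = K \<inter> {x. a \<bullet> x = c}"
    using fF(1) exposed_face_of_polyhedron[OF K(1)] unfolding exposed_face_of_def by metis
  have a: "a \<noteq> 0"
  proof
    assume "a = 0" then show False using ac fF(2) FK by (cases "c = 0") auto
  qed
  define n b where "n = a /\<^sub>R norm a" and "b = c / norm a"
  have n: "norm n = 1" using a by (simp add: n_def)
  have 1: "K \<subseteq> {x. n \<bullet> x \<le> b}" "F = K \<inter> {x. n \<bullet> x = b}"
    using ac a by (auto simp: n_def b_def field_simps)
  have "affine hull F = {x. n \<bullet> x = b}"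
  proof (rule affine_dim_equal)
    show "affine hull F \<subseteq> {x. n \<bullet> x = b}" using 1(2) by (intro hull_minimal affine_hyperplane) auto
    show "aff_dim (affine hull F) = aff_dim {x. n \<bullet> x = b}"
    proof -
      have "n \<noteq> 0" using n by auto
      then show ?thesis using fF(3) K(2) by (simp add: aff_dim_hyperplane)
    qed
  qed (use fF(2) in \<open>auto simp: affine_hyperplane\<close>)
  note hull = this
  have "\<not> K \<subseteq> {x. n \<bullet> x = b}" using 1(2) FK by blast
  then obtain q where q: "q \<in> K" "n \<bullet> q < b" using 1(1) by force
  have "outward_normal K F = n" unfolding outward_normal_def
  proof (rule the_equality)
    show "norm n = 1 \<and> (\<exists>b. F \<subseteq> {x. n \<bullet> x = b} \<and> K \<subseteq> {x. n \<bullet> x \<le> b})" using n 1 by blast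
    fix n' assume "norm n' = 1 \<and> (\<exists>b. F \<subseteq> {x. n' \<bullet> x = b} \<and> K \<subseteq> {x. n' \<bullet> x \<le> b})"
    then obtain b' where n': "norm n' = 1" "F \<subseteq> {x. n' \<bullet> x = b'}" "K \<subseteq> {x. n' \<bullet> x \<le> b'}" by blast
    have "affine hull F \<subseteq> {x. n' \<bullet> x = b'}" using n'(2) by (intro hull_minimal affine_hyperplane)
    then have "n' = n \<and> b' = b \<or> n' = - n \<and> b' = - b"
      using hyperplane_normal_unique[OF n n'(1)] hull by simp
    then show "n' = n" using q n'(3) by force
  qed
  then show thesis using that n hull 1 by simp
qed

lemma compact_facet: "compact K \<Longrightarrow> convex K \<Longrightarrow> F facet_of K \<Longrightarrow> compact F"
  by (meson face_of_imp_compact facet_of_imp_face_of)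

text \<open>The field \<open>f v\<close> is a combination of the fields \<open>f (x) (x - c)\<close> centred at the vertices \<open>c\<close>,
  each of which has flux through the facet opposite to \<open>c\<close> only.\<close>

theorem simplex_divergence:
  fixes f :: "real^'n \<Rightarrow> real"
  assumes K: "int CARD('n) simplex K" and f: "c1 f"
  shows "(LINT x:K|lborel. frechet_derivative f (at x) v) =
    (\<Sum>F | F facet_of K. (outward_normal K F \<bullet> v) * (LINT z:F|surface_measure F. f z))"
proof -
  obtain C where C: "finite C" "\<not> affine_dependent C" "int (card C) = int CARD('n) + 1" "K = convex hull C"
    using K unfolding simplex by blast
  have dim: "aff_dim K = int CARD('n)" using K by (rule aff_dim_simplex)
  have poly: "polyhedron K" using K by (rule simplex_imp_polyhedron)
  have cK: "compact K" "convex K" using K compact_simplex convex_simplex by auto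
  have "CARD('n) \<ge> 1" by (simp add: Suc_leI)
  then have card2: "2 \<le> card C" using C(3) by linarith
  define Fc where "Fc c = convex hull (C - {c})" for c
  have facets: "{F. F facet_of K} = Fc ` C"
    using facet_of_convex_hull_affine_independent_alt[OF C(2)] card2 C(4) by (auto simp: Fc_def)
  have notin: "c \<notin> Fc c" if "c \<in> C" for c
  proof
    assume "c \<in> Fc c"
    then have "c \<in> affine hull (C - {c})" unfolding Fc_def using convex_hull_subset_affine_hull by blast
    then show False using C(2) that unfolding affine_dependent_def by blast
  qed
  have inj: "inj_on Fc C"
  proof (rule inj_onI)
    fix c c' assume c: "c \<in> C" "c' \<in> C" "Fc c = Fc c'"
    show "c = c'"
    proof (rule ccontr)
      assume "c \<noteq> c'"
      then have "c \<in> Fc c'" unfolding Fc_def using c by (intro hull_inc) auto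
      then show False using notin[OF c(1)] c(3) by simp
    qed
  qed
  \<comment> \<open>Differences of the barycentric coordinates of c0 and \<open>c0 + v\<close>.
    Because they sum to 0, \<open>\<Sum>c\<in>C. \<gamma> c *\<^sub>R (x - c)\<close> equals v for
    every x, and the terms without derivative cancel.\<close>
  obtain \<gamma> where \<gamma>: "sum \<gamma> C = 0" "(\<Sum>c\<in>C. \<gamma> c *\<^sub>R c) = - v"
  proof -
    obtain c0 where c0: "c0 \<in> C" using card2 by fastforce
    have "aff_dim C = int CARD('n)" using dim C(4) by (simp add: aff_dim_convex_hull)
    then have "affine hull C = UNIV" using aff_dim_eq_full[of C] by simp
    then have "c0 + v \<in> affine hull C" by simp
    then obtain u where u: "sum u C = 1" "(\<Sum>c\<in>C. u c *\<^sub>R c) = c0 + v"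
      using affine_hull_finite[OF C(1)] by auto
    show thesis
    proof (rule that[of "\<lambda>c. (if c = c0 then 1 else 0) - u c"])
      show "(\<Sum>c\<in>C. (if c = c0 then 1 else 0) - u c) = 0"
        using u c0 C(1) by (simp add: sum_subtractf)
      show "(\<Sum>c\<in>C. ((if c = c0 then 1 else 0) - u c) *\<^sub>R c) = - v"
        using u c0 C(1) by (simp add: scaleR_diff_left sum_subtractf if_distrib[of "\<lambda>a. a *\<^sub>R _"] cong: if_cong)
    qed
  qed
  define n where "n c = outward_normal K (Fc c)" for c
  define I where "I c = (LINT z:Fc c|surface_measure (Fc c). f z)" for c
  define g where "g c x = real CARD('n) * f x + frechet_derivative f (at x) (x - c)" for c x
  have cone: "set_integrable lborel K (g c) \<and> \<gamma> c * (LINT x:K|lborel. g c x) = (n c \<bullet> v) * I c" if c: "c \<in> C" for c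
  proof -
    have facet: "Fc c facet_of K" using facets c by auto
    obtain b where b: "norm (n c) = 1" "affine hull (Fc c) = {x. n c \<bullet> x = b}"
      "K \<subseteq> {x. n c \<bullet> x \<le> b}" "Fc c = K \<inter> {x. n c \<bullet> x = b}"
      using outward_normal[OF poly dim facet] unfolding n_def .
    have "c \<in> K" using c C(4) by (simp add: hull_inc)
    then have below: "n c \<bullet> c < b" using notin[OF c] b(3,4) by force
    have ne: "C - {c} \<noteq> {}"
    proof
      assume "C - {c} = {}" then have "C \<subseteq> {c}" by auto
      then have "card C \<le> 1" using card_mono[of "{c}" C] by simp
      then show False using card2 by simp
    qed
    have "K = convex hull (insert c (C - {c}))" using c C(4) by (simp add: insert_absorb)
    also have "\<dots> = {c + h *\<^sub>R (z - c) |z h. z \<in> Fc c \<and> 0 \<le> h \<and> h \<le> 1}"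
    proof -
      have eq: "(1 - u) *\<^sub>R c + u *\<^sub>R x = c + u *\<^sub>R (x - c)" for u x by (simp add: algebra_simps)
      show ?thesis unfolding convex_hull_insert_alt using ne by (simp only: if_False Fc_def eq) blast
    qed
    finally have K_eq: "K = {c + h *\<^sub>R (z - c) |z h. z \<in> Fc c \<and> 0 \<le> h \<and> h \<le> 1}" .
    note cd = cone_divergence[OF b(1,2) compact_facet[OF cK facet] below K_eq cK(1) f]
    obtain y where y: "y \<in> Fc c" using facet by (auto simp: facet_of_def)
    \<comment> \<open>With y in the facet opposite to c, all edges \<open>y - j\<close> to the other
      vertices lie in that facet. Only j = c survives in \<open>n c \<bullet> v\<close>, which
      leaves \<open>\<gamma> c\<close> times the height of the cone.\<close>
    have orth: "n c \<bullet> (y - j) = 0" if "j \<in> C - {c}" for j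
    proof -
      have "j \<in> Fc c" unfolding Fc_def using that by (rule hull_inc)
      then show ?thesis using y b(4) by (auto simp: inner_diff_right)
    qed
    have "v = (\<Sum>j\<in>C. \<gamma> j *\<^sub>R (y - j))"
      using \<gamma> by (simp add: scaleR_diff_right sum_subtractf scaleR_sum_left[symmetric])
    then have "n c \<bullet> v = (\<Sum>j\<in>C. \<gamma> j * (n c \<bullet> (y - j)))" by (simp add: inner_sum_right)
    also have "\<dots> = \<gamma> c * (n c \<bullet> (y - c)) + (\<Sum>j\<in>C - {c}. \<gamma> j * (n c \<bullet> (y - j)))"
      using c C(1) by (rule sum.remove[rotated])
    also have "(\<Sum>j\<in>C - {c}. \<gamma> j * (n c \<bullet> (y - j))) = 0" using orth by (intro sum.neutral) simp
    also have "n c \<bullet> (y - c) = b - n c \<bullet> c" using y b(4) by (auto simp: inner_diff_right)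
    finally have "n c \<bullet> v = \<gamma> c * (b - n c \<bullet> c)" by simp
    then show ?thesis using cd by (simp add: g_def[abs_def] I_def)
  qed
  have "frechet_derivative f (at x) v = (\<Sum>c\<in>C. \<gamma> c * g c x)" for x
  proof -
    have lin: "linear (frechet_derivative f (at x))"
      using c1_has_derivative[OF f] has_derivative_linear by blast
    have "(\<Sum>c\<in>C. \<gamma> c * g c x) = (\<Sum>c\<in>C. \<gamma> c * (real CARD('n) * f x)) + (\<Sum>c\<in>C. \<gamma> c * frechet_derivative f (at x) (x - c))"
      by (simp add: g_def distrib_left sum.distrib)
    also have "(\<Sum>c\<in>C. \<gamma> c * (real CARD('n) * f x)) = 0" using \<gamma>(1) by (simp add: sum_distrib_right[symmetric])
    also have "(\<Sum>c\<in>C. \<gamma> c * frechet_derivative f (at x) (x - c)) = frechet_derivative f (at x) (\<Sum>c\<in>C. \<gamma> c *\<^sub>R (x - c))"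
      by (simp add: linear_sum[OF lin] linear_cmul[OF lin])
    also have "(\<Sum>c\<in>C. \<gamma> c *\<^sub>R (x - c)) = v"
      using \<gamma> by (simp add: scaleR_diff_right sum_subtractf scaleR_sum_left[symmetric])
    finally show ?thesis by simp
  qed
  then have "(LINT x:K|lborel. frechet_derivative f (at x) v) = (LINT x:K|lborel. (\<Sum>c\<in>C. \<gamma> c * g c x))" by simp
  also have "\<dots> = (\<Sum>c\<in>C. (LINT x:K|lborel. \<gamma> c * g c x))"
    using C(1) cone by (intro set_integral_sum) (auto intro: set_integrable_mult_right)
  also have "\<dots> = (\<Sum>c\<in>C. \<gamma> c * (LINT x:K|lborel. g c x))" by simp
  also have "\<dots> = (\<Sum>c\<in>C. (n c \<bullet> v) * I c)" using cone by (intro sum.cong) auto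
  also have "\<dots> = (\<Sum>F\<in>Fc ` C. (outward_normal K F \<bullet> v) * (LINT z:F|surface_measure F. f z))"
    by (subst sum.reindex[OF inj]) (simp add: n_def I_def)
  finally show ?thesis using facets by simp
qed

section \<open>Smooth bump functions\<close>

text \<open>The classical smooth function that is flat at 0, with a power of t in the denominator so
  that the linear span of the family is closed under differentiation.\<close>

definition flat_exp :: "nat \<Rightarrow> real \<Rightarrow> real"
  where "flat_exp k t = (if t > 0 then exp (- (1 / t)) / t ^ k else 0)"

lemma power_div_fact_le_exp:
  fixes x :: real assumes "0 \<le> x" shows "x ^ m / fact m \<le> exp x"
proof -
  have "(\<Sum>n\<in>{m}. inverse (fact n) *\<^sub>R x ^ n) \<le> (\<Sum>n. inverse (fact n) *\<^sub>R x ^ n)"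
    by (rule sum_le_suminf) (use assms summable_exp_generic[of x] in \<open>auto intro!: mult_nonneg_nonneg\<close>)
  then show ?thesis by (simp add: exp_def divide_inverse mult.commute)
qed

text \<open>The exponential beats every pole: the term of order k + m of the series of
  \<open>exp (1 / t)\<close> already bounds \<open>exp (- (1 / t))\<close> by a multiple of
  \<open>t ^ (k + m)\<close>.\<close>

lemma flat_exp_bound: "\<bar>flat_exp k t\<bar> \<le> fact (k + m) * \<bar>t\<bar> ^ m"
proof (cases "t > 0")
  case True
  have "(1 / t) ^ (k + m) / fact (k + m) \<le> exp (1 / t)" using True by (intro power_div_fact_le_exp) simp
  then have "1 \<le> exp (1 / t) * fact (k + m) * t ^ (k + m)"
    using True by (simp add: field_simps power_one_over)
  then have "exp (- (1 / t)) \<le> fact (k + m) * t ^ (k + m)"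
    by (simp add: exp_minus field_simps)
  then show ?thesis using True by (simp add: flat_exp_def field_simps power_add)
qed (simp add: flat_exp_def)

text \<open>The delicate point is t = 0, where the decay bound with m = 2 makes the difference
  quotient of order h.\<close>

lemma DERIV_flat_exp: "DERIV (flat_exp k) t :> flat_exp (k + 2) t - real k * flat_exp (k + 1) t"
proof (cases t "0::real" rule: linorder_cases)
  case less
  have "DERIV (flat_exp k) t :> 0"
    by (rule has_field_derivative_transform_within_open[of "\<lambda>_. 0" _ _ "{..<0}"])
       (use less in \<open>auto simp: flat_exp_def\<close>)
  then show ?thesis using less by (simp add: flat_exp_def)
next
  case equal
  have "((\<lambda>h. flat_exp k h / h) \<longlongrightarrow> 0) (at 0)"
  proof (rule Lim_null_comparison)
    show "\<forall>\<^sub>F h in at 0. norm (flat_exp k h / h) \<le> fact (k + 2) * \<bar>h\<bar>"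
    proof (rule eventually_at_filter[THEN iffD2], rule always_eventually, intro allI impI)
      fix h :: real assume "h \<noteq> 0"
      then show "norm (flat_exp k h / h) \<le> fact (k + 2) * \<bar>h\<bar>"
        using flat_exp_bound[of k h 2] by (simp add: power2_eq_square field_simps del: fact_Suc)
    qed
    show "((\<lambda>h. fact (k + 2) * \<bar>h\<bar>) \<longlongrightarrow> (0::real)) (at 0)"
      by (auto intro!: tendsto_eq_intros)
  qed
  then show ?thesis using equal by (simp add: DERIV_def flat_exp_def)
next
  case greater
  have "DERIV (\<lambda>t. exp (- (1 / t)) / t ^ k) t :> flat_exp (k + 2) t - real k * flat_exp (k + 1) t"
  proof (rule DERIV_cong)
    show "DERIV (\<lambda>t. exp (- (1 / t)) / t ^ k) t :>
      (exp (- (1 / t)) * (1 / t\<^sup>2) * t ^ k - exp (- (1 / t)) * (real k * t ^ (k - 1))) / (t ^ k * t ^ k)"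
      using greater by (auto intro!: derivative_eq_intros simp: power2_eq_square)
    show "(exp (- (1 / t)) * (1 / t\<^sup>2) * t ^ k - exp (- (1 / t)) * (real k * t ^ (k - 1))) / (t ^ k * t ^ k)
      = flat_exp (k + 2) t - real k * flat_exp (k + 1) t"
      using greater by (cases k) (auto simp: flat_exp_def field_simps power2_eq_square)
  qed
  then show ?thesis
    by (rule has_field_derivative_transform_within_open[of _ _ _ "{0<..}"])
       (use greater in \<open>auto simp: flat_exp_def\<close>)
qed

text \<open>Closed under partial derivatives, which yields the smoothness of the bump function \<open>k = 0\<close>.\<close>

inductive bump_class :: "real^'n \<Rightarrow> real \<Rightarrow> (real^'n \<Rightarrow> real) \<Rightarrow> bool" for x0 r where
  base: "bump_class x0 r (\<lambda>x. flat_exp k (r\<^sup>2 - (x - x0) \<bullet> (x - x0)))"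
| coord: "bump_class x0 r f \<Longrightarrow> bump_class x0 r (\<lambda>x. (x - x0) $ j * f x)"
| scale: "bump_class x0 r f \<Longrightarrow> bump_class x0 r (\<lambda>x. c * f x)"
| add: "bump_class x0 r f \<Longrightarrow> bump_class x0 r g \<Longrightarrow> bump_class x0 r (\<lambda>x. f x + g x)"

lemma partial_eqI: "(f has_derivative f') (at x) \<Longrightarrow> partial j f x = f' (axis j 1)"
  unfolding partial_def using frechet_derivative_at by metis

lemma bump_class_closed:
  fixes f :: "real^'n \<Rightarrow> real"
  assumes "bump_class x0 r f"
  shows "(\<forall>x. f differentiable (at x)) \<and> (\<forall>i. bump_class x0 r (partial i f))"
  using assms
proof induction
  case (base k)
  let ?s = "\<lambda>x. r\<^sup>2 - (x - x0) \<bullet> (x - x0)"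
  let ?f = "\<lambda>x::real^'n. flat_exp k (?s x)"
  have d: "(?f has_derivative (\<lambda>v. (- 2 * ((x - x0) \<bullet> v)) *
      (flat_exp (k + 2) (?s x) - real k * flat_exp (k + 1) (?s x)))) (at x)" for x
  proof -
    have "(?s has_derivative (\<lambda>v. - 2 * ((x - x0) \<bullet> v))) (at x)"
      by (auto intro!: derivative_eq_intros simp: inner_commute)
    then have "(?f has_derivative (\<lambda>v. (flat_exp (k + 2) (?s x) - real k * flat_exp (k + 1) (?s x)) * (- 2 * ((x - x0) \<bullet> v)))) (at x)"
      by (rule has_derivative_compose[OF _ DERIV_flat_exp[unfolded has_field_derivative_def]])
    then show ?thesis by (simp add: mult.commute)
  qed
  have "partial i ?f = (\<lambda>x. (- 2) * ((x - x0) $ i * flat_exp (k + 2) (?s x)) +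
      (2 * real k) * ((x - x0) $ i * flat_exp (k + 1) (?s x)))" for i
    by (rule ext) (simp only: partial_eqI[OF d], simp add: inner_axis algebra_simps)
  moreover have "bump_class x0 r (\<lambda>x. (- 2) * ((x - x0) $ i * flat_exp (k + 2) (?s x)) +
      (2 * real k) * ((x - x0) $ i * flat_exp (k + 1) (?s x)))" for i
    by (intro bump_class.intros)
  ultimately show ?case using d by (auto simp: differentiable_def)
next
  case (coord f j)
  let ?f' = "\<lambda>x. frechet_derivative f (at x)"
  have d: "((\<lambda>x. (x - x0) $ j * f x) has_derivative (\<lambda>v. (x - x0) $ j * ?f' x v + v $ j * f x)) (at x)" for x
  proof (rule has_derivative_mult)
    have "((\<lambda>x. x - x0) has_derivative (\<lambda>v. v)) (at x)"
      by (auto intro!: derivative_eq_intros)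
    from bounded_linear.has_derivative[OF bounded_linear_vec_nth[of j] this]
    show "((\<lambda>x. (x - x0) $ j) has_derivative (\<lambda>v. v $ j)) (at x)" .
    show "(f has_derivative ?f' x) (at x)" using coord.IH frechet_derivative_works by blast
  qed
  have "partial i (\<lambda>x. (x - x0) $ j * f x) =
     (\<lambda>x. (x - x0) $ j * partial i f x + (if i = j then 1 else 0) * f x)" for i
    by (rule ext) (simp only: partial_eqI[OF d], simp add: partial_def axis_def)
  moreover have "bump_class x0 r (\<lambda>x. (x - x0) $ j * partial i f x + (if i = j then 1 else 0) * f x)" for i
    using coord by (intro bump_class.intros) auto
  ultimately show ?case using d by (auto simp: differentiable_def)
next
  case (scale f c)
  let ?f' = "\<lambda>x. frechet_derivative f (at x)"
  have d: "((\<lambda>x. c * f x) has_derivative (\<lambda>v. c * ?f' x v)) (at x)" for x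
    using scale.IH frechet_derivative_works by (intro has_derivative_mult_right) blast
  have "partial i (\<lambda>x. c * f x) = (\<lambda>x. c * partial i f x)" for i
    by (rule ext) (simp only: partial_eqI[OF d], simp add: partial_def)
  then show ?case using d scale by (auto simp: differentiable_def intro: bump_class.intros)
next
  case (add f g)
  have d: "((\<lambda>x. f x + g x) has_derivative (\<lambda>v. frechet_derivative f (at x) v + frechet_derivative g (at x) v)) (at x)" for x
    using add.IH frechet_derivative_works by (intro has_derivative_add) blast+
  have "partial i (\<lambda>x. f x + g x) = (\<lambda>x. partial i f x + partial i g x)" for i
    by (rule ext) (simp only: partial_eqI[OF d], simp add: partial_def)
  then show ?case using d add by (auto simp: differentiable_def intro: bump_class.intros)
qed

lemma test_function_bump:
  assumes r: "r > 0" and sub: "cball x0 r \<subseteq> \<Omega>"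
  obtains \<phi> where "test_function \<Omega> \<phi>" "\<And>x. x \<in> ball x0 r \<Longrightarrow> 0 < \<phi> x" "\<And>x. x \<notin> ball x0 r \<Longrightarrow> \<phi> x = 0"
proof -
  define \<phi> where "\<phi> = (\<lambda>x. flat_exp 0 (r\<^sup>2 - (x - x0) \<bullet> (x - x0)))"
  have in_ball: "r\<^sup>2 - (x - x0) \<bullet> (x - x0) > 0 \<longleftrightarrow> x \<in> ball x0 r" for x
  proof -
    have "r\<^sup>2 - (x - x0) \<bullet> (x - x0) > 0 \<longleftrightarrow> (norm (x - x0))\<^sup>2 < r\<^sup>2" by (simp add: power2_norm_eq_inner)
    also have "\<dots> \<longleftrightarrow> norm (x - x0) < r"
    proof
      show "(norm (x - x0))\<^sup>2 < r\<^sup>2 \<Longrightarrow> norm (x - x0) < r"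
        using power_less_imp_less_base[of "norm (x - x0)" 2 r] r by simp
      show "norm (x - x0) < r \<Longrightarrow> (norm (x - x0))\<^sup>2 < r\<^sup>2"
        using power_strict_mono[of "norm (x - x0)" r 2] by simp
    qed
    finally show ?thesis by (simp add: dist_norm norm_minus_commute)
  qed
  have pos: "0 < \<phi> x" if "x \<in> ball x0 r" for x
    using in_ball[of x, THEN iffD2, OF that] unfolding \<phi>_def flat_exp_def by simp
  have zero: "\<phi> x = 0" if "x \<notin> ball x0 r" for x
    unfolding \<phi>_def flat_exp_def using that in_ball[of x] by (simp only: if_False)
  have "bump_class x0 r (iterated_partial js \<phi>)" for js
  proof (induction js)
    case Nil
    show ?case unfolding \<phi>_def iterated_partial.simps by (rule bump_class.base)
  next
    case (Cons j js)
    then show ?case using bump_class_closed[OF Cons.IH] by simp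
  qed
  then have "iterated_partial js \<phi> differentiable (at x)" for js x using bump_class_closed by blast
  moreover have supp: "{x. \<phi> x \<noteq> 0} = ball x0 r"
    using pos zero by force
  moreover have "closure (ball x0 r) = cball x0 r" using r by simp
  ultimately have "test_function \<Omega> \<phi>" using sub by (simp add: test_function_def)
  then show thesis using pos zero by (rule that)
qed

lemma frechet_derivative_partial:
  fixes f :: "real^'n \<Rightarrow> 'b::real_normed_vector"
  assumes "f differentiable (at x)"
  shows "frechet_derivative f (at x) v = (\<Sum>j\<in>UNIV. v $ j *\<^sub>R partial j f x)"
proof -
  have lin: "linear (frechet_derivative f (at x))" using assms by (rule linear_frechet_derivative)
  have "v = (\<Sum>j\<in>UNIV. v $ j *\<^sub>R axis j 1)"
    using basis_expansion[of v] by (simp add: scalar_mult_eq_scaleR)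
  then have "frechet_derivative f (at x) v = frechet_derivative f (at x) (\<Sum>j\<in>UNIV. v $ j *\<^sub>R axis j 1)"
    by (rule arg_cong)
  also have "\<dots> = (\<Sum>j\<in>UNIV. v $ j *\<^sub>R partial j f x)"
    by (simp only: linear_sum[OF lin] linear_cmul[OF lin] partial_def)
  finally show ?thesis .
qed

lemma c1_test_function:
  assumes "test_function \<Omega> \<phi>" shows "c1 \<phi>"
proof -
  have d: "iterated_partial js \<phi> differentiable (at x)" for js x using assms by (simp add: test_function_def)
  have 1: "\<phi> differentiable (at x)" for x using d[of "[]"] by simp
  have 2: "continuous_on UNIV (partial j \<phi>)" for j
    using d[of "[j]"] by (simp add: continuous_at_imp_continuous_on differentiable_imp_continuous_within)
  show ?thesis unfolding c1_def
  proof (intro exI conjI allI)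
    show "(\<phi> has_derivative frechet_derivative \<phi> (at x)) (at x)" for x
      using 1 frechet_derivative_works by blast
    show "continuous_on UNIV (\<lambda>x. frechet_derivative \<phi> (at x) v)" for v
      unfolding frechet_derivative_partial[OF 1] by (intro continuous_intros 2)
  qed
qed

section \<open>Facets of conforming meshes\<close>

lemma mesh_element:
  fixes K :: "(real^'n) set"
  assumes "conforming_mesh \<Omega> \<T>" and "K \<in> \<T>"
  shows "int CARD('n) simplex K" "compact K" "convex K" "closed K" "polyhedron K"
    "aff_dim K = int CARD('n)" "interior K \<noteq> {}" "interior K \<subseteq> \<Omega>" "K \<subseteq> closure \<Omega>"
proof -
  show K: "int CARD('n) simplex K" using assms by (simp add: conforming_mesh_def)
  then show "compact K" "convex K" "closed K" "polyhedron K" "aff_dim K = int CARD('n)"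
    using compact_simplex convex_simplex closed_simplex simplex_imp_polyhedron aff_dim_simplex by blast+
  then show "interior K \<noteq> {}"
    by (metis aff_dim_eq_full rel_interior_eq_empty rel_interior_interior aff_dim_empty DIM_cart DIM_real mult.right_neutral of_nat_0_le_iff neg_0_le_iff_le not_one_le_zero)
  show "interior K \<subseteq> \<Omega>" "K \<subseteq> closure \<Omega>" using assms by (auto simp: conforming_mesh_def)
qed

text \<open>The intersection is a face of K that meets the interior of K, hence all of K. Then K
  would be a proper face of K', although both have full dimension.\<close>

lemma mesh_interior_disjoint:
  fixes K :: "(real^'n) set"
  assumes "conforming_mesh \<Omega> \<T>" "K \<in> \<T>" "K' \<in> \<T>" "x \<in> interior K" "x \<in> K'"
  shows "K = K'"
proof (rule ccontr)
  assume ne: "K \<noteq> K'"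
  have faces: "(K \<inter> K') face_of K" "(K \<inter> K') face_of K'" using assms by (auto simp: conforming_mesh_def)
  have "x \<in> K \<inter> K'" using assms interior_subset by blast
  then have "K \<inter> K' = K" using face_of_disjoint_interior[OF faces(1)] assms(4) by blast
  then have "K face_of K'" using faces(2) by simp
  then have "aff_dim K < aff_dim K'"
    using face_of_aff_dim_lt ne mesh_element(3)[OF assms(1,3)] by blast
  then show False using mesh_element(6)[OF assms(1)] assms(2,3) by simp
qed

text \<open>A face of K that meets the relative interior of F contains F, so F is a face of the
  intersection. The intersection is a proper face of K, and the dimension leaves no room between it
  and F.\<close>

lemma mesh_facet_other:
  fixes K :: "(real^'n) set"
  assumes "conforming_mesh \<Omega> \<T>" "K \<in> \<T>" "K' \<in> \<T>" "K' \<noteq> K"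
    and F: "F facet_of K" and x: "x \<in> rel_interior F" "x \<in> K'"
  shows "F facet_of K'"
proof -
  note el = mesh_element[OF assms(1)]
  have faces: "(K \<inter> K') face_of K" "(K \<inter> K') face_of K'" using assms by (auto simp: conforming_mesh_def)
  have FK: "F face_of K" "F \<noteq> {}" "aff_dim F = aff_dim K - 1" using F by (auto simp: facet_of_def)
  have "x \<in> F" using x rel_interior_subset by blast
  then have "F \<subseteq> K \<inter> K'"
    using subset_of_face_of[OF faces(1) face_of_imp_subset[OF FK(1)]] x face_of_imp_subset[OF FK(1)] by blast
  then have FKK: "F face_of (K \<inter> K')" using FK(1) face_of_subset by blast
  have "K \<inter> K' \<noteq> K"
  proof
    assume "K \<inter> K' = K"
    moreover obtain y where "y \<in> interior K" using el(7)[OF assms(2)] by blast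
    ultimately have "y \<in> K'" using interior_subset by blast
    then show False using mesh_interior_disjoint[OF assms(1-3) \<open>y \<in> interior K\<close>] assms(4) by simp
  qed
  then have lt: "aff_dim (K \<inter> K') < aff_dim K" using face_of_aff_dim_lt[OF el(3)[OF assms(2)] faces(1)] by blast
  have "F = K \<inter> K'"
  proof (rule ccontr)
    assume "F \<noteq> K \<inter> K'"
    then have "aff_dim F < aff_dim (K \<inter> K')"
      using face_of_aff_dim_lt[OF convex_Int[OF el(3)[OF assms(2)] el(3)[OF assms(3)]] FKK] by simp
    then show False using lt FK(3) by linarith
  qed
  then show ?thesis using faces(2) FK(2,3) el(6)[OF assms(2)] el(6)[OF assms(3)] by (simp add: facet_of_def)
qed

text \<open>Two elements on the same side of a common facet overlap: starting at a relative interior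
  point of F, a short step towards an interior point p of K' stays in K.\<close>

lemma mesh_facet_same_side:
  fixes K :: "(real^'n) set"
  assumes mesh: "conforming_mesh \<Omega> \<T>" "K \<in> \<T>" "K' \<in> \<T>"
    and F: "F facet_of K" "F facet_of K'" and eq: "outward_normal K F = outward_normal K' F"
  shows "K = K'"
proof -
  note el = mesh_element[OF mesh(1)]
  define n where "n = outward_normal K F"
  obtain b where b: "norm n = 1" "affine hull F = {x. n \<bullet> x = b}"
      "K \<subseteq> {x. n \<bullet> x \<le> b}" "F = K \<inter> {x. n \<bullet> x = b}"
    using outward_normal[OF el(5,6)[OF mesh(2)] F(1)] unfolding n_def by metis
  obtain b' where b': "affine hull F = {x. n \<bullet> x = b'}"
      "K' \<subseteq> {x. n \<bullet> x \<le> b'}" "F = K' \<inter> {x. n \<bullet> x = b'}"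
    using outward_normal[OF el(5,6)[OF mesh(3)] F(2)] unfolding n_def eq by metis
  have Fne: "F \<noteq> {}" "convex F" using F(1) el(3)[OF mesh(2)] by (auto simp: facet_of_def face_of_imp_convex)
  then obtain x where x: "x \<in> rel_interior F" using rel_interior_eq_empty by blast
  then have xF: "x \<in> F" using rel_interior_subset by blast
  then have bb: "b' = b" "n \<bullet> x = b" using b(4) b'(3) by auto
  have not_hyper: "\<exists>q\<in>interior L. n \<bullet> q < b" if L: "L \<in> \<T>" "F facet_of L" "L \<subseteq> {x. n \<bullet> x \<le> b}" "F = L \<inter> {x. n \<bullet> x = b}" for L
  proof -
    obtain q where q: "q \<in> interior L" using el(7)[OF L(1)] by blast
    have "F face_of L" "F \<noteq> L" using L(2) by (auto simp: facet_of_def)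
    then have "q \<notin> F" using q face_of_disjoint_interior by blast
    then show ?thesis using L(3,4) q interior_subset by (intro bexI[of _ q]) (force, auto)
  qed
  obtain q where q: "q \<in> K" "n \<bullet> q < b" using not_hyper[OF mesh(2) F(1) b(3,4)] interior_subset by blast
  obtain p where p: "p \<in> interior K'" "n \<bullet> p < b" using not_hyper[OF mesh(3) F(2)] b'(2,3) bb by auto
  obtain e where e: "e > 0" "ball x e \<inter> affine hull F \<subseteq> F" using x by (auto simp: mem_rel_interior_ball)
  \<comment> \<open>Ratio of the depths of p and q below the hyperplane. It makes \<open>w\<close>
    tangential to the hyperplane.\<close>
  define k where "k = (n \<bullet> p - b) / (n \<bullet> q - b)"
  have k: "k > 0" using p(2) q(2) by (simp add: k_def divide_neg_neg)
  define w where "w = (p - x) - k *\<^sub>R (q - x)"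
  \<comment> \<open>Since \<open>s * k\<close> is at most 1/2, the factor
    \<open>1 / (1 - s * k)\<close> below is at most 2. This explains the 2 in the last condition,
    which keeps z within the ball around x on which the hyperplane belongs to F.\<close>
  obtain s where s: "s > 0" "s \<le> 1" "s * k \<le> 1/2" "2 * s * norm w < e"
  proof
    define s where "s = min 1 (min (1 / (2 * k)) (e / (2 * norm w + 1) / 2))"
    show "s > 0" using k e(1) by (auto simp: s_def add_nonneg_pos)
    show "s \<le> 1" by (simp add: s_def)
    have "s \<le> 1 / (2 * k)" by (simp add: s_def)
    then show "s * k \<le> 1/2" using k by (simp add: field_simps)
    have nw: "2 * norm w + 1 > 0" by (simp add: add_nonneg_pos)
    have "s \<le> e / (2 * norm w + 1) / 2" by (simp add: s_def)
    then have "2 * s * (2 * norm w + 1) \<le> e" using nw by (simp add: field_simps)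
    moreover have "2 * s * norm w \<le> s * (2 * norm w + 1)" using \<open>s > 0\<close> by (simp add: algebra_simps)
    moreover have "0 < s * (2 * norm w + 1)" using \<open>s > 0\<close> nw by simp
    ultimately show "2 * s * norm w < e" by linarith
  qed
  define z where "z = x + (s / (1 - s * k)) *\<^sub>R w"
  have sk: "1 - s * k \<ge> 1/2" using s(3) by simp
  have "n \<bullet> w = 0" using q(2) bb(2) by (simp add: w_def k_def inner_diff_right)
  then have "z \<in> affine hull F" using b(2) bb(2) by (simp add: z_def inner_add_right)
  moreover have "dist x z < e"
  proof -
    have "dist x z = s / (1 - s * k) * norm w" using s(1) sk by (simp add: z_def dist_norm)
    also have "s / (1 - s * k) \<le> s / (1/2)" using s(1) sk by (intro divide_left_mono) auto
    then have "s / (1 - s * k) * norm w \<le> 2 * s * norm w" by (intro mult_right_mono) auto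
    finally show ?thesis using s(4) by linarith
  qed
  ultimately have "z \<in> F" using e(2) by auto
  then have zK: "z \<in> K" using b(4) by blast
  \<comment> \<open>The choice of z makes the point on the segment from x to p a convex combination
    of z in F and q in K.\<close>
  have "x + s *\<^sub>R (p - x) = (1 - s * k) *\<^sub>R z + (s * k) *\<^sub>R q"
  proof -
    have "(1 - s * k) *\<^sub>R z = (1 - s * k) *\<^sub>R x + s *\<^sub>R w" using sk by (simp add: z_def scaleR_add_right)
    then show ?thesis by (simp add: w_def algebra_simps)
  qed
  moreover have "(1 - s * k) *\<^sub>R z + (s * k) *\<^sub>R q \<in> K"
    using zK q(1) el(3)[OF mesh(2)] s k sk by (intro convexD) auto
  ultimately have inK: "x + s *\<^sub>R (p - x) \<in> K" by simp
  have "x - s *\<^sub>R (x - p) \<in> interior K'"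
    using mem_interior_convex_shrink[OF el(3)[OF mesh(3)] p(1)] xF b'(3) s by blast
  then have "x + s *\<^sub>R (p - x) \<in> interior K'" by (simp add: algebra_simps)
  then show ?thesis using mesh_interior_disjoint[OF mesh(1,3,2)] inK by blast
qed

lemma mesh_facet_opposite:
  fixes K :: "(real^'n) set"
  assumes mesh: "conforming_mesh \<Omega> \<T>" "K \<in> \<T>" "K' \<in> \<T>"
    and F: "F facet_of K" "F facet_of K'" and ne: "K \<noteq> K'"
  shows "outward_normal K' F = - outward_normal K F"
proof -
  note el = mesh_element[OF mesh(1)]
  obtain b where b: "norm (outward_normal K F) = 1" "affine hull F = {x. outward_normal K F \<bullet> x = b}"
    using outward_normal[OF el(5,6)[OF mesh(2)] F(1)] by metis
  obtain b' where b': "norm (outward_normal K' F) = 1" "affine hull F = {x. outward_normal K' F \<bullet> x = b'}"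
    using outward_normal[OF el(5,6)[OF mesh(3)] F(2)] by metis
  show ?thesis
    using hyperplane_normal_unique[OF b(1) b'(1), of b b'] b(2) b'(2) mesh_facet_same_side[OF mesh F] ne by auto
qed

text \<open>K' and K'' both lie on the side of F opposite to K, hence on the same side.\<close>

lemma mesh_facet_unique:
  fixes K :: "(real^'n) set"
  assumes mesh: "conforming_mesh \<Omega> \<T>" "K \<in> \<T>" "K' \<in> \<T>" "K'' \<in> \<T>"
    and F: "F facet_of K" "F facet_of K'" "F facet_of K''" and ne: "K \<noteq> K'" "K \<noteq> K''"
  shows "K' = K''"
  using mesh_facet_same_side[OF mesh(1,3,4) F(2,3)] mesh_facet_opposite[OF mesh(1,2,3) F(1,2) ne(1)]
    mesh_facet_opposite[OF mesh(1,2,4) F(1,3) ne(2)] by simp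

lemma neighbor_eq:
  fixes K :: "(real^'n) set"
  assumes mesh: "conforming_mesh \<Omega> \<T>" "K \<in> \<T>" "K' \<in> \<T>"
    and F: "F facet_of K" "F facet_of K'" and ne: "K \<noteq> K'"
  shows "neighbor \<T> K F = K'"
  unfolding neighbor_def
proof (rule the_equality)
  show "K' \<in> \<T> \<and> K' \<noteq> K \<and> F facet_of K'" using assms by simp
  fix K'' assume K'': "K'' \<in> \<T> \<and> K'' \<noteq> K \<and> F facet_of K''"
  show "K'' = K'"
    using mesh_facet_unique[OF mesh(1,2) _ mesh(3) F(1) _ F(2) _ ne, of K''] K'' by metis
qed

lemma rel_interior_facet_meets:
  fixes F :: "(real^'n) set"
  assumes "open \<Omega>" "convex F" "x \<in> F" "x \<in> \<Omega>"
  obtains y where "y \<in> rel_interior F" "y \<in> \<Omega>"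
proof -
  have "x \<in> \<Omega> \<inter> closure (rel_interior F)"
    using assms convex_closure_rel_interior[OF assms(2)] closure_subset by auto
  then show thesis using open_Int_closure_eq_empty[OF assms(1), of "rel_interior F"] that by blast
qed

text \<open>If no other element contained y, removing their closed union from the domain would leave
  an open neighborhood of y inside K. But a point of a facet is not interior to K.\<close>

lemma neighbor_exists:
  fixes K :: "(real^'n) set"
  assumes op: "open \<Omega>" and mesh: "conforming_mesh \<Omega> \<T>" "K \<in> \<T>" and F: "F facet_of K"
    and x: "x \<in> F" "x \<in> \<Omega>"
  shows "neighbor \<T> K F \<in> \<T>" "neighbor \<T> K F \<noteq> K" "F facet_of neighbor \<T> K F"
proof -
  note el = mesh_element[OF mesh(1)]
  have fF: "F face_of K" "F \<noteq> K" "convex F" using F el(3)[OF mesh(2)] by (auto simp: facet_of_def face_of_imp_convex)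
  obtain y where y: "y \<in> rel_interior F" "y \<in> \<Omega>" using rel_interior_facet_meets[OF op fF(3) x] .
  define U where "U = \<Union>(\<T> - {K})"
  have "finite \<T>" using mesh by (simp add: conforming_mesh_def)
  then have "closed U" unfolding U_def using el(4) by (intro closed_Union) auto
  have "y \<in> U"
  proof (rule ccontr)
    assume "y \<notin> U"
    then have op': "open (\<Omega> - U)" "y \<in> \<Omega> - U" using op \<open>closed U\<close> y by auto
    have "\<Omega> - U \<subseteq> K"
    proof
      fix z assume z: "z \<in> \<Omega> - U"
      then have "z \<in> closure \<Omega>" using closure_subset by blast
      then have "z \<in> \<Union>\<T>" using mesh(1) by (simp add: conforming_mesh_def)
      then show "z \<in> K" using z by (auto simp: U_def)
    qed
    then have "y \<in> interior K" using op' interior_maximal by blast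
    then show False using face_of_disjoint_interior[OF fF(1,2)] y(1) rel_interior_subset by blast
  qed
  then obtain K' where K': "K' \<in> \<T>" "K' \<noteq> K" "y \<in> K'" by (auto simp: U_def)
  then have FK': "F facet_of K'" using mesh_facet_other[OF mesh(1,2) K'(1,2) F y(1)] by blast
  have "neighbor \<T> K F = K'"
    by (rule neighbor_eq[OF mesh K'(1) F FK']) (use K'(2) in simp)
  then show "neighbor \<T> K F \<in> \<T>" "neighbor \<T> K F \<noteq> K" "F facet_of neighbor \<T> K F" using K' FK' by auto
qed

lemma elem_val_eq:
  fixes K :: "(real^'n) set"
  assumes "conforming_mesh \<Omega> \<T>" "K \<in> \<T>" "constant_on_elements \<T> f" "x \<in> interior K"
  shows "f x = elem_val K f"
proof -
  obtain C where C: "\<forall>x\<in>interior K. f x = C" using assms by (auto simp: constant_on_elements_def)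
  have "elem_val K f = C" unfolding elem_val_def
    by (rule the_equality) (use C assms(4) in auto)
  then show ?thesis using C assms(4) by simp
qed

section \<open>Divergence free coefficients have no normal jump\<close>

lemma AE_notin_open_imp_empty:
  fixes U :: "'a::euclidean_space set"
  assumes "AE x in lborel. x \<notin> U" "open U" shows "U = {}"
proof -
  have "U \<in> null_sets lebesgue"
    using assms by (auto simp: AE_iff_null_sets[of U lborel] null_sets_completionI)
  then show ?thesis using open_not_negligible[OF assms(2)] negligible_iff_null_sets by blast
qed

text \<open>Pulled back to the slab, the points projecting near x form a nonempty open set of full
  dimension on which the integrand is positive. A vanishing integral would make this set
  null.\<close>

lemma surface_integral_pos:
  fixes n :: "real^'n" and \<phi> :: "real^'n \<Rightarrow> real"
  assumes n: "norm n = 1" and hull: "affine hull F = {x. n \<bullet> x = b}" and F: "compact F"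
    and x: "x \<in> rel_interior F" and r: "r > 0" and \<phi>: "continuous_on UNIV \<phi>"
    and pos: "\<And>y. y \<in> ball x r \<Longrightarrow> 0 < \<phi> y" and nonneg: "\<And>y. 0 \<le> \<phi> y"
  shows "0 < (LINT z:F|surface_measure F. \<phi> z)"
proof -
  have [measurable]: "F \<in> sets borel" using F by (simp add: borel_compact)
  have [measurable]: "\<phi> \<in> borel_measurable borel" using \<phi> by (rule borel_measurable_continuous_onI)
  have nn: "n \<bullet> n = 1" using n by (simp add: norm_eq_1)
  obtain e where e: "e > 0" "ball x e \<inter> affine hull F \<subseteq> F" using x by (auto simp: mem_rel_interior_ball)
  let ?p = "\<lambda>y. y - (n \<bullet> y) *\<^sub>R n + b *\<^sub>R n"
  define U where "U = {y. dist x (?p y) < min r e} \<inter> {y. \<bar>n \<bullet> y\<bar> < 1/2}"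
  have "open U" unfolding U_def
    by (intro open_Int open_Collect_less continuous_intros)
  have "x - b *\<^sub>R n \<in> U"
  proof -
    have "x \<in> affine hull F" by (rule hull_inc[OF subsetD[OF rel_interior_subset x]])
    then have "n \<bullet> x = b" using hull by auto
    then show ?thesis using r e(1) by (simp add: U_def inner_diff_right nn)
  qed
  have int: "set_integrable (surface_measure F) F \<phi>"
    by (rule set_integrable_surface_measure[OF n hull F \<phi>])
  have ge: "0 \<le> (LINT z:F|surface_measure F. \<phi> z)"
    unfolding set_lebesgue_integral_def by (rule integral_nonneg_AE) (simp add: nonneg)
  moreover have "(LINT z:F|surface_measure F. \<phi> z) \<noteq> 0"
  proof
    assume "(LINT z:F|surface_measure F. \<phi> z) = 0"
    then have "(LINT z|surface_measure F. indicator F z *\<^sub>R \<phi> z) = 0" by (simp add: set_lebesgue_integral_def)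
    moreover have "(\<integral>\<^sup>+z. ennreal (indicator F z *\<^sub>R \<phi> z) \<partial>surface_measure F) =
        ennreal (LINT z|surface_measure F. indicator F z *\<^sub>R \<phi> z)"
      by (rule nn_integral_eq_integral) (use int nonneg in \<open>auto simp: set_integrable_def\<close>)
    ultimately have "(\<integral>\<^sup>+z. ennreal (indicator F z *\<^sub>R \<phi> z) \<partial>surface_measure F) = 0" by simp
    also have "(\<integral>\<^sup>+z. ennreal (indicator F z *\<^sub>R \<phi> z) \<partial>surface_measure F) =
      (\<integral>\<^sup>+y. ennreal (indicator F (?p y) *\<^sub>R \<phi> (?p y)) * indicator F (?p y) * indicator {y. \<bar>n \<bullet> y\<bar> \<le> 1/2} y \<partial>lborel)"
      by (rule nn_integral_surface_measure[OF n hull]) measurable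
    finally have "AE y in lborel. ennreal (indicator F (?p y) *\<^sub>R \<phi> (?p y)) * indicator F (?p y) * indicator {y. \<bar>n \<bullet> y\<bar> \<le> 1/2} y = 0"
      by (subst (asm) nn_integral_0_iff_AE) auto
    then have "AE y in lborel. y \<notin> U"
    proof eventually_elim
      case (elim y)
      show ?case
      proof
        assume yU: "y \<in> U"
        have "n \<bullet> ?p y = b" by (simp add: inner_simps nn)
        then have "?p y \<in> affine hull F" using hull by simp
        moreover have "?p y \<in> ball x e" "?p y \<in> ball x r" using yU by (auto simp: U_def)
        ultimately have "?p y \<in> F" "0 < \<phi> (?p y)" using e(2) pos by blast+
        moreover have "\<bar>n \<bullet> y\<bar> \<le> 1/2" using yU by (simp add: U_def)
        ultimately show False using elim by simp
      qed
    qed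
    then show False using AE_notin_open_imp_empty \<open>open U\<close> \<open>x - b *\<^sub>R n \<in> U\<close> by blast
  qed
  ultimately show ?thesis by simp
qed

text \<open>Test with a bump function supported in the two elements that share the facet.\<close>

lemma divergence_free_normal_jump:
  fixes K :: "(real^'n) set" and \<L> :: "'n \<Rightarrow> real^'n \<Rightarrow> real^'l^'l"
  assumes op: "open \<Omega>" and mesh: "conforming_mesh \<Omega> \<T>" "K \<in> \<T>" and F: "F facet_of K"
    and x: "x \<in> F" "x \<in> \<Omega>" and const: "\<And>j. constant_on_elements \<T> (\<L> j)"
    and div: "divergence_free \<Omega> \<L>"
  shows "(\<Sum>j\<in>UNIV. outward_normal K F $ j *\<^sub>R elem_val K (\<L> j)) =
    (\<Sum>j\<in>UNIV. outward_normal K F $ j *\<^sub>R elem_val (neighbor \<T> K F) (\<L> j))"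
proof -
  let ?L = "\<lambda>K j. elem_val K (\<L> j)"
  note el = mesh_element[OF mesh(1)]
  define K' where "K' = neighbor \<T> K F"
  have K': "K' \<in> \<T>" "K' \<noteq> K" "F facet_of K'"
    using neighbor_exists[OF op mesh F x] by (simp_all add: K'_def)
  have convF: "convex F" and cF: "compact F"
    using F el(2,3)[OF mesh(2)] by (auto simp: facet_of_def face_of_imp_convex intro: compact_facet)
  obtain y where y: "y \<in> rel_interior F" "y \<in> \<Omega>" using rel_interior_facet_meets[OF op convF x] .
  have yF: "y \<in> F" using y(1) rel_interior_subset by blast
  \<comment> \<open>Everything the support of the bump has to avoid: the other elements, and the
    other facets of the two that share F. After Gauss only the integral over F then
    survives.\<close>
  define Z where "Z = \<Union>(\<T> - {K, K'}) \<union> \<Union>({G. G facet_of K} - {F}) \<union> \<Union>({G. G facet_of K'} - {F})"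
  have fin: "finite \<T>" using mesh(1) by (simp add: conforming_mesh_def)
  have "closed Z" unfolding Z_def
  proof (intro closed_Un closed_Union)
    show "finite ({G. G facet_of K} - {F})" "finite ({G. G facet_of K'} - {F})"
      using finite_polyhedron_facets el(5) mesh(2) K'(1) by blast+
    show "\<forall>S\<in>{G. G facet_of K} - {F}. closed S" "\<forall>S\<in>{G. G facet_of K'} - {F}. closed S"
      using compact_facet compact_imp_closed el(2,3) mesh(2) K'(1) by blast+
  qed (use fin el(4) in auto)
  have facet_notin: "y \<notin> G" if L: "L \<in> \<T>" "F facet_of L" "G facet_of L" "G \<noteq> F" for G L
  proof
    assume "y \<in> G"
    have fG: "G face_of L" "F face_of L" "aff_dim G = aff_dim L - 1" "aff_dim F = aff_dim L - 1"
      using L by (auto simp: facet_of_def)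
    have "F \<subseteq> G" using subset_of_face_of[OF fG(1) face_of_imp_subset[OF fG(2)]] y(1) \<open>y \<in> G\<close> by blast
    then have "F face_of G" using fG(2) face_of_subset face_of_imp_subset[OF fG(1)] by blast
    then have "aff_dim F < aff_dim G"
      using face_of_aff_dim_lt[of G F] L(4) face_of_imp_convex[OF fG(1)] by blast
    then show False using fG by simp
  qed
  have "y \<notin> Z"
  proof
    assume "y \<in> Z"
    then consider K'' where "K'' \<in> \<T>" "K'' \<noteq> K" "K'' \<noteq> K'" "y \<in> K''" | G where "G facet_of K" "G \<noteq> F" "y \<in> G"
      | G where "G facet_of K'" "G \<noteq> F" "y \<in> G" by (auto simp: Z_def)
    then show False
    proof cases
      case 1
      then have "F facet_of K''" using mesh_facet_other[OF mesh(1,2) 1(1,2) F y(1)] by simp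
      then have "neighbor \<T> K F = K''" using neighbor_eq[OF mesh 1(1) F] 1(2) by simp
      then show False using 1(3) by (simp add: K'_def)
    qed (use facet_notin mesh(2) F K' in blast)+
  qed
  then have "open (\<Omega> - Z)" "y \<in> \<Omega> - Z" using op \<open>closed Z\<close> y(2) by auto
  then obtain r where r: "r > 0" "cball y r \<subseteq> \<Omega> - Z" using open_contains_cball by metis
  then have "cball y r \<subseteq> \<Omega>" by blast
  then obtain \<phi> where \<phi>: "test_function \<Omega> \<phi>" "\<And>x. x \<in> ball y r \<Longrightarrow> 0 < \<phi> x" "\<And>x. x \<notin> ball y r \<Longrightarrow> \<phi> x = 0"
    using test_function_bump[OF r(1)] by metis
  have c1: "c1 \<phi>" using \<phi>(1) by (rule c1_test_function)
  have \<phi>_Z: "\<phi> z = 0" if "z \<in> Z" for z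
  proof (rule \<phi>(3))
    show "z \<notin> ball y r" using r(2) that ball_subset_cball by blast
  qed
  define n where "n = outward_normal K F"
  define I where "I = (LINT z:F|surface_measure F. \<phi> z)"
  have normal': "outward_normal K' F = - n"
    using mesh_facet_opposite[OF mesh K'(1) F K'(3)] K'(2) by (simp add: n_def)
  have gauss: "(LINT x:L|lborel. partial j \<phi> x) = outward_normal L F $ j * I"
    if L: "L \<in> \<T>" "F facet_of L" "\<Union>({G. G facet_of L} - {F}) \<subseteq> Z" for L j
  proof -
    have fin: "finite {G. G facet_of L}" using finite_polyhedron_facets el(5)[OF L(1)] by blast
    have "(LINT x:L|lborel. partial j \<phi> x) =
      (\<Sum>G | G facet_of L. (outward_normal L G \<bullet> axis j 1) * (LINT z:G|surface_measure G. \<phi> z))"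
      unfolding partial_def by (rule simplex_divergence[OF el(1)[OF L(1)] c1])
    also have "\<dots> = (\<Sum>G\<in>{F}. (outward_normal L G \<bullet> axis j 1) * (LINT z:G|surface_measure G. \<phi> z))"
    proof (rule sum.mono_neutral_right[OF fin])
      show "\<forall>G\<in>{G. G facet_of L} - {F}. outward_normal L G \<bullet> axis j 1 * (LINT z:G|surface_measure G. \<phi> z) = 0"
      proof
        fix G assume G: "G \<in> {G. G facet_of L} - {F}"
        then have "\<phi> z = 0" if "z \<in> G" for z using L(3) that by (intro \<phi>_Z) blast
        then have "(\<lambda>z. indicator G z *\<^sub>R \<phi> z) = (\<lambda>z. 0)" by (auto simp: fun_eq_iff indicator_def)
        then show "outward_normal L G \<bullet> axis j 1 * (LINT z:G|surface_measure G. \<phi> z) = 0"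
          by (simp add: set_lebesgue_integral_def)
      qed
    qed (use L(2) in auto)
    finally show ?thesis by (simp add: I_def inner_axis)
  qed
  have gK: "(LINT x:K|lborel. partial j \<phi> x) = n $ j * I" for j
    using gauss[OF mesh(2) F] by (auto simp: Z_def n_def)
  have gK': "(LINT x:K'|lborel. partial j \<phi> x) = - n $ j * I" for j
    using gauss[OF K'(1,3)] normal' by (auto simp: Z_def)
  have int: "set_integrable lborel L (partial j \<phi>)" if "L \<in> \<T>" for L j
    unfolding partial_def using c1_continuous_frechet_derivative[OF c1] el(2)[OF that]
    by (meson continuous_on_subset set_integrable_lborel_compact subset_UNIV)
  have cover: "cball y r \<subseteq> K \<union> K'"
  proof
    fix z assume z: "z \<in> cball y r"
    then have "z \<in> closure \<Omega>" using r(2) closure_subset by blast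
    then have "z \<in> \<Union>\<T>" using mesh(1) by (simp add: conforming_mesh_def)
    moreover have "z \<notin> \<Union>(\<T> - {K, K'})" using z r(2) by (auto simp: Z_def)
    ultimately show "z \<in> K \<union> K'" by auto
  qed
  have zero: "partial j \<phi> x = 0" if "x \<notin> K \<union> K'" for x j
  proof -
    have x: "x \<in> - cball y r" using that cover by blast
    have "((\<lambda>x. 0) has_derivative (\<lambda>v. 0)) (at x)" by simp
    then have "(\<phi> has_derivative (\<lambda>v. 0)) (at x)"
      by (rule has_derivative_transform_within_open[of _ _ _ _ "- cball y r"])
         (use x \<phi>(3) in \<open>auto simp: mem_ball mem_cball\<close>)
    then show ?thesis by (simp add: partial_eqI)
  qed
  \<comment> \<open>A Borel version of the distributional integrand: the coefficients are replaced
    by their element values, which changes them only on the null set of element boundaries.\<close>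
  define h where "h x = (\<Sum>j\<in>UNIV. (indicat_real K x * partial j \<phi> x) *\<^sub>R ?L K j +
      (indicat_real K' x * partial j \<phi> x) *\<^sub>R ?L K' j)" for x
  have int': "integrable lborel (\<lambda>x. indicat_real L x * partial j \<phi> x)" if "L \<in> \<T>" for L j
    using int[OF that, of j] by (simp add: set_integrable_def)
  have h_int: "integrable lborel h" unfolding h_def
    using int'[OF mesh(2)] int'[OF K'(1)]
    by (intro Bochner_Integration.integrable_sum Bochner_Integration.integrable_add integrable_scaleR_left) auto
  then have h_meas: "h \<in> borel_measurable lborel" by auto
  have h_val: "integral\<^sup>L lborel h = (\<Sum>j\<in>UNIV. (n $ j * I) *\<^sub>R ?L K j + (- n $ j * I) *\<^sub>R ?L K' j)"
  proof -
    have "integral\<^sup>L lborel h = (\<Sum>j\<in>UNIV. (LINT x|lborel. indicat_real K x * partial j \<phi> x) *\<^sub>R ?L K j +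
      (LINT x|lborel. indicat_real K' x * partial j \<phi> x) *\<^sub>R ?L K' j)"
      unfolding h_def using int'[OF mesh(2)] int'[OF K'(1)]
      by (subst Bochner_Integration.integral_sum)
         (auto intro!: sum.cong Bochner_Integration.integrable_add integrable_scaleR_left
            simp: Bochner_Integration.integral_add integral_scaleR_left)
    then show ?thesis using gK gK' by (simp add: set_lebesgue_integral_def)
  qed
  let ?g = "\<lambda>x. indicat_real \<Omega> x *\<^sub>R (\<Sum>j\<in>UNIV. partial j \<phi> x *\<^sub>R \<L> j x)"
  have ae: "AE x in lebesgue. h x = ?g x"
  proof -
    have "frontier K \<union> frontier K' \<in> null_sets lebesgue"
      using negligible_convex_frontier el(3) mesh(2) K'(1) negligible_Un negligible_iff_null_sets by metis
    then have "AE x in lebesgue. x \<notin> frontier K \<union> frontier K'" by (rule AE_not_in)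
    then show ?thesis
    proof eventually_elim
      case (elim x)
      then consider "x \<in> interior K" | "x \<in> interior K'" | "x \<notin> K" "x \<notin> K'"
        using closure_closed[OF el(4)] mesh(2) K'(1) by (auto simp: frontier_def)
      then show ?case
      proof cases
        case 1
        then have "x \<notin> K'" "x \<in> K" "x \<in> \<Omega>"
          using mesh_interior_disjoint[OF mesh K'(1) 1] K'(2) interior_subset el(8)[OF mesh(2)] by auto
        then show ?thesis using elem_val_eq[OF mesh const 1] by (simp add: h_def)
      next
        case 2
        then have "x \<notin> K" "x \<in> K'" "x \<in> \<Omega>"
          using mesh_interior_disjoint[OF mesh(1) K'(1) mesh(2) 2] K'(2) interior_subset el(8)[OF K'(1)] by auto
        then show ?thesis using elem_val_eq[OF mesh(1) K'(1) const 2] by (simp add: h_def)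
      next
        case 3
        then show ?thesis using zero[of x] by (simp add: h_def)
      qed
    qed
  qed
  have "h \<in> borel_measurable lebesgue" using h_meas by (simp add: measurable_completion)
  then have "?g \<in> borel_measurable lebesgue" using ae by (rule borel_measurable_AE)
  then have "integral\<^sup>L lebesgue h = integral\<^sup>L lebesgue ?g"
    using \<open>h \<in> borel_measurable lebesgue\<close> ae by (intro integral_cong_AE)
  also have "\<dots> = 0" using div \<phi>(1) by (simp add: divergence_free_def set_lebesgue_integral_def)
  also have "integral\<^sup>L lebesgue h = integral\<^sup>L lborel h" using h_meas by (intro integral_completion)
  finally have "(\<Sum>j\<in>UNIV. (n $ j * I) *\<^sub>R ?L K j + (- n $ j * I) *\<^sub>R ?L K' j) = 0"
    using h_val by simp
  also have "(\<Sum>j\<in>UNIV. (n $ j * I) *\<^sub>R ?L K j + (- n $ j * I) *\<^sub>R ?L K' j) =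
     I *\<^sub>R ((\<Sum>j\<in>UNIV. n $ j *\<^sub>R ?L K j) - (\<Sum>j\<in>UNIV. n $ j *\<^sub>R ?L K' j))"
    by (simp add: scaleR_diff_right scaleR_sum_right sum_subtractf[symmetric] mult.commute)
  finally have "I *\<^sub>R ((\<Sum>j\<in>UNIV. n $ j *\<^sub>R ?L K j) - (\<Sum>j\<in>UNIV. n $ j *\<^sub>R ?L K' j)) = 0" .
  moreover have "I > 0"
  proof -
    obtain b where b: "norm n = 1" "affine hull F = {x. n \<bullet> x = b}"
      using outward_normal[OF el(5,6)[OF mesh(2)] F] unfolding n_def by metis
    have "0 \<le> \<phi> z" for z using \<phi>(2,3)[of z] by (cases "z \<in> ball y r") auto
    then show ?thesis unfolding I_def
      using \<phi>(2) by (intro surface_integral_pos[OF b cF y(1) r(1) c1_continuous_on[OF c1]])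
  qed
  ultimately show ?thesis by (simp add: n_def K'_def)
qed

section \<open>Linear algebra of broken polynomials\<close>

context vector_space
begin

lemma sum_linear_on_subspace:
  assumes f: "\<And>x y. x \<in> V \<Longrightarrow> y \<in> V \<Longrightarrow> f (x + y) = f x + f y"
      "\<And>c x. x \<in> V \<Longrightarrow> f (scale c x) = scale c (f x)"
    and V: "subspace V" and B: "B \<subseteq> V"
  shows "f (\<Sum>b\<in>B. scale (u b) b) = (\<Sum>b\<in>B. scale (u b) (f b))"
proof -
  have f0: "f 0 = 0" using f(2)[of 0 0] subspace_0[OF V] by simp
  show ?thesis using B
  proof (induction B rule: infinite_finite_induct)
    case (insert b B)
    have "(\<Sum>b\<in>B. scale (u b) b) \<in> V" using insert.prems V by (intro subspace_sum subspace_scale) auto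
    moreover have "scale (u b) b \<in> V" using insert.prems V by (intro subspace_scale) auto
    ultimately show ?case using insert f by simp
  qed (simp_all add: f0)
qed

text \<open>Linearity is asked on V only, as \<open>A\<^sub>h\<close> is characterised only there.
  The image of a basis is independent; an element of V outside its span would enlarge it to an
  independent set with more elements than the basis.\<close>

lemma injective_on_span_imp_surj:
  assumes B: "finite B" "V = span B" and f: "\<And>x y. x \<in> V \<Longrightarrow> y \<in> V \<Longrightarrow> f (x + y) = f x + f y"
      "\<And>c x. x \<in> V \<Longrightarrow> f (scale c x) = scale c (f x)"
    and fV: "\<And>x. x \<in> V \<Longrightarrow> f x \<in> V"
    and inj: "\<And>x. x \<in> V \<Longrightarrow> f x = 0 \<Longrightarrow> x = 0"
  shows "bij_betw f V V"
proof -
  have V: "subspace V" using B by simp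
  have inj_on: "inj_on f V"
  proof (rule inj_onI)
    fix x y assume xy: "x \<in> V" "y \<in> V" "f x = f y"
    have m: "scale (- 1) y \<in> V" using V xy(2) by (rule subspace_scale)
    have "f (x + scale (- 1) y) = f x + scale (- 1) (f y)"
      by (simp only: f(1)[OF xy(1) m] f(2)[OF xy(2)])
    then have "f (x + scale (- 1) y) = 0" using xy(3) by simp
    moreover have "x + scale (- 1) y \<in> V" using V xy(1) m by (rule subspace_add)
    ultimately have "x + scale (- 1) y = 0" by (rule inj[rotated])
    then show "x = y" by simp
  qed
  obtain C where C: "C \<subseteq> B" "independent C" "B \<subseteq> span C"
    using maximal_independent_subset[of B] by blast
  have finC: "finite C" using C(1) B(1) finite_subset by blast
  have spanC: "span C = V" using C span_mono[OF C(1)] span_minimal[OF C(3)] B(2) by auto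
  have CV: "C \<subseteq> V" using spanC span_superset by blast
  have inj_C: "inj_on f C" using inj_on CV inj_on_subset by blast
  have ind: "independent (f ` C)"
  proof
    assume "dependent (f ` C)"
    then obtain u where u: "\<exists>v\<in>f ` C. u v \<noteq> 0" "(\<Sum>v\<in>f ` C. scale (u v) v) = 0"
      using dependent_finite[of "f ` C"] finC by blast
    have "f (\<Sum>b\<in>C. scale (u (f b)) b) = (\<Sum>b\<in>C. scale (u (f b)) (f b))"
      by (rule sum_linear_on_subspace[OF f V CV])
    also have "\<dots> = 0" using u(2) by (simp add: sum.reindex[OF inj_C])
    finally have "f (\<Sum>b\<in>C. scale (u (f b)) b) = 0" .
    moreover have "(\<Sum>b\<in>C. scale (u (f b)) b) \<in> V"
      using CV V by (intro subspace_sum subspace_scale) auto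
    ultimately have "(\<Sum>b\<in>C. scale (u (f b)) b) = 0" by (rule inj[rotated])
    moreover obtain b where "b \<in> C" "u (f b) \<noteq> 0" using u(1) by blast
    ultimately have "dependent C"
      by (intro dependent_finite[OF finC, THEN iffD2] exI[of _ "\<lambda>b. u (f b)"]) blast
    then show False using C(2) by simp
  qed
  have "y \<in> f ` V" if y: "y \<in> V" for y
  proof -
    have "y \<in> span (f ` C)"
    proof (rule ccontr)
      assume ny: "y \<notin> span (f ` C)"
      then have "independent (insert y (f ` C))" using ind by (rule independent_insertI)
      moreover have "insert y (f ` C) \<subseteq> span C"
        unfolding spanC by (intro insert_subsetI image_subsetI y fV subsetD[OF CV])
      ultimately have "card (insert y (f ` C)) \<le> card C" by (rule independent_span_bound[OF finC, THEN conjunct2])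
      moreover have "y \<notin> f ` C" using ny span_base[of y "f ` C"] by blast
      ultimately show False using finC by (simp add: card_image[OF inj_C])
    qed
    then obtain u where "y = (\<Sum>v\<in>f ` C. scale (u v) v)" using span_finite[of "f ` C"] finC by auto
    also have "\<dots> = f (\<Sum>b\<in>C. scale (u (f b)) b)"
      using sum_linear_on_subspace[OF f V CV, of "\<lambda>b. u (f b)"] by (simp add: sum.reindex[OF inj_C])
    finally have "y = f (\<Sum>b\<in>C. scale (u (f b)) b)" .
    moreover have "(\<Sum>b\<in>C. scale (u (f b)) b) \<in> V"
      using CV V by (intro subspace_sum subspace_scale) auto
    ultimately show ?thesis by (rule image_eqI)
  qed
  then show ?thesis using inj_on fV by (auto simp: bij_betw_def)
qed

text \<open>In a basis C, the map f sends z to the vector with coordinates \<open>ip z b\<close>.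
  Definiteness makes f injective, hence onto, and z is chosen so that these coordinates are
  \<open>l b\<close>.\<close>

lemma riesz_on_span:
  assumes B: "finite B" "V = span B"
    and add_left: "\<And>x y z. x \<in> V \<Longrightarrow> y \<in> V \<Longrightarrow> z \<in> V \<Longrightarrow> ip (x + y) z = ip x z + ip y z"
    and scale_left: "\<And>c x z. x \<in> V \<Longrightarrow> z \<in> V \<Longrightarrow> ip (scale c x) z = c * ip x z"
    and add_right: "\<And>x y z. x \<in> V \<Longrightarrow> y \<in> V \<Longrightarrow> z \<in> V \<Longrightarrow> ip z (x + y) = ip z x + ip z y"
    and scale_right: "\<And>c x z. x \<in> V \<Longrightarrow> z \<in> V \<Longrightarrow> ip z (scale c x) = c * ip z x"
    and def: "\<And>x. x \<in> V \<Longrightarrow> ip x x = 0 \<Longrightarrow> x = 0"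
    and l_add: "\<And>x y. x \<in> V \<Longrightarrow> y \<in> V \<Longrightarrow> l (x + y) = l x + l y"
    and l_scale: "\<And>c x. x \<in> V \<Longrightarrow> l (scale c x) = c * l x"
  shows "\<exists>z\<in>V. \<forall>v\<in>V. ip z v = l v"
proof -
  have V: "subspace V" using B by simp
  obtain C where C: "C \<subseteq> B" "independent C" "B \<subseteq> span C"
    using maximal_independent_subset[of B] by blast
  have finC: "finite C" using C(1) B(1) finite_subset by blast
  have spanC: "span C = V" using C span_mono[OF C(1)] span_minimal[OF C(3)] B(2) by auto
  have CV: "C \<subseteq> V" using spanC span_superset by blast
  have ext: "g v = h v" if v: "v \<in> V" and C': "\<And>b. b \<in> C \<Longrightarrow> g b = h b"
    and g: "\<And>x y. x \<in> V \<Longrightarrow> y \<in> V \<Longrightarrow> g (x + y) = g x + g y" "\<And>c x. x \<in> V \<Longrightarrow> g (scale c x) = c * g x"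
    and h: "\<And>x y. x \<in> V \<Longrightarrow> y \<in> V \<Longrightarrow> h (x + y) = h x + h y" "\<And>c x. x \<in> V \<Longrightarrow> h (scale c x) = c * h x"
    for g h :: "'b \<Rightarrow> 'a" and v
  proof -
    have "subspace {v \<in> V. g v = h v}"
    proof (rule subspaceI)
      show "0 \<in> {v \<in> V. g v = h v}" using g(2)[of 0 0] h(2)[of 0 0] subspace_0[OF V] by simp
      show "x + y \<in> {v \<in> V. g v = h v}" if "x \<in> {v \<in> V. g v = h v}" "y \<in> {v \<in> V. g v = h v}" for x y
        using that g(1) h(1) subspace_add[OF V] by simp
      show "scale c x \<in> {v \<in> V. g v = h v}" if "x \<in> {v \<in> V. g v = h v}" for c x
        using that g(2) h(2) subspace_scale[OF V] by simp
    qed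
    moreover have "C \<subseteq> {v \<in> V. g v = h v}" using C' CV by blast
    ultimately have "span C \<subseteq> {v \<in> V. g v = h v}" by (intro span_minimal)
    then show ?thesis using v spanC by blast
  qed
  have coeff: "u b = w b" if "(\<Sum>b\<in>C. scale (u b) b) = (\<Sum>b\<in>C. scale (w b) b)" "b \<in> C" for u w b
  proof -
    have "(\<Sum>b\<in>C. scale (u b - w b) b) = 0"
      using that(1) by (simp add: scale_left_diff_distrib sum_subtractf)
    then have "u b - w b \<noteq> 0 \<Longrightarrow> dependent C"
      using that(2) by (intro dependent_finite[OF finC, THEN iffD2] exI[of _ "\<lambda>b. u b - w b"] conjI bexI[of _ b])
    then show ?thesis using C(2) by auto
  qed
  define f where "f z = (\<Sum>b\<in>C. scale (ip z b) b)" for z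
  have "bij_betw f V V"
  proof (rule injective_on_span_imp_surj[OF B])
    show "f (x + y) = f x + f y" if "x \<in> V" "y \<in> V" for x y
      unfolding f_def sum.distrib[symmetric] using that CV
      by (intro sum.cong) (auto simp: add_left scale_left_distrib)
    show "f (scale c x) = scale c (f x)" if "x \<in> V" for c x
      unfolding f_def scale_sum_right using that CV by (intro sum.cong) (auto simp: scale_left)
    show "f x \<in> V" if "x \<in> V" for x
      unfolding f_def using CV V by (intro subspace_sum subspace_scale) auto
    show "x = 0" if x: "x \<in> V" "f x = 0" for x
    proof -
      have "ip x b = 0" if "b \<in> C" for b
        using coeff[of "ip x" "\<lambda>_. 0" b] x(2) that by (simp add: f_def)
      then have "ip x x = 0"
        by (intro ext[OF x(1), of "ip x" "\<lambda>_. 0"]) (simp_all add: x(1) add_right scale_right)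
      then show "x = 0" using def x(1) by blast
    qed
  qed
  moreover have "(\<Sum>b\<in>C. scale (l b) b) \<in> V" using CV V by (intro subspace_sum subspace_scale) auto
  ultimately obtain z where z: "z \<in> V" "f z = (\<Sum>b\<in>C. scale (l b) b)" by (metis bij_betw_imp_surj_on imageE)
  have "ip z b = l b" if "b \<in> C" for b using coeff[of "ip z" l b] z(2) that by (simp add: f_def)
  then have "ip z v = l v" if "v \<in> V" for v
    by (intro ext[OF that, of "ip z" l]) (simp_all add: z(1) add_right scale_right l_add l_scale)
  then show ?thesis using z(1) by blast
qed

end

section \<open>Broken polynomials as a finite-dimensional space\<close>

definition scale_broken :: "real \<Rightarrow> ('n::finite, 'l::finite) broken \<Rightarrow> ('n, 'l) broken"
  where "scale_broken r f = (\<lambda>K x. r *\<^sub>R f K x)"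

interpretation broken: vector_space "scale_broken :: real \<Rightarrow> ('n::finite, 'l::finite) broken \<Rightarrow> _"
  by unfold_locales (auto simp: scale_broken_def fun_eq_iff algebra_simps)

lemma sum_broken_apply: "(\<Sum>i\<in>I. f i) K x = (\<Sum>i\<in>I. f i K x)"
  for f :: "'i \<Rightarrow> ('n::finite, 'l::finite) broken"
  by (induction I rule: infinite_finite_induct) auto

lemma finite_multiindices: "finite {\<alpha> :: 'n::finite \<Rightarrow> nat. sum \<alpha> UNIV \<le> p}"
proof (rule finite_subset)
  show "{\<alpha> :: 'n \<Rightarrow> nat. sum \<alpha> UNIV \<le> p} \<subseteq> PiE UNIV (\<lambda>_. {..p})"
  proof
    fix \<alpha> :: "'n \<Rightarrow> nat" assume "\<alpha> \<in> {\<alpha>. sum \<alpha> UNIV \<le> p}"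
    then have "\<alpha> i \<le> p" for i using member_le_sum[of i UNIV \<alpha>] by simp
    then show "\<alpha> \<in> PiE UNIV (\<lambda>_. {..p})" by auto
  qed
  show "finite (PiE (UNIV :: 'n set) (\<lambda>_. {..p}))" by (intro finite_PiE) auto
qed

lemma polysI: "f = (\<lambda>x. \<Sum>\<alpha> | sum \<alpha> UNIV \<le> p. (\<Prod>i\<in>UNIV. (x $ i) ^ \<alpha> i) *\<^sub>R c \<alpha>) \<Longrightarrow> f \<in> polys p"
  unfolding polys_def by blast

lemma polysE:
  assumes "f \<in> polys p"
  obtains c where "f = (\<lambda>x. \<Sum>\<alpha> | sum \<alpha> UNIV \<le> p. (\<Prod>i\<in>UNIV. (x $ i) ^ \<alpha> i) *\<^sub>R c \<alpha>)"
  using assms unfolding polys_def by blast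

lemma polys_add: "f \<in> polys p \<Longrightarrow> g \<in> polys p \<Longrightarrow> (\<lambda>x. f x + g x) \<in> polys p"
  by (elim polysE, rule polysI[where c="\<lambda>\<alpha>. _ \<alpha> + _ \<alpha>"]) (simp add: scaleR_add_right sum.distrib)

lemma polys_linear:
  assumes "f \<in> polys p" "linear T" shows "(\<lambda>x. T (f x)) \<in> polys p"
  using assms(1)
  by (elim polysE, intro polysI[where c="\<lambda>\<alpha>. T (_ \<alpha>)"])
     (simp add: linear_sum[OF assms(2)] linear_cmul[OF assms(2)])

lemma polys_zero: "(\<lambda>x. 0) \<in> polys p"
  by (rule polysI[where c="\<lambda>_. 0"]) simp

lemma polys_monomial:
  assumes "sum \<beta> UNIV \<le> p"
  shows "(\<lambda>x. (\<Prod>i\<in>UNIV. (x $ i) ^ \<beta> i) *\<^sub>R e) \<in> polys p"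
  by (rule polysI[where c="\<lambda>\<alpha>. if \<alpha> = \<beta> then e else 0"])
     (use assms in \<open>simp add: if_distrib[of "\<lambda>e. _ *\<^sub>R e"] finite_multiindices cong: if_cong\<close>)

lemma polys_c1: "f \<in> polys p \<Longrightarrow> c1 f"
  by (elim polysE)
     (auto intro!: c1_sum c1_bounded_bilinear[OF bounded_bilinear_scaleR] c1_prod c1_power c1_const
        c1_bounded_linear[OF bounded_linear_vec_nth])

text \<open>Along the line from a point of U to y, each component is a univariate polynomial with
  infinitely many roots. Its value at parameter 1 is the component at y.\<close>

lemma polys_eq_0:
  fixes f :: "real^'n \<Rightarrow> real^'l"
  assumes f: "f \<in> polys p" and U: "open U" "U \<noteq> {}" and 0: "\<And>x. x \<in> U \<Longrightarrow> f x = 0"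
  shows "f = (\<lambda>x. 0)"
proof
  fix y
  obtain c where c: "f = (\<lambda>x. \<Sum>\<alpha> | sum \<alpha> UNIV \<le> p. (\<Prod>i\<in>UNIV. (x $ i) ^ \<alpha> i) *\<^sub>R c \<alpha>)"
    using f by (rule polysE)
  obtain x0 e where x0: "e > 0" "ball x0 e \<subseteq> U" using U open_contains_ball by (metis all_not_in_conv)
  define w where "w = y - x0"
  have "f y $ l = 0" for l
  proof -
    define q :: "real poly" where
      "q = (\<Sum>\<alpha> | sum \<alpha> UNIV \<le> p. (\<Prod>i\<in>UNIV. [:x0 $ i, w $ i:] ^ \<alpha> i) * [:c \<alpha> $ l:])"
    have q: "poly q t = f (x0 + t *\<^sub>R w) $ l" for t
      by (simp add: q_def c poly_sum poly_prod poly_power mult.commute[of "c _ $ l"])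
    have "q = 0"
    proof (rule ccontr)
      assume "q \<noteq> 0"
      then have fin: "finite {t. poly q t = 0}" by (rule poly_roots_finite)
      have nw: "norm w + 1 > 0" by (simp add: add_nonneg_pos)
      have "{0<..<e / (norm w + 1)} \<subseteq> {t. poly q t = 0}"
      proof
        fix t assume t: "t \<in> {0<..<e / (norm w + 1)}"
        then have "t * (norm w + 1) < e" using nw by (simp add: field_simps)
        then have "t * norm w < e" using t by (simp add: distrib_left)
        then have "x0 + t *\<^sub>R w \<in> ball x0 e" using t by (simp add: dist_norm)
        then show "t \<in> {t. poly q t = 0}" using 0 x0(2) q by auto
      qed
      then have "finite {0<..<e / (norm w + 1)}" using fin finite_subset by blast
      then show False using x0(1) nw by (simp add: infinite_Ioo)
    qed
    then have "f (x0 + 1 *\<^sub>R w) $ l = 0" using q[of 1] by simp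
    then show ?thesis by (simp add: w_def)
  qed
  then show "f y = 0" by (simp add: vec_eq_iff)
qed

lemma subspace_broken_polys: "broken.subspace (broken_polys \<T> p :: ('n::finite, 'l::finite) broken set)"
proof (rule broken.subspaceI)
  show "(0 :: ('n, 'l) broken) \<in> broken_polys \<T> p" by (simp add: broken_polys_def polys_zero zero_fun_def)
  fix f g :: "('n, 'l) broken" and c
  assume f: "f \<in> broken_polys \<T> p"
  have lin: "linear (\<lambda>v::real^'l. c *\<^sub>R v)" by (rule bounded_linear.linear[OF bounded_linear_scaleR_right])
  show "scale_broken c f \<in> broken_polys \<T> p"
    using f by (simp add: broken_polys_def scale_broken_def polys_linear[OF _ lin])
  assume "g \<in> broken_polys \<T> p"
  then show "f + g \<in> broken_polys \<T> p"
    using f by (simp add: broken_polys_def plus_fun_def polys_add)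
qed

text \<open>Generators are monomials times a unit vector, supported on a single element. This finite
  dimension is behind the existence of \<open>A\<^sub>h\<close> and of the inverses.\<close>

lemma broken_polys_span:
  assumes "finite \<T>"
  obtains E :: "('n::finite, 'l::finite) broken set" where "finite E" "broken_polys \<T> p = broken.span E"
proof
  let ?m = "\<lambda>\<alpha> (x :: real^'n). \<Prod>i\<in>UNIV. (x $ i) ^ \<alpha> i"
  define e :: "(real^'n) set \<times> ('n \<Rightarrow> nat) \<times> 'l \<Rightarrow> ('n, 'l) broken" where
    "e = (\<lambda>(K0, \<alpha>, l) K x. if K = K0 then ?m \<alpha> x *\<^sub>R axis l 1 else 0)"
  let ?A = "{\<alpha> :: 'n \<Rightarrow> nat. sum \<alpha> UNIV \<le> p}"
  define E where "E = e ` (\<T> \<times> ?A \<times> UNIV)"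
  show "finite E" unfolding E_def using assms finite_multiindices by (intro finite_imageI finite_cartesian_product) auto
  have "e (K0, \<alpha>, l) K \<in> polys p" if "sum \<alpha> UNIV \<le> p" for K0 \<alpha> l K
    by (cases "K = K0") (simp_all add: e_def polys_monomial[OF that] polys_zero)
  then have "E \<subseteq> broken_polys \<T> p"
    unfolding E_def broken_polys_def by (auto simp: e_def)
  then have "broken.span E \<subseteq> broken_polys \<T> p" using subspace_broken_polys by (rule broken.span_minimal)
  moreover have "v \<in> broken.span E" if v: "v \<in> broken_polys \<T> p" for v :: "('n, 'l) broken"
  proof -
    have "\<forall>K\<in>\<T>. \<exists>c. v K = (\<lambda>x. \<Sum>\<alpha> | sum \<alpha> UNIV \<le> p. ?m \<alpha> x *\<^sub>R c \<alpha>)"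
    proof
      fix K assume "K \<in> \<T>"
      then have "v K \<in> polys p" using v by (simp add: broken_polys_def)
      then obtain c where "v K = (\<lambda>x. \<Sum>\<alpha> | sum \<alpha> UNIV \<le> p. ?m \<alpha> x *\<^sub>R c \<alpha>)" by (rule polysE)
      then show "\<exists>c. v K = (\<lambda>x. \<Sum>\<alpha> | sum \<alpha> UNIV \<le> p. ?m \<alpha> x *\<^sub>R c \<alpha>)" by (intro exI[of _ c])
    qed
    from bchoice[OF this] obtain c where
      c: "\<forall>K\<in>\<T>. v K = (\<lambda>x. \<Sum>\<alpha> | sum \<alpha> UNIV \<le> p. ?m \<alpha> x *\<^sub>R c K \<alpha>)" ..
    let ?s = "\<Sum>K0\<in>\<T>. \<Sum>\<alpha>\<in>?A. \<Sum>l\<in>UNIV. scale_broken (c K0 \<alpha> $ l) (e (K0, \<alpha>, l))"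
    have "v = ?s"
    proof (intro ext)
      fix K x
      have "?s K x =
        (\<Sum>K0\<in>\<T>. if K = K0 then \<Sum>\<alpha>\<in>?A. \<Sum>l\<in>UNIV. (c K0 \<alpha> $ l) *\<^sub>R (?m \<alpha> x *\<^sub>R axis l 1) else 0)"
        unfolding sum_broken_apply scale_broken_def e_def by (intro sum.cong) auto
      also have "\<dots> = (if K \<in> \<T> then \<Sum>\<alpha>\<in>?A. \<Sum>l\<in>UNIV. (c K \<alpha> $ l) *\<^sub>R (?m \<alpha> x *\<^sub>R axis l 1) else 0)"
        using assms by simp
      also have "\<dots> = (if K \<in> \<T> then \<Sum>\<alpha>\<in>?A. ?m \<alpha> x *\<^sub>R (\<Sum>l\<in>UNIV. (c K \<alpha> $ l) *\<^sub>R axis l 1) else 0)"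
        by (simp add: scaleR_sum_right scaleR_left_commute mult.commute)
      also have "\<dots> = v K x"
      proof (cases "K \<in> \<T>")
        case True
        have "(\<Sum>l\<in>UNIV. (c K \<alpha> $ l) *\<^sub>R axis l 1) = c K \<alpha>" for \<alpha>
          using basis_expansion[of "c K \<alpha>"] by (simp add: scalar_mult_eq_scaleR)
        then show ?thesis using True c by simp
      next
        case False
        then show ?thesis using v by (simp add: broken_polys_def)
      qed
      finally show "v K x = ?s K x" by simp
    qed
    also have "\<dots> \<in> broken.span E"
      by (intro broken.span_sum broken.span_scale broken.span_base) (auto simp: E_def)
    finally show ?thesis .
  qed
  ultimately show "broken_polys \<T> p = broken.span E" by blast
qed

section \<open>Causality and positive definiteness\<close>

lemma linear_matrix_vector_left: "linear (\<lambda>A :: real^'n^'m. A *v e)"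
  by (rule linearI) (simp_all add: matrix_vector_mult_add_rdistrib scaleR_matrix_vector_assoc)

lemma symmetric_matrix_inner:
  fixes A :: "real^'l^'l"
  assumes "transpose A = A" shows "(A *v x) \<bullet> y = x \<bullet> (A *v y)"
  using dot_lmul_matrix[of x A y] assms transpose_matrix_vector[of A x] by simp

text \<open>The form attains its minimum 0 at e, and \<open>A *v e\<close> is half of its gradient
  there. If it were nonzero, a small step against it would make the form negative.\<close>

lemma symmetric_psd_null_vector:
  fixes A :: "real^'l^'l"
  assumes sym: "transpose A = A" and psd: "\<And>h. 0 \<le> h \<bullet> (A *v h)" and e: "e \<bullet> (A *v e) = 0"
  shows "A *v e = 0"
proof (rule ccontr)
  define u where "u = A *v e"
  assume "A *v e \<noteq> 0"
  then have uu: "0 < u \<bullet> u" by (simp add: u_def)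
  define c where "c = u \<bullet> (A *v u)"
  have c: "0 \<le> c" unfolding c_def by (rule psd)
  \<comment> \<open>Small enough for the linear term to dominate the quadratic one; the added 1
    covers c = 0.\<close>
  define s where "s = (u \<bullet> u) / (c + 1)"
  have s: "s > 0" using uu c by (simp add: s_def)
  have "0 \<le> (e - s *\<^sub>R u) \<bullet> (A *v (e - s *\<^sub>R u))" by (rule psd)
  also have "\<dots> = s * (s * c - 2 * (u \<bullet> u))"
  proof -
    have "e \<bullet> (A *v u) = u \<bullet> u" using symmetric_matrix_inner[OF sym, of e u] by (simp add: u_def)
    moreover have "u \<bullet> (A *v e) = u \<bullet> u" by (simp add: u_def)
    ultimately show ?thesis
      by (simp add: matrix_vector_mult_diff_distrib matrix_vector_mult_scaleR inner_diff_left inner_diff_right e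
          c_def[symmetric] algebra_simps)
  qed
  finally have "2 * (u \<bullet> u) \<le> s * c" using s by (simp add: zero_le_mult_iff)
  also have "s * c \<le> s * (c + 1)" using s by (intro mult_left_mono) auto
  also have "\<dots> = u \<bullet> u" using c by (simp add: s_def)
  finally show False using uu by simp
qed

text \<open>The quotient of the two forms attains its maximum on the unit sphere. There
  \<open>\<mu> *\<^sub>R G - D\<close> is positive semidefinite with a zero of its form, and such a
  zero is a null vector.\<close>

lemma generalized_rayleigh:
  fixes D G :: "real^'l^'l"
  assumes D: "transpose D = D" and G: "transpose G = G"
    and \<gamma>: "\<gamma> > 0" "\<And>e. \<gamma> * (norm e)\<^sup>2 \<le> e \<bullet> (G *v e)"
  obtains \<mu> e where "e \<noteq> 0" "D *v e = \<mu> *\<^sub>R (G *v e)" "\<And>h. h \<bullet> (D *v h) \<le> \<mu> * (h \<bullet> (G *v h))"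
proof -
  have Gpos: "0 < e \<bullet> (G *v e)" if "e \<noteq> 0" for e
  proof -
    have "0 < \<gamma> * (norm e)\<^sup>2" using that \<gamma>(1) by simp
    then show ?thesis using \<gamma>(2)[of e] by linarith
  qed
  define f where "f e = (e \<bullet> (D *v e)) / (e \<bullet> (G *v e))" for e
  have cont: "continuous_on S (\<lambda>e. e \<bullet> (A *v e))" for S and A :: "real^'l^'l"
    by (rule continuous_on_inner[OF continuous_on_id linear_continuous_on[OF matrix_vector_mul_bounded_linear]])
  have "\<forall>e\<in>sphere 0 1. e \<bullet> (G *v e) \<noteq> 0"
  proof
    fix e :: "real^'l" assume "e \<in> sphere 0 1"
    then have "e \<noteq> 0" by auto
    then show "e \<bullet> (G *v e) \<noteq> 0" using Gpos[of e] by simp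
  qed
  then have "continuous_on (sphere 0 1) f"
    unfolding f_def by (rule continuous_on_divide[OF cont cont])
  moreover have "sphere (0::real^'l) 1 \<noteq> {}" by simp
  ultimately obtain e where e: "e \<in> sphere 0 1" "\<And>h. h \<in> sphere 0 1 \<Longrightarrow> f h \<le> f e"
    using continuous_attains_sup[of "sphere (0::real^'l) 1" f] by (metis compact_sphere)
  have e0: "e \<noteq> 0" using e(1) by auto
  define \<mu> where "\<mu> = f e"
  have le: "h \<bullet> (D *v h) \<le> \<mu> * (h \<bullet> (G *v h))" for h
  proof (cases "h = 0")
    case False
    define k where "k = h /\<^sub>R norm h"
    have "k \<in> sphere 0 1" using False by (simp add: k_def)
    then have "f k \<le> \<mu>" using e(2) by (simp add: \<mu>_def)
    moreover have "f k = f h" using False by (simp add: f_def k_def matrix_vector_mult_scaleR)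
    ultimately have "(h \<bullet> (D *v h)) / (h \<bullet> (G *v h)) \<le> \<mu>" by (simp only: f_def)
    then show ?thesis using Gpos[OF False] by (simp add: pos_divide_le_eq)
  qed simp
  define A where "A = \<mu> *\<^sub>R G - D"
  have A: "A *v h = \<mu> *\<^sub>R (G *v h) - D *v h" for h
    by (simp add: A_def matrix_vector_mult_diff_rdistrib scaleR_matrix_vector_assoc)
  have "A *v e = 0"
  proof (rule symmetric_psd_null_vector)
    show "transpose A = A" using D G by (simp add: A_def transpose_def vec_eq_iff)
    show "0 \<le> h \<bullet> (A *v h)" for h using le[of h] by (simp add: A inner_diff_right)
    show "e \<bullet> (A *v e) = 0" using Gpos[OF e0] by (simp add: A inner_diff_right \<mu>_def f_def)
  qed
  then have "D *v e = \<mu> *\<^sub>R (G *v e)" by (simp add: A)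
  then show thesis using that e0 le by blast
qed

lemma transpose_sum_scaleR:
  fixes A :: "'n::finite \<Rightarrow> real^'l^'l"
  assumes "\<And>j. transpose (A j) = A j" shows "transpose (\<Sum>j\<in>UNIV. q j *\<^sub>R A j) = (\<Sum>j\<in>UNIV. q j *\<^sub>R A j)"
  using assms by (simp add: transpose_def vec_eq_iff)

text \<open>A real supremum bounds its members only if the set is bounded above, so a uniform bound
  on all eigenvalues has to be supplied.\<close>

lemma eigenvalue_le_wave_speed:
  fixes \<Omega> :: "(real^'n) set" and \<L> :: "'n \<Rightarrow> real^'n \<Rightarrow> real^'l^'l"
  assumes L: "\<And>j. bounded_symmetric \<Omega> (\<L> j)" and G: "uniformly_pos_def \<Omega> \<G>"
    and x: "x \<in> \<Omega>" "norm \<nu> = 1" "e \<noteq> 0" and eig: "(\<Sum>j\<in>UNIV. \<nu> $ j *\<^sub>R \<L> j x) *v e = \<mu> *\<^sub>R (\<G> x *v e)"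
  shows "\<bar>\<mu>\<bar> \<le> wave_speed \<Omega> \<L> \<G>"
proof -
  obtain \<gamma> where \<gamma>: "\<gamma> > 0" "\<And>x e. x \<in> \<Omega> \<Longrightarrow> \<gamma> * (norm e)\<^sup>2 \<le> e \<bullet> (\<G> x *v e)"
    using G by (auto simp: uniformly_pos_def_def)
  have "\<exists>C. \<forall>x\<in>\<Omega>. norm (\<L> j x) \<le> C" for j
    using L[of j] by (auto simp: bounded_symmetric_def bounded_iff)
  then obtain C where C: "\<And>j x. x \<in> \<Omega> \<Longrightarrow> norm (\<L> j x) \<le> C j" by metis
  \<comment> \<open>Bounded entries bound the operator norm with the factor
    \<open>CARD('l) * CARD('l)\<close>; division by \<gamma> accounts for the right-hand side
    \<G>.\<close>
  define R where "R = real CARD('l) * real CARD('l) * (\<Sum>j\<in>UNIV. C j) / \<gamma>"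
  have bound: "\<bar>\<mu>\<bar> \<le> R" if x: "x \<in> \<Omega>" "norm \<nu> = 1" "e \<noteq> 0"
    and eig: "(\<Sum>j\<in>UNIV. \<nu> $ j *\<^sub>R \<L> j x) *v e = \<mu> *\<^sub>R (\<G> x *v e)" for x \<nu> e \<mu>
  proof -
    define D where "D = (\<Sum>j\<in>UNIV. \<nu> $ j *\<^sub>R \<L> j x)"
    have "norm D \<le> (\<Sum>j\<in>UNIV. norm (\<nu> $ j *\<^sub>R \<L> j x))" unfolding D_def by (rule norm_sum)
    also have "\<dots> \<le> (\<Sum>j\<in>UNIV. C j)"
    proof (rule sum_mono)
      fix j
      have "\<bar>\<nu> $ j\<bar> * norm (\<L> j x) \<le> 1 * C j"
        using component_le_norm_cart[of \<nu> j] x(2) C[OF x(1), of j] by (intro mult_mono) auto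
      then show "norm (\<nu> $ j *\<^sub>R \<L> j x) \<le> C j" by simp
    qed
    finally have normD: "norm D \<le> (\<Sum>j\<in>UNIV. C j)" .
    have "\<bar>D $ i $ j\<bar> \<le> (\<Sum>j\<in>UNIV. C j)" for i j
      using component_le_norm_cart[of "D $ i" j] Finite_Cartesian_Product.norm_nth_le[of D i] normD by simp
    then have "onorm ((*v) D) \<le> real CARD('l) * real CARD('l) * (\<Sum>j\<in>UNIV. C j)"
      by (rule onorm_le_matrix_component)
    then have "norm (D *v e) \<le> real CARD('l) * real CARD('l) * (\<Sum>j\<in>UNIV. C j) * norm e"
      using onorm[OF matrix_vector_mul_bounded_linear[of D], of e] by (meson mult_right_mono norm_ge_zero order_trans)
    then have De: "norm (D *v e) \<le> R * \<gamma> * norm e" using \<gamma>(1) by (simp add: R_def)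
    have pos: "0 < \<gamma> * (norm e)\<^sup>2" using \<gamma>(1) x(3) by simp
    have "\<bar>\<mu>\<bar> * (\<gamma> * (norm e)\<^sup>2) \<le> \<bar>\<mu>\<bar> * (e \<bullet> (\<G> x *v e))"
      using \<gamma>(2)[OF x(1)] by (intro mult_left_mono) auto
    also have "\<dots> = \<bar>\<mu> * (e \<bullet> (\<G> x *v e))\<bar>"
      using \<gamma>(2)[OF x(1), of e] pos by (simp add: abs_mult)
    also have "\<mu> * (e \<bullet> (\<G> x *v e)) = e \<bullet> (D *v e)" using eig by (simp add: D_def)
    also have "\<bar>e \<bullet> (D *v e)\<bar> \<le> norm e * norm (D *v e)" by (rule Cauchy_Schwarz_ineq2)
    also have "\<dots> \<le> norm e * (R * \<gamma> * norm e)" using De by (intro mult_left_mono) auto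
    also have "\<dots> = R * (\<gamma> * (norm e)\<^sup>2)" by (simp add: power2_eq_square)
    finally show ?thesis using pos by (rule mult_right_le_imp_le)
  qed
  show ?thesis unfolding wave_speed_def
  proof (rule cSup_upper)
    show "bdd_above {\<bar>\<mu>\<bar> |\<mu>. \<exists>x\<in>\<Omega>. \<exists>\<nu> e. norm \<nu> = 1 \<and> e \<noteq> 0 \<and> (\<Sum>j\<in>UNIV. \<nu> $ j *\<^sub>R \<L> j x) *v e = \<mu> *\<^sub>R (\<G> x *v e)}"
      unfolding bdd_above_def using bound by blast
  qed (use x eig in blast)
qed

text \<open>In the direction of q, the form of the flux matrix is at most its largest eigenvalue
  times the form of \<G>. That eigenvalue is below chat, and the length of q is at most 1 /
  chat.\<close>

lemma causal_pos_def:
  fixes \<Omega> :: "(real^'n) set" and \<L> :: "'n \<Rightarrow> real^'n \<Rightarrow> real^'l^'l"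
  assumes L: "\<And>j. bounded_symmetric \<Omega> (\<L> j)" and G: "bounded_symmetric \<Omega> \<G>" "uniformly_pos_def \<Omega> \<G>"
    and chat: "chat > wave_speed \<Omega> \<L> \<G>" and x: "x \<in> \<Omega>" and q: "norm q \<le> 1 / chat" and e: "e \<noteq> 0"
  shows "(\<Sum>j\<in>UNIV. q $ j * (e \<bullet> (\<L> j x *v e))) < e \<bullet> (\<G> x *v e)"
proof -
  obtain \<gamma> where \<gamma>: "\<gamma> > 0" "\<And>x e. x \<in> \<Omega> \<Longrightarrow> \<gamma> * (norm e)\<^sup>2 \<le> e \<bullet> (\<G> x *v e)"
    using G(2) by (auto simp: uniformly_pos_def_def)
  have "0 < \<gamma> * (norm e)\<^sup>2" using \<gamma>(1) e by simp
  then have Gpos: "0 < e \<bullet> (\<G> x *v e)" using \<gamma>(2)[OF x, of e] by linarith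
  show ?thesis
  proof (cases "q = 0")
    case True
    then show ?thesis using Gpos by simp
  next
    case False
    define \<nu> where "\<nu> = q /\<^sub>R norm q"
    have \<nu>: "norm \<nu> = 1" using False by (simp add: \<nu>_def)
    define D where "D = (\<Sum>j\<in>UNIV. \<nu> $ j *\<^sub>R \<L> j x)"
    have D: "transpose D = D" unfolding D_def
      by (rule transpose_sum_scaleR) (use L x in \<open>simp add: bounded_symmetric_def\<close>)
    have Gs: "transpose (\<G> x) = \<G> x" using G(1) x by (simp add: bounded_symmetric_def)
    obtain \<mu> e0 where \<mu>: "e0 \<noteq> 0" "D *v e0 = \<mu> *\<^sub>R (\<G> x *v e0)" "\<And>h. h \<bullet> (D *v h) \<le> \<mu> * (h \<bullet> (\<G> x *v h))"
      using generalized_rayleigh[OF D Gs \<gamma>(1) \<gamma>(2)[OF x]] by metis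
    have "\<bar>\<mu>\<bar> \<le> wave_speed \<Omega> \<L> \<G>"
      using eigenvalue_le_wave_speed[OF L G(2) x \<nu> \<mu>(1)] \<mu>(2) by (simp add: D_def)
    \<comment> \<open>The bound on the absolute value of \<mu> also yields chat > 0, since the wave
      speed is then nonnegative.\<close>
    then have \<mu>c: "\<mu> < chat" "chat > 0" using chat by auto
    have qj: "q $ j = norm q * \<nu> $ j" for j using False by (simp add: \<nu>_def)
    have "(\<Sum>j\<in>UNIV. q $ j * (e \<bullet> (\<L> j x *v e))) = norm q * (e \<bullet> (D *v e))"
      unfolding qj D_def linear_sum[OF linear_matrix_vector_left]
      by (simp add: linear_cmul[OF linear_matrix_vector_left] inner_sum_right sum_distrib_left mult.assoc)
    also have "\<dots> \<le> norm q * (\<mu> * (e \<bullet> (\<G> x *v e)))" using \<mu>(3) by (intro mult_left_mono) auto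
    also have "\<dots> < norm q * (chat * (e \<bullet> (\<G> x *v e)))"
      using \<mu>c(1) Gpos False by (intro mult_strict_left_mono mult_strict_right_mono) auto
    also have "\<dots> \<le> 1 / chat * (chat * (e \<bullet> (\<G> x *v e)))"
      using q Gpos \<mu>c(2) by (intro mult_right_mono) auto
    also have "\<dots> = e \<bullet> (\<G> x *v e)" using \<mu>c(2) by simp
    finally show ?thesis .
  qed
qed

section \<open>The operators on a causal tent\<close>

lemma bounded_bilinear_matrix_vector_mult:
  "bounded_bilinear (\<lambda>(A :: real^'n^'m) x. A *v x)"
proof (rule bilinear_conv_bounded_bilinear[THEN iffD1])
  show "bilinear (\<lambda>(A :: real^'n^'m) x. A *v x)"
    unfolding bilinear_def using linear_matrix_vector_left by (auto simp: matrix_vector_mul_linear)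
qed

lemma integral_zero_imp_zero_interior:
  fixes h :: "'a::euclidean_space \<Rightarrow> real"
  assumes K: "compact K" and h: "continuous_on UNIV h" and nonneg: "\<And>x. x \<in> K \<Longrightarrow> 0 \<le> h x"
    and zero: "(LINT x:K|lborel. h x) = 0" and x: "x \<in> interior K"
  shows "h x = 0"
proof (rule ccontr)
  assume "h x \<noteq> 0"
  define U where "U = interior K \<inter> {x. h x \<noteq> 0}"
  have "open U" unfolding U_def
    by (intro open_Int open_interior open_Collect_neq h continuous_on_const)
  have "x \<in> U" using x \<open>h x \<noteq> 0\<close> by (simp add: U_def)
  have int: "integrable lborel (\<lambda>x. indicat_real K x *\<^sub>R h x)"
    using set_integrable_lborel_compact[OF K continuous_on_subset[OF h]] by (simp add: set_integrable_def)
  have "AE x in lborel. 0 \<le> indicat_real K x *\<^sub>R h x"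
    using nonneg by (intro AE_I2) (auto simp: indicator_def)
  then have "AE x in lborel. indicat_real K x *\<^sub>R h x = 0"
    using integral_nonneg_eq_0_iff_AE[OF int] zero by (simp add: set_lebesgue_integral_def)
  then have "AE x in lborel. x \<notin> U"
  proof eventually_elim
    case (elim x)
    then show ?case using interior_subset[of K] by (auto simp: U_def indicator_def)
  qed
  then show False using AE_notin_open_imp_empty \<open>open U\<close> \<open>x \<in> U\<close> by blast
qed

lemma affine_partial:
  fixes \<phi> :: "real^'n \<Rightarrow> real"
  assumes "\<And>x. x \<in> K \<Longrightarrow> \<phi> x = g \<bullet> x + b" and "x \<in> interior K"
  shows "partial j \<phi> x = g $ j"
proof -
  have "((\<lambda>x. g \<bullet> x + b) has_derivative (\<lambda>v. g \<bullet> v)) (at x)"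
    by (auto intro!: derivative_eq_intros)
  then have "(\<phi> has_derivative (\<lambda>v. g \<bullet> v)) (at x)"
  proof (rule has_derivative_transform_within_open[OF _ open_interior assms(2)])
    show "g \<bullet> y + b = \<phi> y" if "y \<in> interior K" for y
      using assms(1)[OF subsetD[OF interior_subset that]] by simp
  qed
  then show ?thesis by (simp add: partial_eqI inner_axis)
qed

lemma elem_val_constI:
  assumes "interior K \<noteq> {}" "\<And>x. x \<in> interior K \<Longrightarrow> f x = C" shows "elem_val K f = C"
  unfolding elem_val_def using assms by (intro the_equality) auto

locale causal_tent = tent_dg \<Omega> \<T> \<L> \<G> a \<phi>bot \<phi>top S B p
  for \<Omega> :: "(real^'n) set" and \<T> and \<L> :: "'n \<Rightarrow> real^'n \<Rightarrow> real^'l^'l" and \<G> a \<phi>bot \<phi>top S B p +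
  fixes chat :: real
  assumes open_domain: "open \<Omega>" and mesh: "conforming_mesh \<Omega> \<T>"
    and L_sym: "\<And>j. bounded_symmetric \<Omega> (\<L> j)" and L_const: "\<And>j. constant_on_elements \<T> (\<L> j)"
    and G_sym: "bounded_symmetric \<Omega> \<G>" and G_const: "constant_on_elements \<T> \<G>"
    and G_pos: "uniformly_pos_def \<Omega> \<G>"
    and div_free: "divergence_free \<Omega> \<L>"
    and chat: "chat > wave_speed \<Omega> \<L> \<G>"
    and tent: "tent \<T> a \<phi>bot \<phi>top"
    and causal_bot: "causal \<T> a chat \<phi>bot" and causal_top: "causal \<T> a chat \<phi>top"
    and S: "flux_parameter \<T> (\<Union>(mesh_facets \<T>) - frontier \<Omega>) S"
    and B: "flux_parameter \<T> (frontier \<Omega>) B"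
begin

lemma patch_element:
  assumes "K \<in> patch \<T> a"
  shows "K \<in> \<T>" "a \<in> K" "int CARD('n) simplex K" "compact K" "convex K" "polyhedron K"
    "aff_dim K = int CARD('n)" "interior K \<noteq> {}" "interior K \<subseteq> \<Omega>" "K \<subseteq> closure \<Omega>"
    "finite {F. F facet_of K}"
  using assms mesh_element[OF mesh, of K] finite_polyhedron_facets[of K] by (auto simp: patch_def)

lemma finite_patch: "finite (patch \<T> a)"
  using mesh by (simp add: patch_def conforming_mesh_def)

lemma coefficients_on_element:
  assumes K: "K \<in> patch \<T> a"
  obtains x where "x \<in> \<Omega>" "elem_val K \<G> = \<G> x" "\<And>j. elem_val K (\<L> j) = \<L> j x"
proof -
  obtain x where x: "x \<in> interior K" using patch_element(8)[OF K] by blast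
  show thesis
    using that[of x] elem_val_eq[OF mesh patch_element(1)[OF K] G_const x]
      elem_val_eq[OF mesh patch_element(1)[OF K] L_const x] patch_element(9)[OF K] x by auto
qed

lemma L_elem_sym: "K \<in> patch \<T> a \<Longrightarrow> transpose (elem_val K (\<L> j)) = elem_val K (\<L> j)"
  by (erule coefficients_on_element) (use L_sym[of j] in \<open>simp add: bounded_symmetric_def\<close>)

lemma G_elem_sym: "K \<in> patch \<T> a \<Longrightarrow> transpose (elem_val K \<G>) = elem_val K \<G>"
  by (erule coefficients_on_element) (use G_sym in \<open>simp add: bounded_symmetric_def\<close>)

text \<open>Affine data on one element: \<open>gb + gd\<close> is the gradient of \<phi>top, so both
  norm bounds are the causality conditions.\<close>

lemma tent_on_element:
  assumes K: "K \<in> patch \<T> a"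
  obtains gb gd c where "\<And>x. x \<in> K \<Longrightarrow> \<delta> x = gd \<bullet> x + c"
    "\<And>j. elem_val K (partial j \<phi>bot) = gb $ j" "\<And>j. elem_val K (partial j \<delta>) = gd $ j"
    "norm gb \<le> 1 / chat" "norm (gb + gd) \<le> 1 / chat"
proof -
  obtain gb bb where b: "\<And>x. x \<in> K \<Longrightarrow> \<phi>bot x = gb \<bullet> x + bb"
    using tent K unfolding tent_def affine_on_elements_def by meson
  obtain gt bt where t: "\<And>x. x \<in> K \<Longrightarrow> \<phi>top x = gt \<bullet> x + bt"
    using tent K unfolding tent_def affine_on_elements_def by meson
  have d: "\<delta> x = (gt - gb) \<bullet> x + (bt - bb)" if "x \<in> K" for x
    using b[OF that] t[OF that] by (simp add: \<delta>_def inner_diff_left)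
  obtain y where y: "y \<in> interior K" using patch_element(8)[OF K] by blast
  have "grad \<phi>bot y = gb" "grad \<phi>top y = gt"
    by (simp_all add: grad_def vec_eq_iff affine_partial[of K, OF b y] affine_partial[of K, OF t y])
  then have "norm gb \<le> 1 / chat" "norm gt \<le> 1 / chat"
    using causal_bot causal_top K y unfolding causal_def by auto
  moreover have "elem_val K (partial j \<phi>bot) = gb $ j" for j
    by (rule elem_val_constI[OF patch_element(8)[OF K]]) (rule affine_partial[of K, OF b])
  moreover have "elem_val K (partial j \<delta>) = (gt - gb) $ j" for j
    by (rule elem_val_constI[OF patch_element(8)[OF K]]) (rule affine_partial[of K, OF d])
  ultimately show thesis using that[of "gt - gb" "bt - bb" gb] d by simp
qed

lemma delta_nonneg: "K \<in> patch \<T> a \<Longrightarrow> x \<in> K \<Longrightarrow> 0 \<le> \<delta> x"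
  using tent by (auto simp: tent_def \<delta>_def)

lemma V_c1:
  assumes "w \<in> V\<^sub>h" shows "c1 (w K)"
proof (cases "K \<in> patch \<T> a")
  case True
  then show ?thesis using assms by (auto simp: V\<^sub>h_def broken_polys_def intro: polys_c1)
next
  case False
  then have "w K = (\<lambda>x. 0)" using assms by (simp add: V\<^sub>h_def broken_polys_def)
  then show ?thesis by (simp add: c1_const)
qed

lemma V_continuous: "w \<in> V\<^sub>h \<Longrightarrow> continuous_on A (w K)"
  by (rule c1_continuous_on[OF V_c1])

lemma V_subspace: "broken.subspace V\<^sub>h"
  unfolding V\<^sub>h_def by (rule subspace_broken_polys)

lemma V_span: obtains E where "finite E" "V\<^sub>h = broken.span E"
  using broken_polys_span[OF finite_patch] unfolding V\<^sub>h_def by blast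

lemma V_matrix:
  fixes A :: "(real^'n) set \<Rightarrow> real^'l^'l"
  assumes "w \<in> V\<^sub>h" shows "(\<lambda>K x. A K *v w K x) \<in> V\<^sub>h"
  using assms polys_linear[OF _ matrix_vector_mul_linear]
  by (auto simp: V\<^sub>h_def broken_polys_def)

lemma V_eqI:
  assumes "w \<in> V\<^sub>h" "\<And>K x. K \<in> patch \<T> a \<Longrightarrow> x \<in> interior K \<Longrightarrow> w K x = 0" shows "w = 0"
proof
  fix K
  show "w K = 0 K"
  proof (cases "K \<in> patch \<T> a")
    case True
    then have "w K \<in> polys p" using assms(1) by (simp add: V\<^sub>h_def broken_polys_def)
    then have "w K = (\<lambda>x. 0)"
      by (rule polys_eq_0[OF _ open_interior patch_element(8)[OF True]]) (rule assms(2)[OF True])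
    then show ?thesis by (simp add: zero_fun_def)
  next
    case False
    then show ?thesis using assms(1) by (simp add: V\<^sub>h_def broken_polys_def zero_fun_def)
  qed
qed

section \<open>The mass operators as constant matrices on each element\<close>

text \<open>The dependence on \<tau> is collected in the gradient of
  \<open>\<phi>bot + \<tau> \<delta>\<close>, the intermediate front at pseudotime \<tau>.\<close>

definition M_mat :: "real \<Rightarrow> (real^'n) set \<Rightarrow> real^'l^'l"
  where "M_mat \<tau> K = elem_val K \<G> -
    (\<Sum>j\<in>UNIV. (elem_val K (partial j \<phi>bot) + \<tau> * elem_val K (partial j \<delta>)) *\<^sub>R elem_val K (\<L> j))"

definition M1_mat :: "(real^'n) set \<Rightarrow> real^'l^'l"
  where "M1_mat K = (\<Sum>j\<in>UNIV. elem_val K (partial j \<delta>) *\<^sub>R elem_val K (\<L> j))"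

lemma sum_scaleR_matrix_vector:
  fixes A :: "'i \<Rightarrow> real^'l^'l"
  shows "(\<Sum>j\<in>I. q j *\<^sub>R A j) *v e = (\<Sum>j\<in>I. q j *\<^sub>R (A j *v e))"
  by (simp add: linear_sum[OF linear_matrix_vector_left] linear_cmul[OF linear_matrix_vector_left])

lemma M1_eq: "M\<^sub>1 w = (\<lambda>K x. M1_mat K *v w K x)"
  unfolding M\<^sub>1_def M1_mat_def sum_scaleR_matrix_vector ..

lemma M_eq: "M \<tau> w = (\<lambda>K x. M_mat \<tau> K *v w K x)"
proof (intro ext)
  fix K x
  show "M \<tau> w K x = M_mat \<tau> K *v w K x"
    unfolding M_def M\<^sub>0_def M\<^sub>1_def M_mat_def matrix_vector_mult_diff_rdistrib sum_scaleR_matrix_vector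
    by (simp add: scaleR_add_left sum.distrib scaleR_sum_right)
qed

lemma M0_eq: "M\<^sub>0 w = M 0 w"
  by (simp add: M_def)

lemma M_mat_sym: "K \<in> patch \<T> a \<Longrightarrow> transpose (M_mat \<tau> K) = M_mat \<tau> K"
  using G_elem_sym[of K] transpose_sum_scaleR[of "\<lambda>j. elem_val K (\<L> j)", OF L_elem_sym]
  unfolding M_mat_def by (simp add: transpose_def vec_eq_iff)

text \<open>The gradient of the intermediate front is a convex combination of the gradients of
  bottom and top, so that front is causal as well.\<close>

lemma M_mat_pos:
  assumes K: "K \<in> patch \<T> a" and \<tau>: "0 \<le> \<tau>" "\<tau> \<le> 1" and e: "e \<noteq> 0"
  shows "0 < e \<bullet> (M_mat \<tau> K *v e)"
proof -
  obtain gb gd c where g: "\<And>j. elem_val K (partial j \<phi>bot) = gb $ j" "\<And>j. elem_val K (partial j \<delta>) = gd $ j"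
    "norm gb \<le> 1 / chat" "norm (gb + gd) \<le> 1 / chat" using tent_on_element[OF K] by metis
  obtain x where x: "x \<in> \<Omega>" "elem_val K \<G> = \<G> x" "\<And>j. elem_val K (\<L> j) = \<L> j x"
    using coefficients_on_element[OF K] by metis
  define q where "q = gb + \<tau> *\<^sub>R gd"
  have "q = (1 - \<tau>) *\<^sub>R gb + \<tau> *\<^sub>R (gb + gd)" by (simp add: q_def algebra_simps)
  then have "norm q \<le> norm ((1 - \<tau>) *\<^sub>R gb) + norm (\<tau> *\<^sub>R (gb + gd))" by (simp only: norm_triangle_ineq)
  also have "\<dots> = (1 - \<tau>) * norm gb + \<tau> * norm (gb + gd)" using \<tau> by simp
  also have "\<dots> \<le> (1 - \<tau>) * (1 / chat) + \<tau> * (1 / chat)"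
    using g(3,4) \<tau> by (intro add_mono mult_left_mono) auto
  also have "\<dots> = 1 / chat" unfolding distrib_right[symmetric] by simp
  finally have "norm q \<le> 1 / chat" .
  from causal_pos_def[OF L_sym G_sym G_pos chat x(1) this e]
  show ?thesis
    unfolding M_mat_def matrix_vector_mult_diff_rdistrib sum_scaleR_matrix_vector
    by (simp add: inner_diff_right inner_sum_right g(1,2) x(2,3) q_def)
qed

lemma ip_integrable:
  assumes "w \<in> V\<^sub>h" "v \<in> V\<^sub>h" "K \<in> patch \<T> a"
  shows "set_integrable lborel K (\<lambda>x. w K x \<bullet> v K x)"
  using patch_element(4)[OF assms(3)] V_continuous[OF assms(1)] V_continuous[OF assms(2)]
  by (intro set_integrable_lborel_compact continuous_intros)

lemma ip_commute: "ip w v = ip v w"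
  by (simp add: ip_def inner_commute)

lemma ip_add_left: "x \<in> V\<^sub>h \<Longrightarrow> y \<in> V\<^sub>h \<Longrightarrow> z \<in> V\<^sub>h \<Longrightarrow> ip (x + y) z = ip x z + ip y z"
  unfolding ip_def sum.distrib[symmetric]
  by (intro sum.cong refl) (simp add: inner_add_left set_integral_add ip_integrable)

lemma ip_scale_left: "ip (scale_broken c x) z = c * ip x z"
  unfolding ip_def sum_distrib_left scale_broken_def by (simp add: set_integral_mult_right)

lemma ip_add_right: "x \<in> V\<^sub>h \<Longrightarrow> y \<in> V\<^sub>h \<Longrightarrow> z \<in> V\<^sub>h \<Longrightarrow> ip z (x + y) = ip z x + ip z y"
  using ip_add_left ip_commute by metis

lemma ip_scale_right: "ip z (scale_broken c x) = c * ip z x"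
  using ip_scale_left ip_commute by metis

lemma ip_matrix_nonneg:
  assumes "\<And>K e. K \<in> patch \<T> a \<Longrightarrow> 0 \<le> e \<bullet> (A K *v e)"
  shows "0 \<le> ip (\<lambda>K x. A K *v z K x) z"
  unfolding ip_def set_lebesgue_integral_def
  using assms by (intro sum_nonneg Bochner_Integration.integral_nonneg) (simp add: inner_commute)

lemma ip_matrix_definite:
  assumes A: "\<And>K e. K \<in> patch \<T> a \<Longrightarrow> e \<noteq> 0 \<Longrightarrow> 0 < e \<bullet> (A K *v e)"
    and z: "z \<in> V\<^sub>h" and 0: "ip (\<lambda>K x. A K *v z K x) z = 0"
  shows "z = 0"
proof (rule V_eqI[OF z])
  fix K x assume K: "K \<in> patch \<T> a" and x: "x \<in> interior K"
  have A': "0 \<le> (A K *v e) \<bullet> e" if "K \<in> patch \<T> a" for K e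
    using A[OF that, of e] by (cases "e = 0") (auto simp: inner_commute)
  let ?I = "\<lambda>K. LINT x:K|lborel. (A K *v z K x) \<bullet> z K x"
  have "?I K = 0"
  proof -
    have "\<And>K. K \<in> patch \<T> a \<Longrightarrow> 0 \<le> ?I K"
      unfolding set_lebesgue_integral_def using A' by (intro Bochner_Integration.integral_nonneg) simp
    then show ?thesis using 0 K sum_nonneg_eq_0_iff[OF finite_patch, of ?I] by (simp add: ip_def)
  qed
  moreover have "continuous_on UNIV (\<lambda>x. (A K *v z K x) \<bullet> z K x)"
    using V_continuous[OF z] V_continuous[OF V_matrix[OF z]] by (intro continuous_on_inner)
  ultimately have "(A K *v z K x) \<bullet> z K x = 0"
    using integral_zero_imp_zero_interior[OF patch_element(4)[OF K] _ _ _ x] A'[OF K] by blast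
  then show "z K x = 0" using A[OF K, of "z K x"] by (auto simp: inner_commute)
qed

lemma M_in_V: "w \<in> V\<^sub>h \<Longrightarrow> M \<tau> w \<in> V\<^sub>h"
  unfolding M_eq by (rule V_matrix)

lemma M1_in_V: "w \<in> V\<^sub>h \<Longrightarrow> M\<^sub>1 w \<in> V\<^sub>h"
  unfolding M1_eq by (rule V_matrix)

lemma M_add: "M \<tau> (x + y) = M \<tau> x + M \<tau> y"
  unfolding M_eq by (simp add: fun_eq_iff matrix_vector_right_distrib)

lemma M_scale: "M \<tau> (scale_broken c x) = scale_broken c (M \<tau> x)"
  unfolding M_eq scale_broken_def by (simp add: fun_eq_iff matrix_vector_mult_scaleR)

lemma M_selfadjoint: "ip (M \<tau> x) y = ip (M \<tau> y) x"
  unfolding M_eq ip_def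
proof (rule sum.cong[OF refl])
  fix K assume K: "K \<in> patch \<T> a"
  have "(M_mat \<tau> K *v u) \<bullet> v = (M_mat \<tau> K *v v) \<bullet> u" for u v
    by (subst symmetric_matrix_inner[OF M_mat_sym[OF K]]) (rule inner_commute)
  then show "(LINT t:K|lborel. (M_mat \<tau> K *v x K t) \<bullet> y K t) = (LINT t:K|lborel. (M_mat \<tau> K *v y K t) \<bullet> x K t)"
    by simp
qed

lemma M_nonneg: "0 \<le> \<tau> \<Longrightarrow> \<tau> \<le> 1 \<Longrightarrow> 0 \<le> ip (M \<tau> z) z"
  unfolding M_eq
proof (rule ip_matrix_nonneg)
  fix K e assume "0 \<le> \<tau>" "\<tau> \<le> 1" "K \<in> patch \<T> a"
  then show "0 \<le> e \<bullet> (M_mat \<tau> K *v e)" using M_mat_pos[of K \<tau> e] by (cases "e = 0") auto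
qed

lemma M_definite: "0 \<le> \<tau> \<Longrightarrow> \<tau> \<le> 1 \<Longrightarrow> z \<in> V\<^sub>h \<Longrightarrow> ip (M \<tau> z) z = 0 \<Longrightarrow> z = 0"
  unfolding M_eq by (rule ip_matrix_definite[where A="M_mat \<tau>"]) (simp_all add: M_mat_pos)

lemma ip_definite: "z \<in> V\<^sub>h \<Longrightarrow> ip z z = 0 \<Longrightarrow> z = 0"
  by (rule ip_matrix_definite[where A="\<lambda>_. mat 1"]) simp_all

lemma ip_M_split: "z \<in> V\<^sub>h \<Longrightarrow> ip (M \<tau> z) z = ip (M 0 z) z - \<tau> * ip (M\<^sub>1 z) z"
proof -
  assume z: "z \<in> V\<^sub>h"
  have "M 0 z = M \<tau> z + scale_broken \<tau> (M\<^sub>1 z)" by (simp add: M_def scale_broken_def fun_eq_iff)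
  moreover have "scale_broken \<tau> (M\<^sub>1 z) \<in> V\<^sub>h"
    using M1_in_V[OF z] V_subspace by (intro broken.subspace_scale)
  ultimately have "ip (M 0 z) z = ip (M \<tau> z) z + \<tau> * ip (M\<^sub>1 z) z"
    using ip_add_left[OF M_in_V[OF z] _ z] by (simp add: ip_scale_left)
  then show ?thesis by simp
qed

section \<open>Dissipation of the discontinuous Galerkin form\<close>

lemma V_facet:
  assumes K: "K \<in> patch \<T> a" and F: "F facet_of K"
  obtains b where "norm (outward_normal K F) = 1" "affine hull F = {x. outward_normal K F \<bullet> x = b}"
    "compact F" "F \<subseteq> K" "F \<in> mesh_facets \<T>" "finite_measure (surface_measure F)" "F \<in> sets (surface_measure F)"
proof -
  obtain b where b: "norm (outward_normal K F) = 1" "affine hull F = {x. outward_normal K F \<bullet> x = b}"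
    using outward_normal[OF patch_element(6,7)[OF K] F] by metis
  have F': "compact F" "F \<subseteq> K"
    using compact_facet[OF patch_element(4,5)[OF K] F] facet_of_imp_subset[OF F] by auto
  have "F \<in> mesh_facets \<T>" using patch_element(1)[OF K] F by (auto simp: mesh_facets_def)
  moreover have "F \<in> sets (surface_measure F)"
    by (rule sets_surface_measure_borel) (simp add: F'(1) borel_compact)
  ultimately show thesis
    by (rule that[OF b F' _ finite_measure_surface_measure[OF b F'(1)]])
qed

text \<open>The flux is defined by cases, and \<open>S\<close> and \<open>B\<close> are measurable
  only on their own part of the skeleton. With indicators it becomes a sum of products of bounded
  measurable functions.\<close>

lemma flux_integrable:
  assumes w: "w \<in> V\<^sub>h" and v: "v \<in> V\<^sub>h" and K: "K \<in> patch \<T> a" and F: "F facet_of K"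
  shows "set_integrable (surface_measure F) F (\<lambda>x. (\<delta> x *\<^sub>R flux w K F x) \<bullet> v K x)"
proof -
  obtain b where FF: "norm (outward_normal K F) = 1" "affine hull F = {x. outward_normal K F \<bullet> x = b}"
    "compact F" "F \<subseteq> K" "F \<in> mesh_facets \<T>" "finite_measure (surface_measure F)" "F \<in> sets (surface_measure F)"
    using V_facet[OF K F] .
  obtain gd c where d: "\<And>x. x \<in> K \<Longrightarrow> \<delta> x = gd \<bullet> x + c" using tent_on_element[OF K] by metis
  define X where "X = \<Union>(mesh_facets \<T>) - frontier \<Omega>"
  define fr where "fr = indicat_real (frontier \<Omega>)"
  define wi where "wi = w K"
  \<comment> \<open>\<open>V_c1\<close> holds for every piece, so \<open>wo\<close> is continuous
    even on a boundary facet, where \<open>neighbor\<close> is unspecified.\<close>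
  define wo where "wo = w (neighbor \<T> K F)"
  let ?M = "surface_measure F"
  have fin: "finite (mesh_facets \<T>)"
  proof -
    have "mesh_facets \<T> = (\<Union>K\<in>\<T>. {F. F facet_of K})" by (auto simp: mesh_facets_def)
    moreover have "finite \<T>" using mesh by (simp add: conforming_mesh_def)
    ultimately show ?thesis
      by (simp add: finite_polyhedron_facets mesh_element(5)[OF mesh])
  qed
  have "closed F" if "F \<in> mesh_facets \<T>" for F
    using that compact_facet[OF mesh_element(2,3)[OF mesh]] by (auto simp: mesh_facets_def intro: compact_imp_closed)
  then have "closed (\<Union>(mesh_facets \<T>))" using fin by (intro closed_Union) auto
  then have "\<Union>(mesh_facets \<T>) \<in> sets borel" by (rule borel_closed)
  moreover have "frontier \<Omega> \<in> sets borel" by simp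
  ultimately have X: "X \<in> sets ?M" "frontier \<Omega> \<in> sets ?M"
    unfolding X_def by (simp_all add: sets_surface_measure_borel sets.Diff)
  have S': "bounded_measurable ?M F (\<lambda>x. indicat_real X x *\<^sub>R S x)"
    using S FF(5) by (intro bounded_measurable_restrict[OF X(1)]) (auto simp: flux_parameter_def X_def)
  have B': "bounded_measurable ?M F (\<lambda>x. fr x *\<^sub>R B x)"
    using B FF(5) unfolding fr_def by (intro bounded_measurable_restrict[OF X(2)]) (auto simp: flux_parameter_def)
  have cont: "continuous_on UNIV wi" "continuous_on UNIV wo" "continuous_on UNIV (v K)"
    using V_continuous w v by (auto simp: wi_def wo_def)
  note bm = surface_bounded_measurable_continuous[OF FF(3)]
  have cmv: "continuous_on UNIV (\<lambda>x. A *v f x)" if "continuous_on UNIV f" for A :: "real^'l^'l" and f :: "real^'n \<Rightarrow> real^'l"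
    by (rule bounded_bilinear.continuous_on[OF bounded_bilinear_matrix_vector_mult continuous_on_const that])
  \<comment> \<open>On the boundary the term with the minus sign cancels the mean flux; off the
    boundary all terms with \<open>fr\<close> vanish.\<close>
  define f where "f x = (((fr x *\<^sub>R ((1 / 2) *\<^sub>R (D K F *v wi x)) + (1 / 2) *\<^sub>R ((fr x *\<^sub>R B x) *v wi x)) +
      (D K F *v ((1 / 2) *\<^sub>R (wi x + wo x)) + fr x *\<^sub>R (- (D K F *v ((1 / 2) *\<^sub>R (wi x + wo x)))))) +
      (indicat_real X x *\<^sub>R S x) *v (wi x - wo x))" for x
  have fr: "bounded_measurable ?M F fr" unfolding fr_def by (rule bounded_measurable_indicator[OF X(2)])
  have fm: "bounded_measurable ?M F f"
    unfolding f_def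
  proof (intro bounded_measurable_add)
    show "bounded_measurable ?M F (\<lambda>x. fr x *\<^sub>R ((1 / 2) *\<^sub>R (D K F *v wi x)))"
      by (rule bounded_measurable_bilinear[OF bounded_bilinear_scaleR fr bm]) (intro continuous_intros cmv cont)
    show "bounded_measurable ?M F (\<lambda>x. (1 / 2) *\<^sub>R ((fr x *\<^sub>R B x) *v wi x))"
      by (rule bounded_measurable_bilinear[OF bounded_bilinear_scaleR bm[OF continuous_on_const]
            bounded_measurable_bilinear[OF bounded_bilinear_matrix_vector_mult B' bm[OF cont(1)]]])
    show "bounded_measurable ?M F (\<lambda>x. D K F *v ((1 / 2) *\<^sub>R (wi x + wo x)))"
      by (rule bm) (intro continuous_intros cmv cont)
    show "bounded_measurable ?M F (\<lambda>x. fr x *\<^sub>R (- (D K F *v ((1 / 2) *\<^sub>R (wi x + wo x)))))"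
      by (rule bounded_measurable_bilinear[OF bounded_bilinear_scaleR fr bm]) (intro continuous_intros cmv cont)
    show "bounded_measurable ?M F (\<lambda>x. (indicat_real X x *\<^sub>R S x) *v (wi x - wo x))"
      by (rule bounded_measurable_bilinear[OF bounded_bilinear_matrix_vector_mult S' bm]) (intro continuous_intros cont)
  qed
  have f: "flux w K F x = f x" if "x \<in> F" for x
  proof (cases "x \<in> frontier \<Omega>")
    case True
    then have "x \<notin> X" by (simp add: X_def)
    then show ?thesis using True
      by (simp add: flux_def f_def fr_def wi_def Let_def matrix_vector_mult_add_rdistrib scaleR_add_right)
  next
    case False
    then have "x \<in> X" using that FF(5) by (auto simp: X_def)
    then show ?thesis using False
      by (simp add: flux_def f_def fr_def wi_def wo_def Let_def)
  qed
  have "bounded_measurable ?M F (\<lambda>x. ((gd \<bullet> x + c) *\<^sub>R f x) \<bullet> v K x)"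
    by (rule bounded_measurable_bilinear[OF bounded_bilinear_inner bounded_measurable_bilinear[OF bounded_bilinear_scaleR bm fm] bm])
       (intro continuous_intros cont)+
  then have "set_integrable ?M F (\<lambda>x. ((gd \<bullet> x + c) *\<^sub>R f x) \<bullet> v K x)"
    by (rule bounded_measurable_set_integrable[OF FF(6,7)])
  moreover have "((gd \<bullet> x + c) *\<^sub>R f x) \<bullet> v K x = (\<delta> x *\<^sub>R flux w K F x) \<bullet> v K x" if "x \<in> F" for x
    using f[OF that] d FF(4) that by auto
  ultimately show ?thesis
    by (subst set_integrable_cong[OF refl refl, symmetric]) auto
qed

lemma delta_continuous: "K \<in> patch \<T> a \<Longrightarrow> continuous_on K \<delta>"
proof -
  assume K: "K \<in> patch \<T> a"
  obtain gd c where d: "\<And>x. x \<in> K \<Longrightarrow> \<delta> x = gd \<bullet> x + c" using tent_on_element[OF K] by metis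
  have "continuous_on K (\<lambda>x. gd \<bullet> x + c)" by (intro continuous_intros)
  then show ?thesis using d by (simp cong: continuous_on_cong)
qed

lemma volume_integrable:
  assumes w: "w \<in> V\<^sub>h" and v: "v \<in> V\<^sub>h" and K: "K \<in> patch \<T> a"
  shows "set_integrable lborel K (\<lambda>x. (\<delta> x *\<^sub>R (A *v w K x)) \<bullet> partial j (v K) x)"
proof (rule set_integrable_lborel_compact[OF patch_element(4)[OF K]])
  have "continuous_on K (partial j (v K))"
    unfolding partial_def
    using c1_continuous_frechet_derivative[OF V_c1[OF v]] continuous_on_subset subset_UNIV by blast
  moreover have "continuous_on K (\<lambda>x. A *v w K x)"
    by (rule bounded_bilinear.continuous_on[OF bounded_bilinear_matrix_vector_mult continuous_on_const V_continuous[OF w]])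
  ultimately show "continuous_on K (\<lambda>x. (\<delta> x *\<^sub>R (A *v w K x)) \<bullet> partial j (v K) x)"
    by (intro continuous_on_inner continuous_on_scaleR delta_continuous[OF K])
qed

lemma partial_add:
  "f differentiable (at x) \<Longrightarrow> g differentiable (at x) \<Longrightarrow>
    partial j (\<lambda>x. f x + g x) x = partial j f x + partial j g x"
  unfolding frechet_derivative_works
  by (subst partial_eqI[OF has_derivative_add]) (auto simp: partial_def)

lemma partial_scaleR:
  "f differentiable (at x) \<Longrightarrow> partial j (\<lambda>x. c *\<^sub>R f x) x = c *\<^sub>R partial j f x"
  unfolding frechet_derivative_works
  by (subst partial_eqI[OF has_derivative_scaleR_right]) (auto simp: partial_def)

lemma flux_add: "flux (w + w') K F x = flux w K F x + flux w' K F x"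
  unfolding flux_def Let_def
  by (simp add: matrix_vector_right_distrib matrix_vector_mult_diff_distrib scaleR_add_right algebra_simps)

lemma flux_scale: "flux (scale_broken c w) K F x = c *\<^sub>R flux w K F x"
  unfolding flux_def Let_def scale_broken_def
  by (simp add: matrix_vector_mult_scaleR scaleR_add_right[symmetric] scaleR_diff_right[symmetric])
     (simp add: scaleR_add_right matrix_vector_mult_scaleR)

lemma dg_form_add_left:
  assumes w: "w \<in> V\<^sub>h" "w' \<in> V\<^sub>h" and v: "v \<in> V\<^sub>h"
  shows "dg_form (w + w') v = dg_form w v + dg_form w' v"
proof -
  let ?V = "\<lambda>w v K j. LINT x:K|lborel. (\<delta> x *\<^sub>R (elem_val K (\<L> j) *v w K x)) \<bullet> partial j (v K) x"
  let ?F = "\<lambda>w v K F. LINT x:F|surface_measure F. (\<delta> x *\<^sub>R flux w K F x) \<bullet> v K x"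
  have 1: "(?V (w + w') v K j) =
     (?V w v K j) +
     (?V w' v K j)"
    if K: "K \<in> patch \<T> a" for K j
    using set_integral_add(2)[OF volume_integrable[OF w(1) v K] volume_integrable[OF w(2) v K]]
    by (simp add: matrix_vector_right_distrib scaleR_add_right inner_add_left)
  have 2: "(?F (w + w') v K F) =
     (?F w v K F) +
     (?F w' v K F)"
    if K: "K \<in> patch \<T> a" "F facet_of K" for K F
    using set_integral_add(2)[OF flux_integrable[OF w(1) v K] flux_integrable[OF w(2) v K]]
    by (simp add: flux_add scaleR_add_right inner_add_left)
  show ?thesis unfolding dg_form_def sum.distrib[symmetric]
  proof (rule sum.cong[OF refl])
    fix K assume K: "K \<in> patch \<T> a"
    have s1: "(\<Sum>j\<in>UNIV. ?V (w + w') v K j) = (\<Sum>j\<in>UNIV. ?V w v K j) + (\<Sum>j\<in>UNIV. ?V w' v K j)"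
      unfolding 1[OF K] by (rule sum.distrib)
    have s2: "(\<Sum>F | F facet_of K. ?F (w + w') v K F) = (\<Sum>F | F facet_of K. ?F w v K F) + (\<Sum>F | F facet_of K. ?F w' v K F)"
      unfolding sum.distrib[symmetric] by (rule sum.cong[OF refl], rule 2[OF K]) simp
    show "(\<Sum>j\<in>UNIV. ?V (w + w') v K j) - (\<Sum>F | F facet_of K. ?F (w + w') v K F) =
      ((\<Sum>j\<in>UNIV. ?V w v K j) - (\<Sum>F | F facet_of K. ?F w v K F)) +
      ((\<Sum>j\<in>UNIV. ?V w' v K j) - (\<Sum>F | F facet_of K. ?F w' v K F))"
      unfolding s1 s2 by (rule add_diff_add)
  qed
qed

lemma dg_form_scale_left: "dg_form (scale_broken c w) v = c * dg_form w v"
proof -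
  have 1: "(LINT x:K|lborel. (\<delta> x *\<^sub>R (elem_val K (\<L> j) *v scale_broken c w K x)) \<bullet> partial j (v K) x) =
     c * (LINT x:K|lborel. (\<delta> x *\<^sub>R (elem_val K (\<L> j) *v w K x)) \<bullet> partial j (v K) x)" for K j
  proof -
    have "(\<delta> x *\<^sub>R (elem_val K (\<L> j) *v scale_broken c w K x)) \<bullet> y = c * ((\<delta> x *\<^sub>R (elem_val K (\<L> j) *v w K x)) \<bullet> y)" for x y
      by (simp add: scale_broken_def matrix_vector_mult_scaleR)
    then show ?thesis by (simp only: set_integral_mult_right)
  qed
  have 2: "(LINT x:F|surface_measure F. (\<delta> x *\<^sub>R flux (scale_broken c w) K F x) \<bullet> v K x) =
     c * (LINT x:F|surface_measure F. (\<delta> x *\<^sub>R flux w K F x) \<bullet> v K x)" for K F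
  proof -
    have "(\<delta> x *\<^sub>R flux (scale_broken c w) K F x) \<bullet> y = c * ((\<delta> x *\<^sub>R flux w K F x) \<bullet> y)" for x y
      by (simp add: flux_scale)
    then show ?thesis by (simp only: set_integral_mult_right)
  qed
  show ?thesis unfolding dg_form_def 1 2
    by (simp add: sum_distrib_left right_diff_distrib)
qed

lemma dg_form_add_right:
  assumes w: "w \<in> V\<^sub>h" and v: "v \<in> V\<^sub>h" "v' \<in> V\<^sub>h"
  shows "dg_form w (v + v') = dg_form w v + dg_form w v'"
proof -
  let ?V = "\<lambda>w v K j. LINT x:K|lborel. (\<delta> x *\<^sub>R (elem_val K (\<L> j) *v w K x)) \<bullet> partial j (v K) x"
  let ?F = "\<lambda>w v K F. LINT x:F|surface_measure F. (\<delta> x *\<^sub>R flux w K F x) \<bullet> v K x"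
  have p: "partial j ((v + v') K) x = partial j (v K) x + partial j (v' K) x" for j K x
    using partial_add[OF c1_differentiable[OF V_c1[OF v(1)]] c1_differentiable[OF V_c1[OF v(2)]]]
    by (simp add: plus_fun_def)
  have 1: "(?V w (v + v') K j) =
     (?V w v K j) +
     (?V w v' K j)"
    if K: "K \<in> patch \<T> a" for K j
    using set_integral_add(2)[OF volume_integrable[OF w v(1) K] volume_integrable[OF w v(2) K]]
    by (simp only: p inner_add_right)
  have 2: "(?F w (v + v') K F) =
     (?F w v K F) +
     (?F w v' K F)"
    if K: "K \<in> patch \<T> a" "F facet_of K" for K F
    using set_integral_add(2)[OF flux_integrable[OF w v(1) K] flux_integrable[OF w v(2) K]]
    by (simp add: inner_add_right)
  show ?thesis unfolding dg_form_def sum.distrib[symmetric]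
  proof (rule sum.cong[OF refl])
    fix K assume K: "K \<in> patch \<T> a"
    have s1: "(\<Sum>j\<in>UNIV. ?V w (v + v') K j) = (\<Sum>j\<in>UNIV. ?V w v K j) + (\<Sum>j\<in>UNIV. ?V w v' K j)"
      unfolding 1[OF K] by (rule sum.distrib)
    have s2: "(\<Sum>F | F facet_of K. ?F w (v + v') K F) = (\<Sum>F | F facet_of K. ?F w v K F) + (\<Sum>F | F facet_of K. ?F w v' K F)"
      unfolding sum.distrib[symmetric] by (rule sum.cong[OF refl], rule 2[OF K]) simp
    show "(\<Sum>j\<in>UNIV. ?V w (v + v') K j) - (\<Sum>F | F facet_of K. ?F w (v + v') K F) =
      ((\<Sum>j\<in>UNIV. ?V w v K j) - (\<Sum>F | F facet_of K. ?F w v K F)) +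
      ((\<Sum>j\<in>UNIV. ?V w v' K j) - (\<Sum>F | F facet_of K. ?F w v' K F))"
      unfolding s1 s2 by (rule add_diff_add)
  qed
qed

lemma dg_form_scale_right:
  assumes v: "v \<in> V\<^sub>h" shows "dg_form w (scale_broken c v) = c * dg_form w v"
proof -
  have p: "partial j (scale_broken c v K) x = c *\<^sub>R partial j (v K) x" for j K x
    using partial_scaleR[OF c1_differentiable[OF V_c1[OF v]]] by (simp add: scale_broken_def)
  show ?thesis unfolding dg_form_def p
    by (simp only: scale_broken_def sum_distrib_left right_diff_distrib inner_scaleR_right set_integral_mult_right)
qed

section \<open>Nonnegativity of the facet terms\<close>

text \<open>The facet is the convex hull of its extreme points. These are vertices of the patch
  other than a, where bottom and top agree, and \<open>\<delta>\<close> is affine on K.\<close>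

lemma delta_zero_on_facet:
  assumes K: "K \<in> patch \<T> a" and F: "F facet_of K" and aF: "a \<notin> F" and x: "x \<in> F"
  shows "\<delta> x = 0"
proof -
  obtain gd c where d: "\<And>x. x \<in> K \<Longrightarrow> \<delta> x = gd \<bullet> x + c" using tent_on_element[OF K] by metis
  have fF: "F face_of K" "F \<subseteq> K" using facet_of_imp_face_of[OF F] facet_of_imp_subset[OF F] by auto
  have "F = convex hull {y. y extreme_point_of F}"
    by (rule Krein_Milman_Minkowski[OF compact_facet[OF patch_element(4,5)[OF K] F] face_of_imp_convex[OF fF(1)]])
  also have "\<dots> \<subseteq> {y. gd \<bullet> y = - c}"
  proof (rule hull_minimal)
    show "convex {y. gd \<bullet> y = - c}" by (rule convex_hyperplane)
    show "{y. y extreme_point_of F} \<subseteq> {y. gd \<bullet> y = - c}"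
    proof
      fix y assume "y \<in> {y. y extreme_point_of F}"
      then have y: "y extreme_point_of F" by simp
      then have yF: "y \<in> F" by (simp add: extreme_point_of_def)
      have "y extreme_point_of K" using y extreme_point_of_face[OF fF(1)] by simp
      then have "y \<in> mesh_vertices (patch \<T> a)" using K by (auto simp: mesh_vertices_def)
      moreover have "y \<noteq> a" using yF aF by auto
      ultimately have "\<phi>bot y = \<phi>top y" using tent by (simp add: tent_def)
      then have "\<delta> y = 0" by (simp add: \<delta>_def)
      then show "y \<in> {y. gd \<bullet> y = - c}" using d[of y] yF fF(2) by auto
    qed
  qed
  finally have "gd \<bullet> x = - c" using x by blast
  then show ?thesis using d[of x] x fF(2) by auto
qed

lemma D_sym: "K \<in> patch \<T> a \<Longrightarrow> transpose (D K F) = D K F"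
  unfolding D_def by (rule transpose_sum_scaleR) (rule L_elem_sym)

text \<open>The normal changes sign, while the normal component of \<L> does not jump.\<close>

lemma D_neighbor:
  assumes K: "K \<in> patch \<T> a" and F: "F facet_of K" and x: "x \<in> F" "x \<in> \<Omega>"
  shows "D (neighbor \<T> K F) F = - D K F"
proof -
  note KT = patch_element(1)[OF K]
  note nb = neighbor_exists[OF open_domain mesh KT F x]
  have "outward_normal (neighbor \<T> K F) F = - outward_normal K F"
    by (rule mesh_facet_opposite[OF mesh KT nb(1) F nb(3)]) (use nb(2) in simp)
  then show ?thesis
    unfolding D_def using divergence_free_normal_jump[OF open_domain mesh KT F x L_const div_free]
    by (simp add: sum_negf)
qed

lemma psd_inner: "psd (A + transpose A) \<Longrightarrow> 0 \<le> e \<bullet> (A *v e)"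
proof -
  assume "psd (A + transpose A)"
  then have "0 \<le> e \<bullet> ((A + transpose A) *v e)" by (simp add: psd_def)
  also have "\<dots> = e \<bullet> (A *v e) + e \<bullet> (transpose A *v e)" by (simp add: matrix_vector_mult_add_rdistrib inner_add_right)
  also have "e \<bullet> (transpose A *v e) = e \<bullet> (A *v e)"
    using dot_lmul_matrix[of e A e] transpose_matrix_vector[of A e] by (simp add: inner_commute)
  finally show ?thesis by simp
qed

text \<open>Half of the exact flux is what integration by parts leaves of the volume term on a facet.\<close>

definition dissipation :: "('n, 'l) broken \<Rightarrow> (real^'n) set \<Rightarrow> (real^'n) set \<Rightarrow> real^'n \<Rightarrow> real"
  where "dissipation w K F x =
    (\<delta> x *\<^sub>R flux w K F x) \<bullet> w K x - (1 / 2) * (\<delta> x * ((D K F *v w K x) \<bullet> w K x))"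

text \<open>The \<open>D\<close> parts of the flux and of the subtracted term cancel, which leaves
  \<open>\<delta> / 2\<close> times the form of \<open>B\<close>.\<close>

lemma dissipation_boundary:
  assumes K: "K \<in> patch \<T> a" "F facet_of K" and x: "x \<in> F" "x \<in> frontier \<Omega>"
  shows "0 \<le> dissipation w K F x"
proof -
  have xK: "x \<in> K" using x(1) facet_of_imp_subset[OF K(2)] by blast
  have "psd (B x + transpose (B x))" using B x(2) by (simp add: flux_parameter_def)
  then have "0 \<le> w K x \<bullet> (B x *v w K x)" by (rule psd_inner)
  moreover have "dissipation w K F x = \<delta> x * ((1 / 2) * (w K x \<bullet> (B x *v w K x)))"
    using x(2) by (simp add: dissipation_def flux_def Let_def matrix_vector_mult_add_rdistrib
        inner_add_left inner_commute algebra_simps)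
  ultimately show ?thesis using delta_nonneg[OF K(1) xK] by (simp only:) (intro mult_nonneg_nonneg, simp_all)
qed

text \<open>The two sides see opposite matrices \<open>D\<close>, so the terms in \<open>D\<close>
  cancel by symmetry. What is left is \<open>\<delta>\<close> times the form of \<open>S\<close> at
  the jump.\<close>

lemma dissipation_interior:
  assumes K: "K \<in> patch \<T> a" "F facet_of K" and x: "x \<in> F" "x \<in> \<Omega>" "x \<notin> frontier \<Omega>"
  shows "0 \<le> dissipation w K F x + dissipation w (neighbor \<T> K F) F x"
proof -
  define K' where "K' = neighbor \<T> K F"
  note KT = patch_element(1)[OF K(1)]
  note nb = neighbor_exists[OF open_domain mesh KT K(2) x(1,2), folded K'_def]
  have nK: "neighbor \<T> K' F = K"
    by (rule neighbor_eq[OF mesh nb(1) KT nb(3) K(2) nb(2)])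
  have DK': "D K' F = - D K F" using D_neighbor[OF K x(1,2)] by (simp add: K'_def)
  have xK: "x \<in> K" using x(1) facet_of_imp_subset[OF K(2)] by blast
  have "F \<in> mesh_facets \<T>" using KT K(2) by (auto simp: mesh_facets_def)
  then have "psd (S x + transpose (S x))" using S x(1,3) by (auto simp: flux_parameter_def)
  then have Spos: "0 \<le> (w K x - w K' x) \<bullet> (S x *v (w K x - w K' x))" by (rule psd_inner)
  define u where "u = w K x"
  define u' where "u' = w K' x"
  define j where "j = S x *v (u - u')"
  have j': "S x *v (u' - u) = - j" by (simp add: j_def matrix_vector_mult_diff_distrib)
  have sym: "(D K F *v u') \<bullet> u = (D K F *v u) \<bullet> u'"
    by (subst symmetric_matrix_inner[OF D_sym[OF K(1)]]) (rule inner_commute)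
  have neg: "(- A) *v e = - (A *v e)" for A :: "real^'l^'l" and e
    using linear_neg[OF linear_matrix_vector_left] by blast
  have f: "flux w K F x = (1 / 2) *\<^sub>R (D K F *v u + D K F *v u') + j"
    using x(3) by (simp add: flux_def Let_def K'_def[symmetric] u_def[symmetric] u'_def[symmetric] j_def
        matrix_vector_mult_scaleR matrix_vector_right_distrib)
  have f': "flux w K' F x = (1 / 2) *\<^sub>R (- (D K F *v u') - D K F *v u) - j"
    using x(3) by (simp add: flux_def Let_def nK u_def[symmetric] u'_def[symmetric] DK' neg j'
        matrix_vector_mult_scaleR matrix_vector_right_distrib)
  have "dissipation w K F x + dissipation w K' F x = \<delta> x * ((u - u') \<bullet> j)"
    unfolding dissipation_def f f' DK' neg u_def[symmetric] u'_def[symmetric]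
    by (simp add: inner_add_left inner_diff_left inner_diff_right sym inner_commute[of _ j] algebra_simps)
  then show ?thesis
    using delta_nonneg[OF K(1) xK] Spos by (simp add: u_def u'_def j_def K'_def[symmetric])
qed

text \<open>The case distinction is on the point, because even an interior facet may touch the
  boundary; there each side has the boundary flux and is nonnegative alone. At other points of a
  facet containing a, the neighbor also contains a, so both sides occur in the patch; if a is not in
  F, \<open>\<delta>\<close> vanishes.\<close>

lemma dissipation_sum_nonneg:
  assumes x: "x \<in> F" shows "0 \<le> (\<Sum>K | K \<in> patch \<T> a \<and> F facet_of K. dissipation w K F x)"
proof (cases "x \<in> frontier \<Omega>")
  case True
  then show ?thesis using x by (intro sum_nonneg) (auto intro: dissipation_boundary)
next
  case False
  show ?thesis
  proof (cases "\<exists>K. K \<in> patch \<T> a \<and> F facet_of K")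
    case ex: True
    then obtain K where K: "K \<in> patch \<T> a" "F facet_of K" by blast
    have "x \<in> closure \<Omega>" using x facet_of_imp_subset[OF K(2)] patch_element(10)[OF K(1)] by blast
    then have x\<Omega>: "x \<in> \<Omega>" using False open_domain by (simp add: frontier_def interior_open)
    show ?thesis
    proof (cases "a \<in> F")
      case True
      note KT = patch_element(1)[OF K(1)]
      note nb = neighbor_exists[OF open_domain mesh KT K(2) x x\<Omega>]
      have "a \<in> neighbor \<T> K F" using True facet_of_imp_subset[OF nb(3)] by blast
      then have nP: "neighbor \<T> K F \<in> patch \<T> a" using nb(1) by (simp add: patch_def)
      have "{K. K \<in> patch \<T> a \<and> F facet_of K} = {K, neighbor \<T> K F}"
      proof (intro equalityI subsetI)
        fix L assume "L \<in> {K. K \<in> patch \<T> a \<and> F facet_of K}"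
        then have L: "L \<in> patch \<T> a" "F facet_of L" by auto
        then show "L \<in> {K, neighbor \<T> K F}"
          using neighbor_eq[OF mesh KT patch_element(1)[OF L(1)] K(2) L(2)] by auto
      next
        fix L assume "L \<in> {K, neighbor \<T> K F}"
        then show "L \<in> {K. K \<in> patch \<T> a \<and> F facet_of K}" using K nP nb(3) by auto
      qed
      then show ?thesis using dissipation_interior[OF K x x\<Omega> False] nb(2) by simp
    next
      case aF: False
      have "\<delta> x = 0" by (rule delta_zero_on_facet[OF K aF x])
      then show ?thesis by (simp add: dissipation_def)
    qed
  next
    case none: False
    then have "{K. K \<in> patch \<T> a \<and> F facet_of K} = {}" by blast
    then show ?thesis by (simp only: sum.empty order_refl)
  qed
qed

lemma normal_flux_integrable:
  assumes w: "w \<in> V\<^sub>h" and K: "K \<in> patch \<T> a" and F: "F facet_of K"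
  shows "set_integrable (surface_measure F) F (\<lambda>x. \<delta> x * ((A *v w K x) \<bullet> w K x))"
proof -
  obtain b where FF: "norm (outward_normal K F) = 1" "affine hull F = {x. outward_normal K F \<bullet> x = b}"
    "compact F" "F \<subseteq> K" using V_facet[OF K F] by metis
  obtain gd c where d: "\<And>x. x \<in> K \<Longrightarrow> \<delta> x = gd \<bullet> x + c" using tent_on_element[OF K] by metis
  have "continuous_on UNIV (\<lambda>x. A *v w K x)"
    by (rule bounded_bilinear.continuous_on[OF bounded_bilinear_matrix_vector_mult continuous_on_const V_continuous[OF w]])
  then have "continuous_on UNIV (\<lambda>x. (gd \<bullet> x + c) * ((A *v w K x) \<bullet> w K x))"
    by (intro continuous_intros V_continuous[OF w])
  then have "set_integrable (surface_measure F) F (\<lambda>x. (gd \<bullet> x + c) * ((A *v w K x) \<bullet> w K x))"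
    by (rule set_integrable_surface_measure[OF FF(1-3)])
  moreover have "(gd \<bullet> x + c) * ((A *v w K x) \<bullet> w K x) = \<delta> x * ((A *v w K x) \<bullet> w K x)" if "x \<in> F" for x
    using d[of x] FF(4) that by auto
  ultimately show ?thesis by (subst set_integrable_cong[OF refl refl, symmetric]) auto
qed

lemma dissipation_integrable:
  "w \<in> V\<^sub>h \<Longrightarrow> K \<in> patch \<T> a \<Longrightarrow> F facet_of K \<Longrightarrow>
    set_integrable (surface_measure F) F (dissipation w K F)"
  unfolding dissipation_def[abs_def]
  by (intro set_integral_diff(1) set_integrable_mult_right flux_integrable normal_flux_integrable)

text \<open>Summation is reordered from elements to facets, since on an interior facet only the two
  sides together have a sign.\<close>

lemma total_dissipation_nonneg:
  assumes w: "w \<in> V\<^sub>h"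
  shows "0 \<le> (\<Sum>K\<in>patch \<T> a. \<Sum>F | F facet_of K. LINT x:F|surface_measure F. dissipation w K F x)"
proof -
  let ?FS = "\<Union>K\<in>patch \<T> a. {F. F facet_of K}"
  let ?I = "\<lambda>K F. LINT x:F|surface_measure F. dissipation w K F x"
  have fin: "finite ?FS" using finite_patch patch_element(11) by blast
  have "(\<Sum>K\<in>patch \<T> a. \<Sum>F | F facet_of K. ?I K F) = (\<Sum>K\<in>patch \<T> a. \<Sum>F | F \<in> ?FS \<and> F facet_of K. ?I K F)"
    by (intro sum.cong refl) auto
  also have "\<dots> = (\<Sum>F\<in>?FS. \<Sum>K | K \<in> patch \<T> a \<and> F facet_of K. ?I K F)"
    by (rule sum.swap_restrict[OF finite_patch fin])
  also have "\<dots> \<ge> 0"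
  proof (rule sum_nonneg)
    fix F
    have "(\<Sum>K | K \<in> patch \<T> a \<and> F facet_of K. ?I K F) =
      (LINT x:F|surface_measure F. (\<Sum>K | K \<in> patch \<T> a \<and> F facet_of K. dissipation w K F x))"
      by (rule set_integral_sum(2)[symmetric]) (auto intro: dissipation_integrable[OF w])
    also have "\<dots> \<ge> 0"
      unfolding set_lebesgue_integral_def
      by (rule Bochner_Integration.integral_nonneg) (simp add: dissipation_sum_nonneg indicator_def)
    finally show "0 \<le> (\<Sum>K | K \<in> patch \<T> a \<and> F facet_of K. ?I K F)" .
  qed
  finally show ?thesis .
qed

text \<open>By symmetry of \<L>, the derivative of \<open>\<delta> (\<L> j w) . w\<close> is twice
  the volume integrand plus the gradient term of \<open>M\<^sub>1\<close>; Gauss turns its integral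
  into the facet terms.\<close>

lemma element_energy:
  assumes w: "w \<in> V\<^sub>h" and K: "K \<in> patch \<T> a"
  shows "(\<Sum>j\<in>UNIV. LINT x:K|lborel. (\<delta> x *\<^sub>R (elem_val K (\<L> j) *v w K x)) \<bullet> partial j (w K) x) =
    (1 / 2) * (\<Sum>F | F facet_of K. LINT x:F|surface_measure F. \<delta> x * ((D K F *v w K x) \<bullet> w K x)) -
    (1 / 2) * (LINT x:K|lborel. M\<^sub>1 w K x \<bullet> w K x)"
proof -
  obtain gd c where d: "\<And>x. x \<in> K \<Longrightarrow> \<delta> x = gd \<bullet> x + c" and gd: "\<And>j. elem_val K (partial j \<delta>) = gd $ j"
    using tent_on_element[OF K] by metis
  let ?N = "\<lambda>F. LINT x:F|surface_measure F. \<delta> x * ((D K F *v w K x) \<bullet> w K x)"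
  define L where "L j = elem_val K (\<L> j)" for j
  \<comment> \<open>\<open>\<delta>\<close> is replaced by the affine extension of its restriction
    to K, because Gauss is stated for functions that are \<open>c1\<close> on the whole
    space.\<close>
  define f where "f j x = (gd \<bullet> x + c) * ((L j *v w K x) \<bullet> w K x)" for j x
  let ?f = "\<lambda>F j. outward_normal K F $ j * (LINT x:F|surface_measure F. f j x)"
  let ?q = "\<lambda>j x. (L j *v w K x) \<bullet> w K x"
    and ?v = "\<lambda>j x. ((gd \<bullet> x + c) *\<^sub>R (L j *v w K x)) \<bullet> partial j (w K) x"
  have cw: "c1 (w K)" by (rule V_c1[OF w])
  have cAw: "c1 (\<lambda>x. A *v w K x)" for A :: "real^'l^'l"
    by (rule c1_compose_bounded_linear[OF matrix_vector_mul_bounded_linear cw])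
  have cf: "c1 (f j)" for j
    unfolding f_def
    by (rule c1_bounded_bilinear[OF bounded_bilinear_mult _ c1_bounded_bilinear[OF bounded_bilinear_inner cAw cw]])
       (rule c1_add[OF c1_bounded_linear[OF bounded_linear_inner_right] c1_const])
  have pf: "partial j (f j) x = gd $ j * (?q j x) +
      2 * (?v j x)" for j x
  proof -
    let ?w' = "frechet_derivative (w K) (at x)"
    have dw: "(w K has_derivative ?w') (at x)" by (rule c1_has_derivative[OF cw])
    have dL: "((\<lambda>x. L j *v w K x) has_derivative (\<lambda>h. L j *v ?w' h)) (at x)"
      by (rule bounded_linear.has_derivative[OF matrix_vector_mul_bounded_linear dw])
    have dg: "((\<lambda>x. gd \<bullet> x + c) has_derivative (\<lambda>h. gd \<bullet> h)) (at x)"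
      by (auto intro!: derivative_eq_intros)
    have "(f j has_derivative (\<lambda>h. (gd \<bullet> x + c) * ((L j *v w K x) \<bullet> ?w' h + (L j *v ?w' h) \<bullet> w K x) +
        (gd \<bullet> h) * (?q j x))) (at x)"
      unfolding f_def by (rule has_derivative_mult[OF dg has_derivative_inner[OF dL dw]])
    then have "partial j (f j) x = (gd \<bullet> x + c) * ((L j *v w K x) \<bullet> partial j (w K) x + (L j *v partial j (w K) x) \<bullet> w K x) +
        (gd \<bullet> axis j 1) * (?q j x)"
      unfolding partial_def[of j "w K"] by (rule partial_eqI)
    also have "(L j *v partial j (w K) x) \<bullet> w K x = (L j *v w K x) \<bullet> partial j (w K) x"
      unfolding L_def by (subst symmetric_matrix_inner[OF L_elem_sym[OF K]]) (rule inner_commute)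
    finally show ?thesis by (simp add: inner_axis algebra_simps)
  qed
  let ?V = "\<lambda>j. LINT x:K|lborel. ?v j x"
  let ?Q = "\<lambda>j. LINT x:K|lborel. ?q j x"
  have cont: "continuous_on K (\<lambda>x. ?q j x)" for j
    by (intro continuous_on_inner c1_continuous_on cAw cw)
  have intQ: "set_integrable lborel K (\<lambda>x. ?q j x)" for j
    by (rule set_integrable_lborel_compact[OF patch_element(4)[OF K] cont])
  have intV: "set_integrable lborel K (\<lambda>x. ?v j x)" for j
    using volume_integrable[OF w w K, of "L j" j] d
    by (subst (asm) set_integrable_cong[OF refl refl, where f'="\<lambda>x. ?v j x"]) auto
  have VQ: "(LINT x:K|lborel. partial j (f j) x) = gd $ j * ?Q j + 2 * ?V j" for j
    unfolding pf using set_integral_add(2)[OF set_integrable_mult_right set_integrable_mult_right, OF intQ intV]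
    by simp
  have div: "(LINT x:K|lborel. partial j (f j) x) =
      (\<Sum>F | F facet_of K. ?f F j)" for j
    using simplex_divergence[OF patch_element(3)[OF K] cf, where v="axis j 1"]
    by (simp add: partial_def inner_axis)
  have M1: "(LINT x:K|lborel. M\<^sub>1 w K x \<bullet> w K x) = (\<Sum>j\<in>UNIV. gd $ j * ?Q j)"
  proof -
    have "M\<^sub>1 w K x \<bullet> w K x = (\<Sum>j\<in>UNIV. gd $ j * (?q j x))" for x
      by (simp add: M\<^sub>1_def L_def gd inner_sum_left)
    then show ?thesis
      using set_integral_sum(2)[of UNIV lborel K "\<lambda>j x. gd $ j * (?q j x)"] intQ by simp
  qed
  have surf: "?N F =
      (\<Sum>j\<in>UNIV. ?f F j)" if F: "F facet_of K" for F
  proof -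
    obtain b where FF: "norm (outward_normal K F) = 1" "affine hull F = {x. outward_normal K F \<bullet> x = b}"
      "compact F" "F \<subseteq> K" "F \<in> sets (surface_measure F)" using V_facet[OF K F] by metis
    have "\<delta> x * ((D K F *v w K x) \<bullet> w K x) = (\<Sum>j\<in>UNIV. outward_normal K F $ j * f j x)" if "x \<in> F" for x
    proof -
      have "\<delta> x = gd \<bullet> x + c" using d[of x] that FF(4) by blast
      then show ?thesis
        unfolding D_def sum_scaleR_matrix_vector
        by (simp add: inner_sum_left f_def L_def sum_distrib_left mult_ac)
    qed
    then have "?N F =
      (LINT x:F|surface_measure F. (\<Sum>j\<in>UNIV. outward_normal K F $ j * f j x))"
      by (intro set_lebesgue_integral_cong[OF FF(5)]) auto
    also have "\<dots> = (\<Sum>j\<in>UNIV. LINT x:F|surface_measure F. outward_normal K F $ j * f j x)"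
      by (rule set_integral_sum(2), rule set_integrable_mult_right, rule set_integrable_surface_measure[OF FF(1-3)])
         (rule c1_continuous_on[OF cf])
    finally show ?thesis by simp
  qed
  have "(\<Sum>j\<in>UNIV. gd $ j * ?Q j + 2 * ?V j) =
    (\<Sum>j\<in>UNIV. \<Sum>F | F facet_of K. ?f F j)"
    unfolding VQ[symmetric] div ..
  also have "\<dots> = (\<Sum>F | F facet_of K. \<Sum>j\<in>UNIV. ?f F j)"
    by (rule sum.swap)
  also have "\<dots> = (\<Sum>F | F facet_of K. ?N F)"
    by (intro sum.cong refl) (simp add: surf)
  finally have "(\<Sum>j\<in>UNIV. gd $ j * ?Q j) + 2 * (\<Sum>j\<in>UNIV. ?V j) =
      (\<Sum>F | F facet_of K. ?N F)"
    by (simp add: sum.distrib sum_distrib_left)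
  moreover have "(LINT x:K|lborel. (\<delta> x *\<^sub>R (elem_val K (\<L> j) *v w K x)) \<bullet> partial j (w K) x) = ?V j" for j
  proof (rule set_lebesgue_integral_cong)
    show "K \<in> sets lborel" using patch_element(4)[OF K] by (simp add: borel_compact)
  qed (simp add: d L_def)
  ultimately show ?thesis unfolding M1 by simp
qed

lemma dg_form_energy:
  assumes w: "w \<in> V\<^sub>h" shows "dg_form w w \<le> - (1 / 2) * ip (M\<^sub>1 w) w"
proof -
  let ?J = "\<lambda>K F. LINT x:F|surface_measure F. dissipation w K F x"
  let ?N = "\<lambda>K F. LINT x:F|surface_measure F. \<delta> x * ((D K F *v w K x) \<bullet> w K x)"
  let ?S = "\<lambda>K F. LINT x:F|surface_measure F. (\<delta> x *\<^sub>R flux w K F x) \<bullet> w K x"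
  let ?Q = "\<lambda>K. LINT x:K|lborel. M\<^sub>1 w K x \<bullet> w K x"
  have J: "?J K F = ?S K F - (1 / 2) * ?N K F" if "K \<in> patch \<T> a" "F facet_of K" for K F
    unfolding dissipation_def
    using set_integral_diff(2)[OF flux_integrable[OF w w that] set_integrable_mult_right[OF normal_flux_integrable[OF w that]]]
    by (simp only: set_integral_mult_right)
  have "dg_form w w = (\<Sum>K\<in>patch \<T> a. - (\<Sum>F | F facet_of K. ?J K F) - (1 / 2) * ?Q K)"
    unfolding dg_form_def
  proof (rule sum.cong[OF refl])
    fix K assume K: "K \<in> patch \<T> a"
    have "(\<Sum>F | F facet_of K. ?J K F) = (\<Sum>F | F facet_of K. ?S K F - (1 / 2) * ?N K F)"
      using J[OF K] by (intro sum.cong refl) simp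
    also have "\<dots> = (\<Sum>F | F facet_of K. ?S K F) - (1 / 2) * (\<Sum>F | F facet_of K. ?N K F)"
      by (simp only: sum_subtractf sum_distrib_left)
    finally show "(\<Sum>j\<in>UNIV. LINT x:K|lborel. (\<delta> x *\<^sub>R (elem_val K (\<L> j) *v w K x)) \<bullet> partial j (w K) x) -
        (\<Sum>F | F facet_of K. ?S K F) = - (\<Sum>F | F facet_of K. ?J K F) - (1 / 2) * ?Q K"
      unfolding element_energy[OF w K] by simp
  qed
  also have "\<dots> = - (\<Sum>K\<in>patch \<T> a. \<Sum>F | F facet_of K. ?J K F) - (1 / 2) * ip (M\<^sub>1 w) w"
    by (simp only: sum_subtractf sum_negf sum_distrib_left ip_def)
  finally show ?thesis using total_dissipation_nonneg[OF w] by simp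
qed

section \<open>Stability of the implicit step\<close>

text \<open>Riesz representation gives existence and definiteness of the inner product uniqueness;
  together they resolve the description in \<open>A\<^sub>h\<close>. The uniqueness rule later
  yields linearity.\<close>

lemma A_h:
  assumes w: "w \<in> V\<^sub>h"
  shows "A\<^sub>h w \<in> V\<^sub>h" "\<And>v. v \<in> V\<^sub>h \<Longrightarrow> ip (A\<^sub>h w) v = dg_form w v"
    and A_h_unique: "\<And>z. z \<in> V\<^sub>h \<Longrightarrow> (\<And>v. v \<in> V\<^sub>h \<Longrightarrow> ip z v = dg_form w v) \<Longrightarrow> A\<^sub>h w = z"
proof -
  obtain E where E: "finite E" "V\<^sub>h = broken.span E" by (rule V_span)
  have uniq: "z = z'" if z: "z \<in> V\<^sub>h" "z' \<in> V\<^sub>h" and eq: "\<And>v. v \<in> V\<^sub>h \<Longrightarrow> ip z v = ip z' v" for z z'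
  proof -
    have m: "scale_broken (- 1) z' \<in> V\<^sub>h" using V_subspace z(2) by (rule broken.subspace_scale)
    define d where "d = z + scale_broken (- 1) z'"
    have d: "d \<in> V\<^sub>h" unfolding d_def using V_subspace z(1) m by (rule broken.subspace_add)
    have "ip (z + scale_broken (- 1) z') d = ip z d - ip z' d"
      unfolding ip_add_left[OF z(1) m d] ip_scale_left by simp
    then have "ip d d = ip z d - ip z' d" by (simp only: d_def[symmetric])
    then have "d = 0" using eq[OF d] by (intro ip_definite[OF d]) simp
    then show "z = z'" by (simp add: d_def)
  qed
  obtain z where z: "z \<in> V\<^sub>h" "\<forall>v\<in>V\<^sub>h. ip z v = dg_form w v"
    using broken.riesz_on_span[OF E ip_add_left ip_scale_left ip_add_right ip_scale_right ip_definite
        dg_form_add_right[OF w] dg_form_scale_right] by blast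
  have eqI: "A\<^sub>h w = z'" if "z' \<in> V\<^sub>h" "\<And>v. v \<in> V\<^sub>h \<Longrightarrow> ip z' v = dg_form w v" for z'
    unfolding A\<^sub>h_def
  proof (rule the_equality)
    show "z' \<in> V\<^sub>h \<and> (\<forall>v\<in>V\<^sub>h. ip z' v = dg_form w v)" using that by blast
    show "y = z'" if "y \<in> V\<^sub>h \<and> (\<forall>v\<in>V\<^sub>h. ip y v = dg_form w v)" for y
      by (rule uniq) (use that \<open>z' \<in> V\<^sub>h\<close> \<open>\<And>v. v \<in> V\<^sub>h \<Longrightarrow> ip z' v = dg_form w v\<close> in auto)
  qed
  show "A\<^sub>h w = z'" if "z' \<in> V\<^sub>h" "\<And>v. v \<in> V\<^sub>h \<Longrightarrow> ip z' v = dg_form w v" for z'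
    using that by (rule eqI)
  have "A\<^sub>h w = z" by (rule eqI) (use z in auto)
  then show "A\<^sub>h w \<in> V\<^sub>h" "\<And>v. v \<in> V\<^sub>h \<Longrightarrow> ip (A\<^sub>h w) v = dg_form w v" using z by auto
qed

lemma A_h_add:
  assumes x: "x \<in> V\<^sub>h" and y: "y \<in> V\<^sub>h" shows "A\<^sub>h (x + y) = A\<^sub>h x + A\<^sub>h y"
proof (rule A_h_unique)
  show "x + y \<in> V\<^sub>h" using V_subspace x y by (rule broken.subspace_add)
  show "A\<^sub>h x + A\<^sub>h y \<in> V\<^sub>h" using V_subspace A_h(1)[OF x] A_h(1)[OF y] by (rule broken.subspace_add)
  show "ip (A\<^sub>h x + A\<^sub>h y) v = dg_form (x + y) v" if "v \<in> V\<^sub>h" for v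
    unfolding ip_add_left[OF A_h(1)[OF x] A_h(1)[OF y] that] A_h(2)[OF x that] A_h(2)[OF y that]
      dg_form_add_left[OF x y that] ..
qed

lemma A_h_scale:
  assumes x: "x \<in> V\<^sub>h" shows "A\<^sub>h (scale_broken c x) = scale_broken c (A\<^sub>h x)"
proof (rule A_h_unique)
  show "scale_broken c x \<in> V\<^sub>h" using V_subspace x by (rule broken.subspace_scale)
  show "scale_broken c (A\<^sub>h x) \<in> V\<^sub>h" using V_subspace A_h(1)[OF x] by (rule broken.subspace_scale)
  show "ip (scale_broken c (A\<^sub>h x)) v = dg_form (scale_broken c x) v" if "v \<in> V\<^sub>h" for v
    unfolding ip_scale_left dg_form_scale_left A_h(2)[OF x that] ..
qed

context
  fixes \<tau> :: real
  assumes \<tau>: "0 \<le> \<tau>" "\<tau> \<le> 1"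
begin

lemma M_bij: "bij_betw (M \<tau>) V\<^sub>h V\<^sub>h"
proof -
  obtain E where E: "finite E" "V\<^sub>h = broken.span E" by (rule V_span)
  show ?thesis
  proof (rule broken.injective_on_span_imp_surj[OF E M_add M_scale M_in_V])
    show "x = 0" if "x \<in> V\<^sub>h" "M \<tau> x = 0" for x
    proof (rule M_definite[OF \<tau> that(1)])
      show "ip (M \<tau> x) x = 0" unfolding that(2) by (simp add: ip_def)
    qed
  qed
qed

lemma M_inv:
  assumes "z \<in> V\<^sub>h" shows "M_inv \<tau> z \<in> V\<^sub>h" "M \<tau> (M_inv \<tau> z) = z"
proof -
  have inj: "inj_on (M \<tau>) V\<^sub>h" and z: "z \<in> M \<tau> ` V\<^sub>h" using assms M_bij by (simp_all add: bij_betw_def)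
  show "M_inv \<tau> z \<in> V\<^sub>h" "M \<tau> (M_inv \<tau> z) = z"
    unfolding M_inv_def by (rule the_inv_into_into[OF inj z order_refl], rule f_the_inv_into_f[OF inj z])
qed

lemma M_inv_M: "x \<in> V\<^sub>h \<Longrightarrow> M_inv \<tau> (M \<tau> x) = x"
  unfolding M_inv_def using M_bij by (intro the_inv_into_f_f) (auto simp: bij_betw_def)

lemma M_inv_add:
  assumes "x \<in> V\<^sub>h" "y \<in> V\<^sub>h" shows "M_inv \<tau> (x + y) = M_inv \<tau> x + M_inv \<tau> y"
proof -
  have "M_inv \<tau> x + M_inv \<tau> y \<in> V\<^sub>h"
    using V_subspace M_inv(1)[OF assms(1)] M_inv(1)[OF assms(2)] by (rule broken.subspace_add)
  from M_inv_M[OF this] show ?thesis by (simp only: M_add M_inv(2)[OF assms(1)] M_inv(2)[OF assms(2)])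
qed

lemma M_inv_scale:
  assumes "x \<in> V\<^sub>h" shows "M_inv \<tau> (scale_broken c x) = scale_broken c (M_inv \<tau> x)"
proof -
  have "scale_broken c (M_inv \<tau> x) \<in> V\<^sub>h"
    using V_subspace M_inv(1)[OF assms] by (rule broken.subspace_scale)
  from M_inv_M[OF this] show ?thesis by (simp only: M_scale M_inv(2)[OF assms])
qed

lemma implicit_step_energy:
  assumes u: "u \<in> V\<^sub>h" and v: "v \<in> V\<^sub>h" and eq: "M \<tau> u + scale_broken (- \<tau>) (A\<^sub>h u) = M 0 v"
  shows "ip (M \<tau> u) u \<le> ip (M 0 v) v"
proof -
  have sA: "scale_broken (- \<tau>) (A\<^sub>h u) \<in> V\<^sub>h"
    using V_subspace A_h(1)[OF u] by (rule broken.subspace_scale)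
  have "ip (M 0 v) u = ip (M \<tau> u) u + - \<tau> * dg_form u u"
    unfolding eq[symmetric] ip_add_left[OF M_in_V[OF u] sA u] ip_scale_left A_h(2)[OF u u] ..
  moreover have "\<tau> * dg_form u u \<le> \<tau> * (- (1 / 2) * ip (M\<^sub>1 u) u)"
    using dg_form_energy[OF u] \<tau>(1) by (rule mult_left_mono)
  moreover have "ip (M \<tau> u) u = ip (M 0 u) u - \<tau> * ip (M\<^sub>1 u) u" by (rule ip_M_split[OF u])
  moreover have "2 * ip (M 0 v) u \<le> ip (M 0 v) v + ip (M 0 u) u"
  proof -
    \<comment> \<open>Young's inequality is the nonnegativity of the \<open>M\<^sub>0\<close> form
      at v - u, with the difference written as a sum to match the additivity rules.\<close>
    define m where "m = scale_broken (- 1) u"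
    have m: "m \<in> V\<^sub>h" unfolding m_def using V_subspace u by (rule broken.subspace_scale)
    have vm: "v + m \<in> V\<^sub>h" using V_subspace v m by (rule broken.subspace_add)
    have "0 \<le> ip (M 0 (v + m)) (v + m)" by (rule M_nonneg) simp_all
    also have "\<dots> = ip (M 0 v) v + ip (M 0 v) m + (ip (M 0 m) v + ip (M 0 m) m)"
      unfolding M_add ip_add_left[OF M_in_V[OF v] M_in_V[OF m] vm]
        ip_add_right[OF v m M_in_V[OF v]] ip_add_right[OF v m M_in_V[OF m]] ..
    also have "ip (M 0 m) v = ip (M 0 v) m" by (rule M_selfadjoint)
    also have "ip (M 0 v) m = - ip (M 0 v) u" unfolding m_def ip_scale_right by simp
    also have "ip (M 0 m) m = ip (M 0 u) u" unfolding m_def M_scale ip_scale_left ip_scale_right by simp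
    finally show ?thesis by simp
  qed
  ultimately show ?thesis by simp
qed

lemma strong_stability:
  assumes v: "v \<in> V\<^sub>h" shows "(M_norm \<tau> (R_imp \<tau> v))\<^sup>2 \<le> (M_norm 0 v)\<^sup>2"
proof -
  define T where "T z = (\<lambda>K x. z K x - \<tau> *\<^sub>R A\<^sub>h (M_inv \<tau> z) K x)" for z
  have T: "T z = z + scale_broken (- \<tau>) (A\<^sub>h (M_inv \<tau> z))" for z
    by (simp add: T_def scale_broken_def fun_eq_iff)
  have AM: "A\<^sub>h (M_inv \<tau> z) \<in> V\<^sub>h" if "z \<in> V\<^sub>h" for z
    by (rule A_h(1)[OF M_inv(1)[OF that]])
  have zero: "(0 :: ('n, 'l) broken) \<in> V\<^sub>h" using V_subspace by (rule broken.subspace_0)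
  have M0: "M t 0 = 0" for t unfolding M_eq by (simp add: fun_eq_iff)
  obtain E where E: "finite E" "V\<^sub>h = broken.span E" by (rule V_span)
  have "bij_betw T V\<^sub>h V\<^sub>h"
  proof (rule broken.injective_on_span_imp_surj[OF E])
    show "T (x + y) = T x + T y" if "x \<in> V\<^sub>h" "y \<in> V\<^sub>h" for x y
      unfolding T M_inv_add[OF that] A_h_add[OF M_inv(1)[OF that(1)] M_inv(1)[OF that(2)]]
        broken.scale_right_distrib by (simp add: add_ac)
    show "T (scale_broken c x) = scale_broken c (T x)" if "x \<in> V\<^sub>h" for c x
      unfolding T M_inv_scale[OF that] A_h_scale[OF M_inv(1)[OF that]] broken.scale_right_distrib
        broken.scale_scale by (simp add: mult.commute)
    show "T x \<in> V\<^sub>h" if "x \<in> V\<^sub>h" for x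
      unfolding T using V_subspace AM[OF that] that by (intro broken.subspace_add broken.subspace_scale)
    show "x = 0" if x: "x \<in> V\<^sub>h" "T x = 0" for x
    proof -
      let ?u = "M_inv \<tau> x"
      have u: "?u \<in> V\<^sub>h" "M \<tau> ?u = x" using M_inv[OF x(1)] by auto
      \<comment> \<open>A kernel element x is translated into a solution \<open>?u\<close> of the
        implicit step with zero data.\<close>
      have "M \<tau> ?u + scale_broken (- \<tau>) (A\<^sub>h ?u) = M 0 0" using x(2) unfolding T u(2) M0 .
      then have "ip (M \<tau> ?u) ?u \<le> ip (M 0 0) 0" by (rule implicit_step_energy[OF u(1) zero])
      also have "\<dots> = 0" by (simp add: ip_def)
      finally have "ip (M \<tau> ?u) ?u = 0" using M_nonneg[OF \<tau>, of ?u] by simp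
      then have "?u = 0" by (rule M_definite[OF \<tau> u(1)])
      then show "x = 0" using u(2) M0 by simp
    qed
  qed
  then have inj: "inj_on T V\<^sub>h" and im: "T ` V\<^sub>h = V\<^sub>h" by (auto simp: bij_betw_def)
  define z where "z = the_inv_into V\<^sub>h T (M\<^sub>0 v)"
  have Mv: "M\<^sub>0 v \<in> T ` V\<^sub>h" unfolding im M0_eq by (rule M_in_V[OF v])
  have z: "z \<in> V\<^sub>h" "T z = M\<^sub>0 v"
    unfolding z_def using the_inv_into_into[OF inj Mv order_refl] f_the_inv_into_f[OF inj Mv] by auto
  have R: "R_imp \<tau> v = M_inv \<tau> z" by (simp add: R_imp_def z_def T_def[abs_def])
  have u: "M_inv \<tau> z \<in> V\<^sub>h" "M \<tau> (M_inv \<tau> z) = z" using M_inv[OF z(1)] by auto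
  have "ip (M \<tau> (M_inv \<tau> z)) (M_inv \<tau> z) \<le> ip (M 0 v) v"
    by (rule implicit_step_energy[OF u(1) v]) (use z(2) in \<open>simp only: T u(2) M0_eq\<close>)
  then show ?thesis
    unfolding R M_norm_def using M_nonneg[OF \<tau>] M_nonneg[of 0] by simp
qed

end

end

theorem lemma4p7:
  fixes \<Omega> :: "(real^'n) set"
    and \<T> :: "(real^'n) set set"
    and \<L> :: "'n \<Rightarrow> real^'n \<Rightarrow> real^'l^'l"
    and \<G> :: "real^'n \<Rightarrow> real^'l^'l"
    and a :: "real^'n"
    and \<phi>bot \<phi>top :: "real^'n \<Rightarrow> real"
    and S B :: "real^'n \<Rightarrow> real^'l^'l"
    and p :: nat
    and chat \<tau> :: real
    and v :: "('n, 'l) broken"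
  assumes "open \<Omega>" and "bounded \<Omega>" and "conforming_mesh \<Omega> \<T>"
    and "\<And>j. bounded_symmetric \<Omega> (\<L> j)" and "\<And>j. constant_on_elements \<T> (\<L> j)"
    and "bounded_symmetric \<Omega> \<G>" and "constant_on_elements \<T> \<G>"
    and "uniformly_pos_def \<Omega> \<G>"
    and "divergence_free \<Omega> \<L>"
    and "chat > wave_speed \<Omega> \<L> \<G>"
    and "tent \<T> a \<phi>bot \<phi>top"
    and "causal \<T> a chat \<phi>bot" and "causal \<T> a chat \<phi>top"
    and "flux_parameter \<T> (\<Union>(mesh_facets \<T>) - frontier \<Omega>) S"
    and "flux_parameter \<T> (frontier \<Omega>) B"
    and "v \<in> tent_dg.V\<^sub>h \<T> a p"
    and "0 \<le> \<tau>" and "\<tau> \<le> 1"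
  shows "(tent_dg.M_norm \<T> \<L> \<G> a \<phi>bot \<phi>top \<tau>
            (tent_dg.R_imp \<Omega> \<T> \<L> \<G> a \<phi>bot \<phi>top S B p \<tau> v))\<^sup>2
         \<le> (tent_dg.M_norm \<T> \<L> \<G> a \<phi>bot \<phi>top 0 v)\<^sup>2"
proof -
  interpret causal_tent \<Omega> \<T> \<L> \<G> a \<phi>bot \<phi>top S B p chat
    by unfold_locales (fact assms)+
  show ?thesis using assms(17,18,16) by (rule strong_stability)
qed

end
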